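(* Let $\pi=(\pi^n)_{n\ge1}$, $\pi^n=(0=t^n_0<\cdots<t^n_{m(n)}=T)$, be a sequence of partitions of $[0,T]$, let $a:[0,T]\to S^d_+$ be a continuous function with values in the positive-definite symmetric $d\times d$ matrices, and let $\bar\omega\in Q_\pi([0,T],\mathbb{R}^d)\cap C^\nu([0,T],\mathbb{R}^d)$ with $\nu>\frac{\sqrt3-1}{2}$, $\frac{d[\bar\omega]_\pi}{dt}=a$, and $\max_{j}\sup_{t\in(t^n_j,t^n_{j+1}]}|\bar\omega(t)-\bar\omega(t^n_j)|\to0$ as $n\to\infty$. Then the map $$I_{\bar\omega}:\big(\mathbb{V}_a(\bar\omega),\|\cdot\|_{L^2([0,T],a)}\big)\to\big(\mathcal{H}_a(\bar\omega),\|\cdot\|_\pi\big),\qquad \phi=\nabla_\omega F(\cdot,\bar\omega)\mapsto I_{\bar\omega}(\phi)=\int_0^{\cdot}\phi\,d^\pi\bar\omega ,$$ is an injective isometry, i.e. it is injective and $\|I_{\bar\omega}(\phi)\|_\pi=\|\phi\|_{L^2([0,T],a)}$ for all $\phi\in\mathbb{V}_a(\bar\omega)$.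
   Context: Fix $T>0$ and $d\ge 1$. $D([0,T],\mathbb{R}^d)$ is the set of càdlàg paths. For a path $\omega$, $\omega_t:=\omega(t\wedge\cdot)$ is the path stopped at $t$, and $\omega_{t-}$ is the path equal to $\omega$ on $[0,t)$ and to $\omega(t-)$ on $[t,T]$. The space of stopped paths $\Lambda_T=\Lambda^d_T=\{(t,\omega_t):(t,\omega)\in[0,T]\times D([0,T],\mathbb{R}^d)\}$ carries the metric $d_\infty((t,\omega),(t',\omega'))=\|\omega_t-\omega'_{t'}\|_\infty+|t-t'|$, where $\|\cdot\|_\infty$ is the sup norm on $[0,T]$. A non-anticipative functional is a measurable map $F:(\Lambda^d_T,d_\infty)\to\mathbb{R}$ (so $F(t,\omega)=F(t,\omega_t)$); vector- or matrix-valued functionals are treated componentwise. Regularity: $F$ is continuous at fixed times if for all $t,\omega,\epsilon>0$ there is $\eta>0$ such that $\|\omega_t-\omega'_t\|_\infty<\eta$ implies $|F(t,\omega)-F(t,\omega')|<\epsilon$. $F$ is left-continuous ($F\in\mathbb{C}^{0,0}_l(\Lambda^d_T)$) if for all $(t,\omega)\in\Lambda_T^d$, $\epsilon>0$ there is $\eta>0$ such that for $(t',\omega')\in\Lambda_T^d$, $t'<t$ and $d_\infty((t,\omega),(t',\omega'))<\eta$ imply $|F(t,\omega)-F(t',\omega')|<\epsilon$. $F$ is boundedness-preserving ($F\in\mathbb{B}(\Lambda^d_T)$) if for every compact $K\subset\mathbb{R}^d$ and $t_0\in[0,T]$ there is $C(K,t_0)>0$ with $|F(t,\omega)|<C(K,t_0)$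 whenever $t\le t_0$ and $\omega([0,t])\subset K$. Derivatives: the horizontal derivative is $\mathcal{D}F(t,\omega)=\lim_{h\to0^+}\frac{F(t+h,\omega_t)-F(t,\omega_t)}{h}$ (for $t<T$, so that $t+h\le T$). The vertical derivative $\nabla_\omega F(t,\omega)\in\mathbb{R}^d$ is the gradient at $e=0$ of $e\mapsto F(t,\omega_t+e\mathbf{1}_{[t,T]})$ (this map being required to be differentiable at $0$); $\nabla^j_\omega F$ is the iterated vertical derivative, $\nabla_\omega^0F=F$. $\mathbb{C}^{1,k}_b(\Lambda^d_T)$ is the set of non-anticipative functionals $F$ that are horizontally differentiable with $\mathcal{D}F$ continuous at fixed times, $k$ times vertically differentiable with $\nabla^j_\omega F\in\mathbb{C}^{0,0}_l(\Lambda^d_T)$ for $j=0,\dots,k$, and with $\mathcal{D}F,\nabla_\omega F,\dots,\nabla^k_\omega F\in\mathbb{B}(\Lambda^d_T)$. $Lip(\Lambda^d_T,\|\cdot\|_\infty)$ is the set of non-anticipative functionals for which there is $K>0$ with $|F(t,\omega)-F(t,\omega')|\le K\|\omega_t-\omega'_t\|_\infty$ for all $t\in[0,T]$ and all $\omega,\omega'\in D([0,T],\mathbb{R}^d)$. Quadratic variation: a càdlàg $x:[0,T]\to\mathbb{R}$ is in $Q_\pi([0,T],\mathbb{R})$ if for every $t\in[0,T]$ the limit $[x]_\pi(t)=\lim_{n}\sum_{t^n_{i+1}\le t}(x(t^n_{i+1})-x(t^n_i))^2<\infty$ exists and $[x]_\pi(t)=[x]^c_\pi(t)+\sum_{0<s\le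 t}|\Delta x(s)|^2$ with $[x]_\pi^c$ continuous and increasing. $x\in Q_\pi([0,T],\mathbb{R}^d)$ if $x^i$ and $x^i+x^j$ are in $Q_\pi([0,T],\mathbb{R})$ for all $i,j$; then $[x]_\pi$ is the $d\times d$ symmetric matrix-valued function $[x]^{ij}_\pi=\frac12([x^i+x^j]_\pi-[x^i]_\pi-[x^j]_\pi)$. For square matrices $\langle A,B\rangle=\mathrm{tr}(AB)$, and ${}^t$ denotes transpose. $C^\nu([0,T],\mathbb{R}^d)$, $0<\nu<1$, is the space of $\nu$-Hölder continuous functions. Pathwise integral: for continuous $\omega$ let $\omega^n=\sum_{i}\omega(t^n_{i+1})\mathbf{1}_{[t^n_i,t^n_{i+1})}+\omega(T)\mathbf{1}_{\{T\}}$. Then $\int_0^t\nabla_\omega F(s,\omega)\,d^\pi\omega:=\lim_{n}\sum_{i=0}^{m(n)-1}\nabla_\omega F(t^n_i,\omega^n_{t^n_i-})\cdot(\omega(t^n_{i+1}\wedge t)-\omega(t^n_i\wedge t))$. Function spaces of the statement: $\mathcal{R}(\Lambda_T)$ is the set of $F\in\mathbb{C}^{1,2}_b(\Lambda^d_T)\cap Lip(\Lambda^d_T,\|\cdot\|_\infty)$ with $\nabla_\omega F\in\mathbb{C}^{1,1}_b(\Lambda^d_T)$ and $\max_i|F(t^n_{i+1},\bar\omega)-F(t^n_i,\bar\omega)|\to0$ as $n\to\infty$. $F\in\mathcal{R}(\Lambda_T)$ is called $a$-harmonic if $\mathcal{D}F(t,\omega_t)+\frac12\langle\nabla^2_\omega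 F(t,\omega_t),a(t)\rangle=0$ for all $(t,\omega)\in\Lambda_T$; $\mathcal{H}_a(\Lambda_T)$ is the space of $a$-harmonic functionals. Set $\mathcal{H}_a(\bar\omega)=\{F(\cdot,\bar\omega_\cdot):F\in\mathcal{H}_a(\Lambda_T)\}\subset Q_\pi([0,T],\mathbb{R})$ and $\mathbb{V}_a(\bar\omega)=\{\nabla_\omega F(\cdot,\bar\omega_\cdot):F\in\mathcal{H}_a(\Lambda_T)\}\subset L^2([0,T],a)$, where $\|\phi\|^2_{L^2([0,T],a)}=\int_0^T{}^t\phi(u)a(u)\phi(u)\,du$, and for $x\in\mathcal{H}_a(\bar\omega)$ put $\|x\|_\pi=\sqrt{[x]_\pi(T)}$. For $\phi\in\mathbb{V}_a(\bar\omega)$, $\phi=\nabla_\omega F(\cdot,\bar\omega)$ with $F\in\mathcal{H}_a(\Lambda_T)$, $\int_0^\cdot\phi\,d^\pi\bar\omega:=\int_0^\cdot\nabla_\omega F(s,\bar\omega)\,d^\pi\bar\omega$. *)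

theory Defs
  imports "HOL-Analysis.Analysis"
begin

section \<open>Stopped paths\<close>

type_synonym 'd path = "real \<Rightarrow> (real, 'd) vec"
type_synonym 'd functional = "real \<times> 'd path \<Rightarrow> real"

text \<open>Paths live on \<open>[0,T]\<close>. Elements of the path space are normalised to be \<open>undefined\<close>
  outside \<open>[0,T]\<close>, so that equality of functions is equality on \<open>[0,T]\<close>.\<close>

definition cadlag :: "real \<Rightarrow> (real \<Rightarrow> 'a::real_normed_vector) \<Rightarrow> bool" where
  "cadlag T x \<longleftrightarrow>
     (\<forall>t\<in>{0..<T}. (x \<longlongrightarrow> x t) (at_right t)) \<and>
     (\<forall>t\<in>{0<..T}. \<exists>l. (x \<longlongrightarrow> l) (at_left t))"

definition cadlag_paths :: "real \<Rightarrow> ('d::finite) path set" where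
  "cadlag_paths T = {\<omega> \<in> extensional {0..T}. cadlag T \<omega>}"

definition sup_norm :: "real \<Rightarrow> (real \<Rightarrow> 'a::real_normed_vector) \<Rightarrow> real" where
  "sup_norm T x = (SUP s\<in>{0..T}. norm (x s))"

definition stop :: "real \<Rightarrow> real \<Rightarrow> ('d::finite) path \<Rightarrow> 'd path" where
  "stop T t \<omega> = restrict (\<lambda>s. \<omega> (min t s)) {0..T}"

text \<open>The left limit at time \<open>0\<close> is by convention the value at \<open>0\<close>.\<close>

definition left_lim :: "(real \<Rightarrow> 'a::real_normed_vector) \<Rightarrow> real \<Rightarrow> 'a" where
  "left_lim x t = (if t \<le> 0 then x t else Lim (at_left t) x)"

definition stop_left :: "real \<Rightarrow> real \<Rightarrow> ('d::finite) path \<Rightarrow> 'd path" where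
  "stop_left T t \<omega> = restrict (\<lambda>s. if s < t then \<omega> s else left_lim \<omega> t) {0..T}"

definition stopped_paths :: "real \<Rightarrow> (real \<times> ('d::finite) path) set" where
  "stopped_paths T = {(t, stop T t \<omega>) | t \<omega>. t \<in> {0..T} \<and> \<omega> \<in> cadlag_paths T}"

definition d_inf :: "real \<Rightarrow> real \<times> ('d::finite) path \<Rightarrow> real \<times> 'd path \<Rightarrow> real" where
  "d_inf T p q = sup_norm T (\<lambda>s. snd p s - snd q s) + \<bar>fst p - fst q\<bar>"

section \<open>Non-anticipative functionals\<close>

text \<open>A functional is a map on stopped paths, so \<open>F(t,\<omega>)\<close> is rendered \<open>F (t, stop T t \<omega>)\<close>;
  its values off \<^term>\<open>stopped_paths T\<close> are irrelevant.\<close>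

definition nonanticipative :: "real \<Rightarrow> ('d::finite) functional \<Rightarrow> bool" where
  "nonanticipative T F \<longleftrightarrow>
     F \<in> borel_measurable (sigma (stopped_paths T)
           {U. openin (Metric_space.mtopology (stopped_paths T) (d_inf T)) U})"

definition left_continuous :: "real \<Rightarrow> ('d::finite) functional \<Rightarrow> bool" where
  "left_continuous T F \<longleftrightarrow>
     (\<forall>p\<in>stopped_paths T. \<forall>\<epsilon>>0. \<exists>\<eta>>0. \<forall>q\<in>stopped_paths T.
        fst q < fst p \<and> d_inf T p q < \<eta> \<longrightarrow> \<bar>F p - F q\<bar> < \<epsilon>)"

text \<open>The horizontal derivative exists at times \<open>t < T\<close> only. The next two notions therefore take
  the set of admissible times as a parameter: \<open>{0..T}\<close> in general, \<open>{0..<T}\<close> for \<open>\<D>F\<close>.\<close>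

definition continuous_fixed_times :: "real \<Rightarrow> real set \<Rightarrow> ('d::finite) functional \<Rightarrow> bool" where
  "continuous_fixed_times T I F \<longleftrightarrow>
     (\<forall>t\<in>I. \<forall>\<omega>\<in>cadlag_paths T. \<forall>\<epsilon>>0. \<exists>\<eta>>0. \<forall>\<omega>'\<in>cadlag_paths T.
        sup_norm T (\<lambda>s. stop T t \<omega> s - stop T t \<omega>' s) < \<eta> \<longrightarrow>
        \<bar>F (t, stop T t \<omega>) - F (t, stop T t \<omega>')\<bar> < \<epsilon>)"

definition boundedness_preserving :: "real \<Rightarrow> real set \<Rightarrow> ('d::finite) functional \<Rightarrow> bool" where
  "boundedness_preserving T I F \<longleftrightarrow>
     (\<forall>K. compact K \<longrightarrow> (\<forall>t0\<in>{0..T}. \<exists>C>0. \<forall>t\<in>I. \<forall>\<omega>\<in>cadlag_paths T.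
        t \<le> t0 \<and> \<omega> ` {0..t} \<subseteq> K \<longrightarrow> \<bar>F (t, stop T t \<omega>)\<bar> < C))"

definition lipschitz_functional :: "real \<Rightarrow> ('d::finite) functional \<Rightarrow> bool" where
  "lipschitz_functional T F \<longleftrightarrow>
     nonanticipative T F \<and>
     (\<exists>K>0. \<forall>t\<in>{0..T}. \<forall>\<omega>\<in>cadlag_paths T. \<forall>\<omega>'\<in>cadlag_paths T.
        \<bar>F (t, stop T t \<omega>) - F (t, stop T t \<omega>')\<bar>
          \<le> K * sup_norm T (\<lambda>s. stop T t \<omega> s - stop T t \<omega>' s))"

section \<open>Horizontal and vertical derivatives\<close>

definition horizontally_differentiable :: "real \<Rightarrow> ('d::finite) functional \<Rightarrow> bool" where
  "horizontally_differentiable T F \<longleftrightarrow>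
     (\<forall>(t, \<omega>)\<in>stopped_paths T. t < T \<longrightarrow>
        (\<exists>l. ((\<lambda>h. (F (t + h, \<omega>) - F (t, \<omega>)) / h) \<longlongrightarrow> l) (at_right 0)))"

definition hderiv :: "('d::finite) functional \<Rightarrow> 'd functional" where
  "hderiv F = (\<lambda>(t, \<omega>). Lim (at_right 0) (\<lambda>h. (F (t + h, \<omega>) - F (t, \<omega>)) / h))"

definition bump :: "real \<Rightarrow> real \<Rightarrow> ('d::finite) path \<Rightarrow> (real, 'd) vec \<Rightarrow> 'd path" where
  "bump T t \<omega> e = restrict (\<lambda>s. \<omega> s + (if t \<le> s then e else 0)) {0..T}"

definition vertically_differentiable :: "real \<Rightarrow> ('d::finite) functional \<Rightarrow> bool" where
  "vertically_differentiable T F \<longleftrightarrow>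
     (\<forall>(t, \<omega>)\<in>stopped_paths T. (\<lambda>e. F (t, bump T t \<omega> e)) differentiable (at 0))"

definition vgrad :: "real \<Rightarrow> ('d::finite) functional \<Rightarrow> real \<times> 'd path \<Rightarrow> (real, 'd) vec" where
  "vgrad T F = (\<lambda>(t, \<omega>). THE D. GDERIV (\<lambda>e. F (t, bump T t \<omega> e)) 0 :> D)"

text \<open>Components of iterated vertical derivatives: for a list of \<open>j\<close> indices,
  \<open>vderivs T [i\<^sub>1, \<dots>, i\<^sub>j] F = \<partial>\<^sub>i\<^sub>1 \<dots> \<partial>\<^sub>i\<^sub>j F\<close>, i.e. the entries of \<open>\<nabla>\<^sup>j F\<close>.\<close>

fun vderivs :: "real \<Rightarrow> 'd list \<Rightarrow> ('d::finite) functional \<Rightarrow> 'd functional" where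
  "vderivs T [] F = F"
| "vderivs T (i # is) F = (\<lambda>p. vgrad T (vderivs T is F) p $ i)"

definition vhess :: "real \<Rightarrow> ('d::finite) functional \<Rightarrow> real \<times> 'd path \<Rightarrow> real^'d^'d" where
  "vhess T F p = (\<chi> i j. vderivs T [i, j] F p)"

definition C1b :: "real \<Rightarrow> nat \<Rightarrow> ('d::finite) functional set" where
  "C1b T k = {F.
     nonanticipative T F \<and>
     horizontally_differentiable T F \<and>
     continuous_fixed_times T {0..<T} (hderiv F) \<and>
     boundedness_preserving T {0..<T} (hderiv F) \<and>
     (\<forall>is. length is < k \<longrightarrow> vertically_differentiable T (vderivs T is F)) \<and>
     (\<forall>is. length is \<le> k \<longrightarrow>
        nonanticipative T (vderivs T is F) \<and> left_continuous T (vderivs T is F)) \<and>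
     (\<forall>is. 1 \<le> length is \<and> length is \<le> k \<longrightarrow>
        boundedness_preserving T {0..T} (vderivs T is F))}"

section \<open>Partitions and quadratic variation\<close>

text \<open>The partition \<open>\<pi>\<^sup>n\<close> consists of the points \<open>\<pi> n 0 < \<dots> < \<pi> n (m n)\<close>.\<close>

definition partition_seq :: "real \<Rightarrow> (nat \<Rightarrow> nat) \<Rightarrow> (nat \<Rightarrow> nat \<Rightarrow> real) \<Rightarrow> bool" where
  "partition_seq T m \<pi> \<longleftrightarrow>
     (\<forall>n. \<pi> n 0 = 0 \<and> \<pi> n (m n) = T \<and> (\<forall>i<m n. \<pi> n i < \<pi> n (Suc i)))"

definition qv_sum ::
  "(nat \<Rightarrow> nat) \<Rightarrow> (nat \<Rightarrow> nat \<Rightarrow> real) \<Rightarrow> (real \<Rightarrow> real) \<Rightarrow> real \<Rightarrow> nat \<Rightarrow> real" where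
  "qv_sum m \<pi> x t n =
     (\<Sum>i | i < m n \<and> \<pi> n (Suc i) \<le> t. (x (\<pi> n (Suc i)) - x (\<pi> n i))\<^sup>2)"

definition qv ::
  "(nat \<Rightarrow> nat) \<Rightarrow> (nat \<Rightarrow> nat \<Rightarrow> real) \<Rightarrow> (real \<Rightarrow> real) \<Rightarrow> real \<Rightarrow> real" where
  "qv m \<pi> x t = lim (qv_sum m \<pi> x t)"

definition Q_scalar ::
  "real \<Rightarrow> (nat \<Rightarrow> nat) \<Rightarrow> (nat \<Rightarrow> nat \<Rightarrow> real) \<Rightarrow> (real \<Rightarrow> real) set" where
  "Q_scalar T m \<pi> = {x. cadlag T x \<and>
     (\<forall>t\<in>{0..T}. convergent (qv_sum m \<pi> x t)) \<and>
     (\<exists>c. continuous_on {0..T} c \<and> mono_on {0..T} c \<and>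
        (\<forall>t\<in>{0..T}. ((\<lambda>s. (x s - left_lim x s)\<^sup>2) has_sum (qv m \<pi> x t - c t)) {0<..t}))}"

definition Q_vec ::
  "real \<Rightarrow> (nat \<Rightarrow> nat) \<Rightarrow> (nat \<Rightarrow> nat \<Rightarrow> real) \<Rightarrow> ('d::finite) path set" where
  "Q_vec T m \<pi> = {x.
     (\<forall>i. (\<lambda>t. x t $ i) \<in> Q_scalar T m \<pi>) \<and>
     (\<forall>i j. (\<lambda>t. x t $ i + x t $ j) \<in> Q_scalar T m \<pi>)}"

definition qv_mat ::
  "(nat \<Rightarrow> nat) \<Rightarrow> (nat \<Rightarrow> nat \<Rightarrow> real) \<Rightarrow> ('d::finite) path \<Rightarrow> real \<Rightarrow> real^'d^'d" where
  "qv_mat m \<pi> x t = (\<chi> i j.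
     (qv m \<pi> (\<lambda>s. x s $ i + x s $ j) t - qv m \<pi> (\<lambda>s. x s $ i) t - qv m \<pi> (\<lambda>s. x s $ j) t) / 2)"

definition qv_norm ::
  "real \<Rightarrow> (nat \<Rightarrow> nat) \<Rightarrow> (nat \<Rightarrow> nat \<Rightarrow> real) \<Rightarrow> (real \<Rightarrow> real) \<Rightarrow> real" where
  "qv_norm T m \<pi> x = sqrt (qv m \<pi> x T)"

definition holder_on :: "real \<Rightarrow> real \<Rightarrow> ('d::finite) path \<Rightarrow> bool" where
  "holder_on T \<nu> \<omega> \<longleftrightarrow>
     (\<exists>C. \<forall>s\<in>{0..T}. \<forall>t\<in>{0..T}. norm (\<omega> t - \<omega> s) \<le> C * \<bar>t - s\<bar> powr \<nu>)"

section \<open>Pathwise integral\<close>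

definition step_path ::
  "real \<Rightarrow> (nat \<Rightarrow> nat) \<Rightarrow> (nat \<Rightarrow> nat \<Rightarrow> real) \<Rightarrow> ('d::finite) path \<Rightarrow> nat \<Rightarrow> 'd path" where
  "step_path T m \<pi> \<omega> n = (\<lambda>s.
     (\<Sum>i<m n. indicator {\<pi> n i..<\<pi> n (Suc i)} s *\<^sub>R \<omega> (\<pi> n (Suc i))) + indicator {T} s *\<^sub>R \<omega> T)"

definition integral_sum ::
  "real \<Rightarrow> (nat \<Rightarrow> nat) \<Rightarrow> (nat \<Rightarrow> nat \<Rightarrow> real) \<Rightarrow> ('d::finite) path \<Rightarrow> 'd functional
     \<Rightarrow> real \<Rightarrow> nat \<Rightarrow> real" where
  "integral_sum T m \<pi> \<omega> F t n =
     (\<Sum>i<m n. vgrad T F (\<pi> n i, stop_left T (\<pi> n i) (step_path T m \<pi> \<omega> n))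
                 \<bullet> (\<omega> (min (\<pi> n (Suc i)) t) - \<omega> (min (\<pi> n i) t)))"

definition pathwise_integral ::
  "real \<Rightarrow> (nat \<Rightarrow> nat) \<Rightarrow> (nat \<Rightarrow> nat \<Rightarrow> real) \<Rightarrow> ('d::finite) path \<Rightarrow> 'd functional
     \<Rightarrow> real \<Rightarrow> real" where
  "pathwise_integral T m \<pi> \<omega> F = restrict (\<lambda>t. lim (integral_sum T m \<pi> \<omega> F t)) {0..T}"

section \<open>Harmonic functionals and the associated spaces of paths\<close>

definition R_space ::
  "real \<Rightarrow> (nat \<Rightarrow> nat) \<Rightarrow> (nat \<Rightarrow> nat \<Rightarrow> real) \<Rightarrow> ('d::finite) path \<Rightarrow> 'd functional set" where
  "R_space T m \<pi> \<omega> = {F \<in> C1b T 2. lipschitz_functional T F \<and>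
     (\<forall>i. (\<lambda>p. vgrad T F p $ i) \<in> C1b T 1) \<and>
     (\<lambda>n. MAX i\<in>{..<m n}.
        \<bar>F (\<pi> n (Suc i), stop T (\<pi> n (Suc i)) \<omega>) - F (\<pi> n i, stop T (\<pi> n i) \<omega>)\<bar>)
       \<longlonglongrightarrow> 0}"

definition harmonic_functionals ::
  "real \<Rightarrow> (nat \<Rightarrow> nat) \<Rightarrow> (nat \<Rightarrow> nat \<Rightarrow> real) \<Rightarrow> (real \<Rightarrow> real^'d^'d) \<Rightarrow> ('d::finite) path
     \<Rightarrow> 'd functional set" where
  "harmonic_functionals T m \<pi> a \<omega> = {F \<in> R_space T m \<pi> \<omega>.
     \<forall>p\<in>stopped_paths T. fst p < T \<longrightarrow>
       hderiv F p + 1/2 * trace (vhess T F p ** a (fst p)) = 0}"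

definition along :: "real \<Rightarrow> ('d::finite) path \<Rightarrow> (real \<times> 'd path \<Rightarrow> 'b) \<Rightarrow> real \<Rightarrow> 'b" where
  "along T \<omega> G = restrict (\<lambda>t. G (t, stop T t \<omega>)) {0..T}"

definition H_paths ::
  "real \<Rightarrow> (nat \<Rightarrow> nat) \<Rightarrow> (nat \<Rightarrow> nat \<Rightarrow> real) \<Rightarrow> (real \<Rightarrow> real^'d^'d) \<Rightarrow> ('d::finite) path
     \<Rightarrow> (real \<Rightarrow> real) set" where
  "H_paths T m \<pi> a \<omega> = {along T \<omega> F | F. F \<in> harmonic_functionals T m \<pi> a \<omega>}"

definition V_paths ::
  "real \<Rightarrow> (nat \<Rightarrow> nat) \<Rightarrow> (nat \<Rightarrow> nat \<Rightarrow> real) \<Rightarrow> (real \<Rightarrow> real^'d^'d) \<Rightarrow> ('d::finite) path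
     \<Rightarrow> 'd path set" where
  "V_paths T m \<pi> a \<omega> = {along T \<omega> (vgrad T F) | F. F \<in> harmonic_functionals T m \<pi> a \<omega>}"

definition L2_space :: "real \<Rightarrow> (real \<Rightarrow> real^'d^'d) \<Rightarrow> ('d::finite) path set" where
  "L2_space T a = {\<phi>. set_borel_measurable lborel {0..T} \<phi> \<and>
     set_integrable lborel {0..T} (\<lambda>u. \<phi> u \<bullet> (a u *v \<phi> u))}"

definition L2_norm :: "real \<Rightarrow> (real \<Rightarrow> real^'d^'d) \<Rightarrow> ('d::finite) path \<Rightarrow> real" where
  "L2_norm T a \<phi> = sqrt (LINT u:{0..T}|lborel. \<phi> u \<bullet> (a u *v \<phi> u))"

end

theory Submission
  imports Defs
begin

text \<open>
  Let \<open>F\<close> be harmonic and put \<open>y t = F(t, \<omega>\<^sub>t)\<close> and \<open>g t = \<nabla>F(t, \<omega>\<^sub>t)\<close>. Write \<open>\<Delta>t\<close> and \<open>\<delta>\<close> for the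
  increments of time and of \<open>\<omega>\<close> over an interval of the partition. Two facts carry the theorem.

  The first is the change of variable formula \<open>\<integral> g d\<omega> = y - y 0\<close> (\<open>integral_sum_tendsto\<close>). Replace
  \<open>\<omega>\<close> by its staircase approximation. From one partition point to the next the functional then
  changes once by a vertical bump \<open>\<delta>\<close> and once by a horizontal move. Taylor's formula turns the
  bump into \<open>g \<bullet> \<delta> + 1/2 <\<nabla>\<^sup>2F, \<delta> \<delta>\<^sup>T>\<close>, and harmonicity turns the horizontal move into
  \<open>- 1/2 <\<nabla>\<^sup>2F, a> \<Delta>t\<close>. The sums of \<open>\<delta> \<delta>\<^sup>T\<close> converge to the integral of \<open>a\<close>, so that the two
  second-order terms cancel in the limit (\<open>Ito_error_tendsto_0\<close>).

  The second is that \<open>y\<close> has the quadratic variation \<open>\<integral> g \<bullet> a g dt\<close>. An increment of \<open>y\<close> is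
  \<open>g \<bullet> \<delta>\<close> up to a remainder of order \<open>\<Delta>t\<close> to the power \<open>min 1 (\<nu> + \<nu>\<^sup>2)\<close>, found by cutting the
  interval into about \<open>\<Delta>t\<close> to the power \<open>-\<nu>\<close> pieces (\<open>increment_remainder_bound\<close>, \<open>holder_substep_bound\<close>).
  The squares of the remainders sum to zero in the limit because \<open>2 (\<nu> + \<nu>\<^sup>2) > 1\<close>, which is what
  \<open>\<nu> > (sqrt 3 - 1) / 2\<close> says; and the sums of \<open>(g \<bullet> \<delta>)\<^sup>2\<close> converge to the integral.

  In both facts discrete measures that converge only weakly are tested against integrands that are
  only left-continuous. This is resolved by \<open>asymptotic_left_derivative_zero\<close>: in the limit, the
  partial sums up to time \<open>r\<close> are Lipschitz in \<open>r\<close> and have left derivative zero at every \<open>r\<close>,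
  and such a function is constant. The left derivative at \<open>r\<close> involves only the partition
  intervals just before \<open>r\<close>, where left-continuity gives uniform control.

  The isometry combines the two facts. For injectivity, let \<open>F\<close> and \<open>G\<close> have the same integral.
  By the first fact their values along \<open>\<omega>\<close> have the same increments, so the difference \<open>h\<close> of the
  gradients satisfies \<open>\<integral> h \<bullet> a h dt = 0\<close>, and positive definiteness and left-continuity give
  \<open>h = 0\<close> on \<open>(0, T]\<close>. Left-continuity is silent at time \<open>0\<close>; there the gradients agree because
  they are right-continuous at \<open>0\<close> (\<open>gradient_right_limit_0\<close>).
\<close>

section \<open>Limits controlled by one-sided derivatives\<close>

lemma real_induction:
  fixes P :: "real \<Rightarrow> bool"
  assumes "a \<le> b" "P a"
    and step: "\<And>x. a \<le> x \<Longrightarrow> x < b \<Longrightarrow> P x \<Longrightarrow> \<exists>y>x. \<forall>z. x < z \<and> z \<le> y \<and> z \<le> b \<longrightarrow> P z"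
    and lim: "\<And>x. a < x \<Longrightarrow> x \<le> b \<Longrightarrow> (\<And>y. a \<le> y \<Longrightarrow> y < x \<Longrightarrow> P y) \<Longrightarrow> P x"
  shows "P b"
proof -
  define S where "S = {x. a \<le> x \<and> x \<le> b \<and> (\<forall>y. a \<le> y \<and> y \<le> x \<longrightarrow> P y)}"
  have aS: "a \<in> S" using assms(1,2) by (auto simp: S_def dest: order_antisym)
  have bdd: "bdd_above S" by (auto simp: S_def bdd_above_def)
  define s where "s = Sup S"
  have as: "a \<le> s" using cSup_upper[OF aS bdd] s_def by simp
  have sb: "s \<le> b" unfolding s_def by (rule cSup_least) (use aS in \<open>auto simp: S_def\<close>)
  have below: "P y" if "a \<le> y" "y < s" for y
  proof -
    obtain x where "x \<in> S" "y < x" using less_cSupD[of S y] aS \<open>y < s\<close> unfolding s_def by blast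
    then show ?thesis using that by (auto simp: S_def)
  qed
  have Ps: "P s"
    by (cases "a = s") (use assms(2) as sb below lim[of s] in auto)
  have sS: "s \<in> S" using as sb below Ps by (auto simp: S_def less_eq_real_def)
  have "s = b"
  proof (rule ccontr)
    assume "s \<noteq> b"
    then have "s < b" using sb by simp
    then obtain y where y: "y > s" "\<forall>z. s < z \<and> z \<le> y \<and> z \<le> b \<longrightarrow> P z"
      using step[OF as _ Ps] by auto
    have "min y b \<in> S" using y sS \<open>s < b\<close> as by (auto simp: S_def) (metis not_less)+
    then have "min y b \<le> s" using cSup_upper[OF _ bdd] s_def by simp
    then show False using y(1) \<open>s < b\<close> by auto
  qed
  then show ?thesis using Ps by simp
qed

text \<open>Induction along the interval: the right derivative carries the estimate to the right
  of each point, left-continuity carries it to limits.\<close>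
lemma right_derivative_increment_bound:
  fixes f :: "real \<Rightarrow> real"
  assumes "a \<le> b"
    and left: "\<And>x. a < x \<Longrightarrow> x \<le> b \<Longrightarrow> (f \<longlongrightarrow> f x) (at_left x)"
    and right: "\<And>x. a \<le> x \<Longrightarrow> x < b \<Longrightarrow>
       \<exists>l. \<bar>l - \<rho>\<bar> \<le> e \<and> ((\<lambda>h. (f (x + h) - f x) / h) \<longlongrightarrow> l) (at_right 0)"
  shows "\<bar>f b - f a - \<rho> * (b - a)\<bar> \<le> e * (b - a)"
proof (cases "a = b")
  case False
  then have ab: "a < b" using assms(1) by simp
  have main: "\<bar>f b - f a - \<rho> * (b - a)\<bar> \<le> e' * (b - a)" if "e' > e" for e'
  proof (rule real_induction[where P = "\<lambda>x. \<bar>f x - f a - \<rho> * (x - a)\<bar> \<le> e' * (x - a)", OF assms(1)])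
    show "\<bar>f a - f a - \<rho> * (a - a)\<bar> \<le> e' * (a - a)" by simp
  next
    fix x assume x: "a \<le> x" "x < b" and P: "\<bar>f x - f a - \<rho> * (x - a)\<bar> \<le> e' * (x - a)"
    obtain l where l: "\<bar>l - \<rho>\<bar> \<le> e" "((\<lambda>h. (f (x + h) - f x) / h) \<longlongrightarrow> l) (at_right 0)"
      using right[OF x] by auto
    have "\<forall>\<^sub>F h in at_right 0. dist ((f (x + h) - f x) / h) l < e' - e"
      using l(2) that by (intro tendstoD) auto
    then obtain d where d: "d > 0" "\<And>h. 0 < h \<Longrightarrow> h < d \<Longrightarrow> dist ((f (x + h) - f x) / h) l < e' - e"
      unfolding eventually_at_right_field by auto
    show "\<exists>y>x. \<forall>z. x < z \<and> z \<le> y \<and> z \<le> b \<longrightarrow> \<bar>f z - f a - \<rho> * (z - a)\<bar> \<le> e' * (z - a)"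
    proof (intro exI[of _ "x + d / 2"] conjI allI impI)
      show "x < x + d / 2" using d by simp
      fix z assume z: "x < z \<and> z \<le> x + d / 2 \<and> z \<le> b"
      define h where "h = z - x"
      have h: "0 < h" "h < d" using z d by (auto simp: h_def)
      have "\<bar>(f (x + h) - f x) / h - \<rho>\<bar> \<le> e'" using d(2)[OF h] l(1) by (auto simp: dist_real_def)
      then have "\<bar>(f (x + h) - f x) / h - \<rho>\<bar> * h \<le> e' * h" using h by simp
      moreover have "\<bar>(f (x + h) - f x) / h - \<rho>\<bar> * h = \<bar>((f (x + h) - f x) / h - \<rho>) * h\<bar>"
        using h by (simp add: abs_mult)
      moreover have "((f (x + h) - f x) / h - \<rho>) * h = f (x + h) - f x - \<rho> * h"
        using h by (simp add: field_simps)
      ultimately have "\<bar>f z - f x - \<rho> * (z - x)\<bar> \<le> e' * (z - x)" by (simp add: h_def)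
      then show "\<bar>f z - f a - \<rho> * (z - a)\<bar> \<le> e' * (z - a)" using P by (simp add: algebra_simps)
    qed
  next
    fix x assume x: "a < x" "x \<le> b"
      and P: "\<And>y. a \<le> y \<Longrightarrow> y < x \<Longrightarrow> \<bar>f y - f a - \<rho> * (y - a)\<bar> \<le> e' * (y - a)"
    show "\<bar>f x - f a - \<rho> * (x - a)\<bar> \<le> e' * (x - a)"
    proof (rule tendsto_le[where F = "at_left x"])
      show "((\<lambda>y. e' * (y - a)) \<longlongrightarrow> e' * (x - a)) (at_left x)"
        by (intro tendsto_intros)
      show "((\<lambda>y. \<bar>f y - f a - \<rho> * (y - a)\<bar>) \<longlongrightarrow> \<bar>f x - f a - \<rho> * (x - a)\<bar>) (at_left x)"
        by (intro tendsto_intros left x)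
      have "\<forall>\<^sub>F y in at_left x. y \<in> {a<..<x}" using x(1) by (rule eventually_at_leftI[rotated]) auto
      then show "\<forall>\<^sub>F y in at_left x. \<bar>f y - f a - \<rho> * (y - a)\<bar> \<le> e' * (y - a)"
        by eventually_elim (use P in auto)
    qed simp
  qed
  have "\<bar>f b - f a - \<rho> * (b - a)\<bar> / (b - a) \<le> e"
    by (rule dense_ge) (use main ab in \<open>simp add: divide_le_eq\<close>)
  then show ?thesis using ab by (simp add: divide_le_eq)
qed simp

text \<open>The function \<open>r \<mapsto> limsup \<bar>S n t - S n r\<bar>\<close> is Lipschitz
  and has left derivative zero everywhere, hence vanishes. The limit superior is avoided by
  carrying an arbitrary \<open>\<delta>\<close>, and the induction runs downwards from
  \<open>t\<close>, which is why it is phrased for \<open>t - z\<close>.\<close>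
lemma asymptotic_left_derivative_zero:
  fixes S :: "nat \<Rightarrow> real \<Rightarrow> real"
  assumes "0 \<le> t"
    and lip: "\<And>x y \<delta>. 0 \<le> x \<Longrightarrow> x \<le> y \<Longrightarrow> y \<le> t \<Longrightarrow> \<delta> > 0 \<Longrightarrow>
        \<forall>\<^sub>F n in sequentially. \<bar>S n y - S n x\<bar> \<le> C * (y - x) + \<delta>"
    and left: "\<And>r \<epsilon>. 0 < r \<Longrightarrow> r \<le> t \<Longrightarrow> \<epsilon> > 0 \<Longrightarrow>
        \<exists>\<eta>>0. \<forall>x \<delta>. r - \<eta> < x \<longrightarrow> x < r \<longrightarrow> 0 \<le> x \<longrightarrow> \<delta> > 0 \<longrightarrow>
          (\<forall>\<^sub>F n in sequentially. \<bar>S n r - S n x\<bar> \<le> \<epsilon> * (r - x) + \<delta>)"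
  shows "(\<lambda>n. S n t - S n 0) \<longlonglongrightarrow> 0"
proof -
  have main: "\<forall>\<delta>>0. \<forall>\<^sub>F n in sequentially. \<bar>S n t - S n (t - t)\<bar> \<le> \<epsilon> * t + \<delta>" if \<epsilon>: "\<epsilon> > 0" for \<epsilon>
  proof (rule real_induction[where P = "\<lambda>z. \<forall>\<delta>>0. \<forall>\<^sub>F n in sequentially. \<bar>S n t - S n (t - z)\<bar> \<le> \<epsilon> * z + \<delta>", OF assms(1)])
    show "\<forall>\<delta>>0. \<forall>\<^sub>F n in sequentially. \<bar>S n t - S n (t - 0)\<bar> \<le> \<epsilon> * 0 + \<delta>" by simp
  next
    fix z assume z: "0 \<le> z" "z < t"
      and P: "\<forall>\<delta>>0. \<forall>\<^sub>F n in sequentially. \<bar>S n t - S n (t - z)\<bar> \<le> \<epsilon> * z + \<delta>"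
    obtain \<eta> where \<eta>: "\<eta> > 0" and H: "\<forall>x \<delta>. t - z - \<eta> < x \<longrightarrow> x < t - z \<longrightarrow> 0 \<le> x \<longrightarrow> \<delta> > 0 \<longrightarrow>
          (\<forall>\<^sub>F n in sequentially. \<bar>S n (t - z) - S n x\<bar> \<le> \<epsilon> * (t - z - x) + \<delta>)"
      using left[of "t - z" \<epsilon>] z \<epsilon> by auto
    show "\<exists>y>z. \<forall>z'. z < z' \<and> z' \<le> y \<and> z' \<le> t \<longrightarrow>
        (\<forall>\<delta>>0. \<forall>\<^sub>F n in sequentially. \<bar>S n t - S n (t - z')\<bar> \<le> \<epsilon> * z' + \<delta>)"
    proof (intro exI[of _ "z + \<eta> / 2"] conjI allI impI)
      show "z < z + \<eta> / 2" using \<eta> by simp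
      fix z' \<delta> assume z': "z < z' \<and> z' \<le> z + \<eta> / 2 \<and> z' \<le> t" and \<delta>: "(0::real) < \<delta>"
      have "\<forall>\<^sub>F n in sequentially. \<bar>S n t - S n (t - z)\<bar> \<le> \<epsilon> * z + \<delta> / 2" using P \<delta> by simp
      moreover have "\<forall>\<^sub>F n in sequentially. \<bar>S n (t - z) - S n (t - z')\<bar> \<le> \<epsilon> * (t - z - (t - z')) + \<delta> / 2"
        using H[rule_format, of "t - z'" "\<delta> / 2"] z' \<delta> \<eta> by simp
      ultimately show "\<forall>\<^sub>F n in sequentially. \<bar>S n t - S n (t - z')\<bar> \<le> \<epsilon> * z' + \<delta>"
        by eventually_elim (simp add: algebra_simps)
    qed
  next
    fix z assume z: "0 < z" "z \<le> t"
      and P: "\<And>y. 0 \<le> y \<Longrightarrow> y < z \<Longrightarrow> \<forall>\<delta>>0. \<forall>\<^sub>F n in sequentially. \<bar>S n t - S n (t - y)\<bar> \<le> \<epsilon> * y + \<delta>"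
    show "\<forall>\<delta>>0. \<forall>\<^sub>F n in sequentially. \<bar>S n t - S n (t - z)\<bar> \<le> \<epsilon> * z + \<delta>"
    proof (intro allI impI)
      fix \<delta> :: real assume \<delta>: "\<delta> > 0"
      define u where "u = min z (\<delta> / (3 * (\<bar>C\<bar> + 1)))"
      have u: "0 < u" "u \<le> z" "u \<le> \<delta> / (3 * (\<bar>C\<bar> + 1))" using z \<delta> by (auto simp: u_def)
      have "C * u \<le> (\<bar>C\<bar> + 1) * u" using u by (intro mult_right_mono) auto
      also have "\<dots> \<le> \<delta> / 3" using u(3) by (simp add: field_simps)
      finally have Cu: "C * u \<le> \<delta> / 3" .
      have eu: "\<epsilon> * (z - u) \<le> \<epsilon> * z" using \<epsilon> u by simp
      have "\<forall>\<^sub>F n in sequentially. \<bar>S n t - S n (t - (z - u))\<bar> \<le> \<epsilon> * (z - u) + \<delta> / 3"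
        using P[of "z - u"] u \<delta> by auto
      moreover have "\<forall>\<^sub>F n in sequentially. \<bar>S n (t - (z - u)) - S n (t - z)\<bar> \<le> C * (t - (z - u) - (t - z)) + \<delta> / 3"
        using lip[of "t - z" "t - (z - u)" "\<delta> / 3"] u \<delta> z by auto
      ultimately show "\<forall>\<^sub>F n in sequentially. \<bar>S n t - S n (t - z)\<bar> \<le> \<epsilon> * z + \<delta>"
        by eventually_elim (use Cu eu in simp)
    qed
  qed
  show ?thesis
  proof (rule tendstoI)
    fix e :: real assume e: "e > 0"
    define \<epsilon> where "\<epsilon> = e / (2 * (t + 1))"
    have \<epsilon>: "\<epsilon> > 0" using e assms(1) by (simp add: \<epsilon>_def)
    have "\<epsilon> * t \<le> e / 2" using e assms(1) by (simp add: \<epsilon>_def field_simps)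
    moreover have "\<forall>\<^sub>F n in sequentially. \<bar>S n t - S n (t - t)\<bar> \<le> \<epsilon> * t + e / 4"
      using main[OF \<epsilon>] e by simp
    ultimately show "\<forall>\<^sub>F n in sequentially. dist (S n t - S n 0) 0 < e"
      using e by (elim eventually_mono) auto
  qed
qed

section \<open>Stopped paths\<close>

lemma cadlag_cong:
  assumes "\<And>s. s \<in> {0..T} \<Longrightarrow> x s = y s" "cadlag T x"
  shows "cadlag T y"
  unfolding cadlag_def
proof (intro conjI ballI)
  fix t assume t: "t \<in> {0..<T}"
  have ev: "\<forall>\<^sub>F s in at_right t. x s = y s"
    by (rule eventually_at_rightI[of t T]) (use t assms(1) in auto)
  have "(x \<longlongrightarrow> y t) (at_right t)" using assms t unfolding cadlag_def by auto
  then show "(y \<longlongrightarrow> y t) (at_right t)" using ev by (rule Lim_transform_eventually)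
next
  fix t assume t: "t \<in> {0<..T}"
  have ev: "\<forall>\<^sub>F s in at_left t. x s = y s"
    by (rule eventually_at_leftI[of 0 t]) (use t assms(1) in auto)
  obtain l where "(x \<longlongrightarrow> l) (at_left t)" using assms(2) t unfolding cadlag_def by blast
  then have "(y \<longlongrightarrow> l) (at_left t)" using ev by (rule Lim_transform_eventually)
  then show "\<exists>l. (y \<longlongrightarrow> l) (at_left t)" ..
qed

lemma cadlag_continuous_on:
  assumes "continuous_on {0..T} x"
  shows "cadlag T x"
  unfolding cadlag_def
proof (intro conjI ballI)
  fix t assume t: "t \<in> {0..<T}"
  then have "at t within {t..T} = at_right t" by (auto intro: at_within_Icc_at_right)
  moreover have "(x \<longlongrightarrow> x t) (at t within {t..T})"
    using continuous_on_subset[OF assms, of "{t..T}"] t by (simp add: continuous_on_def)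
  ultimately show "(x \<longlongrightarrow> x t) (at_right t)" by simp
next
  fix t assume t: "t \<in> {0<..T}"
  then have "at t within {0..t} = at_left t" by (auto intro: at_within_Icc_at_left)
  moreover have "(x \<longlongrightarrow> x t) (at t within {0..t})"
    using continuous_on_subset[OF assms, of "{0..t}"] t by (simp add: continuous_on_def)
  ultimately show "\<exists>l. (x \<longlongrightarrow> l) (at_left t)" by auto
qed

lemma cadlag_paths_stop:
  assumes "cadlag T x" "0 \<le> t" "t \<le> T"
  shows "stop T t x \<in> cadlag_paths T"
proof -
  have "cadlag T (\<lambda>s. x (min t s))"
    unfolding cadlag_def
  proof (intro conjI ballI)
    fix s assume s: "s \<in> {0..<T}"
    show "((\<lambda>s. x (min t s)) \<longlongrightarrow> x (min t s)) (at_right s)"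
    proof (cases "s < t")
      case True
      then have ev: "\<forall>\<^sub>F u in at_right s. x u = x (min t u)"
        by (intro eventually_at_rightI[of s t]) auto
      have "(x \<longlongrightarrow> x (min t s)) (at_right s)" using assms(1) s True by (auto simp: cadlag_def)
      then show ?thesis using ev by (rule Lim_transform_eventually)
    next
      case False
      then have "\<forall>\<^sub>F u in at_right s. x t = x (min t u)"
        by (intro eventually_at_rightI[of s "s + 1"]) auto
      then show ?thesis using False by (intro tendsto_eventually) (auto simp: eq_commute min_def)
    qed
  next
    fix s assume s: "s \<in> {0<..T}"
    show "\<exists>l. ((\<lambda>s. x (min t s)) \<longlongrightarrow> l) (at_left s)"
    proof (cases "s \<le> t")
      case True
      then have ev: "\<forall>\<^sub>F u in at_left s. x u = x (min t u)"
        by (intro eventually_at_leftI[of "s - 1"]) auto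
      obtain l where "(x \<longlongrightarrow> l) (at_left s)" using assms(1) s unfolding cadlag_def by blast
      then have "((\<lambda>s. x (min t s)) \<longlongrightarrow> l) (at_left s)" using ev by (rule Lim_transform_eventually)
      then show ?thesis ..
    next
      case False
      then have "\<forall>\<^sub>F u in at_left s. x (min t u) = x t"
        by (intro eventually_at_leftI[of t]) auto
      then show ?thesis by (intro exI[of _ "x t"] tendsto_eventually)
    qed
  qed
  then have "cadlag T (stop T t x)" by (rule cadlag_cong[rotated]) (simp add: stop_def)
  then show ?thesis by (simp add: cadlag_paths_def stop_def)
qed

lemma cadlag_paths_bump:
  assumes "p \<in> cadlag_paths T"
  shows "bump T t p e \<in> cadlag_paths T"
proof -
  have p: "cadlag T p" using assms by (simp add: cadlag_paths_def)
  have "cadlag T (\<lambda>s. p s + (if t \<le> s then e else 0))"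
    unfolding cadlag_def
  proof (intro conjI ballI)
    fix s assume s: "s \<in> {0..<T}"
    have "\<forall>\<^sub>F u in at_right s. (if t \<le> u then e else 0) = (if t \<le> s then e else 0)"
    proof (cases "s < t")
      case True then show ?thesis by (intro eventually_at_rightI[of s t]) auto
    next
      case False then show ?thesis by (intro eventually_at_rightI[of s "s + 1"]) auto
    qed
    then have "((\<lambda>u. if t \<le> u then e else 0) \<longlongrightarrow> (if t \<le> s then e else 0)) (at_right s)"
      by (rule tendsto_eventually)
    moreover have "(p \<longlongrightarrow> p s) (at_right s)" using p s by (simp add: cadlag_def)
    ultimately show "((\<lambda>s. p s + (if t \<le> s then e else 0)) \<longlongrightarrow> p s + (if t \<le> s then e else 0)) (at_right s)"
      by (rule tendsto_add[rotated])
  next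
    fix s assume s: "s \<in> {0<..T}"
    have "\<forall>\<^sub>F u in at_left s. (if t \<le> u then e else 0) = (if t < s then e else 0)"
    proof (cases "t < s")
      case True then show ?thesis by (intro eventually_at_leftI[of t]) auto
    next
      case False then show ?thesis by (intro eventually_at_leftI[of "s - 1"]) auto
    qed
    then have "((\<lambda>u. if t \<le> u then e else 0) \<longlongrightarrow> (if t < s then e else 0)) (at_left s)"
      by (rule tendsto_eventually)
    moreover obtain l where "(p \<longlongrightarrow> l) (at_left s)" using p s unfolding cadlag_def by blast
    ultimately have "((\<lambda>s. p s + (if t \<le> s then e else 0)) \<longlongrightarrow> l + (if t < s then e else 0)) (at_left s)"
      by (rule tendsto_add[rotated])
    then show "\<exists>l. ((\<lambda>s. p s + (if t \<le> s then e else 0)) \<longlongrightarrow> l) (at_left s)" ..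
  qed
  then have "cadlag T (bump T t p e)" by (rule cadlag_cong[rotated]) (simp add: bump_def)
  then show ?thesis by (simp add: cadlag_paths_def bump_def)
qed

text \<open>A description that does not mention a path before stopping. It makes the closure
  properties of the space of stopped paths easy to check.\<close>
lemma stopped_paths_iff:
  "(t, p) \<in> stopped_paths T \<longleftrightarrow>
     t \<in> {0..T} \<and> p \<in> cadlag_paths T \<and> (\<forall>s\<in>{t..T}. p s = p t)"
proof
  assume "(t, p) \<in> stopped_paths T"
  then obtain w where w: "t \<in> {0..T}" "w \<in> cadlag_paths T" "p = stop T t w"
    by (auto simp: stopped_paths_def)
  have "stop T t w \<in> cadlag_paths T"
    using cadlag_paths_stop w by (auto simp: cadlag_paths_def)
  then show "t \<in> {0..T} \<and> p \<in> cadlag_paths T \<and> (\<forall>s\<in>{t..T}. p s = p t)"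
    using w by (auto simp: stop_def)
next
  assume *: "t \<in> {0..T} \<and> p \<in> cadlag_paths T \<and> (\<forall>s\<in>{t..T}. p s = p t)"
  have "p s = stop T t p s" for s
  proof (cases "s \<in> {0..T}")
    case True
    have "p s = p t" if "t < s"
      using * that True by (intro bspec[of "{t..T}" "\<lambda>s. p s = p t"]) (blast, simp)
    then show ?thesis using True by (cases "s \<le> t") (simp_all add: stop_def min_def)
  next
    case False
    moreover have "p s = undefined"
      using * False unfolding cadlag_paths_def extensional_def by blast
    ultimately show ?thesis by (simp only: stop_def restrict_def if_False)
  qed
  then have "p = stop T t p" by (rule ext)
  then show "(t, p) \<in> stopped_paths T" using * unfolding stopped_paths_def by blast
qed

lemma stopped_paths_time:
  assumes "(t, P) \<in> stopped_paths T"
  shows "0 \<le> t" "t \<le> T"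
  using assms unfolding stopped_paths_def by auto

lemma stop_stopped_path:
  assumes "(t, p) \<in> stopped_paths T"
  shows "stop T t p = p"
proof
  fix s
  note p = assms[unfolded stopped_paths_iff]
  show "stop T t p s = p s"
  proof (cases "s \<in> {0..T}")
    case True
    have "p s = p t" if "t < s"
      using p that True by (intro bspec[of "{t..T}" "\<lambda>s. p s = p t"]) (blast, simp)
    then show ?thesis using True by (cases "s \<le> t") (simp_all add: stop_def min_def)
  next
    case False
    moreover have "p s = undefined"
      using p False unfolding cadlag_paths_def extensional_def by blast
    ultimately show ?thesis by (simp only: stop_def restrict_def if_False)
  qed
qed

lemma stopped_paths_later:
  assumes "(t, p) \<in> stopped_paths T" "t \<le> u" "u \<le> T"
  shows "(u, p) \<in> stopped_paths T"
  using assms unfolding stopped_paths_iff by (metis atLeastAtMost_iff order_trans)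

lemma stopped_paths_bump:
  assumes "(t, p) \<in> stopped_paths T"
  shows "(t, bump T t p e) \<in> stopped_paths T"
  unfolding stopped_paths_iff
proof (intro conjI ballI)
  show "t \<in> {0..T}" "bump T t p e \<in> cadlag_paths T"
    using assms cadlag_paths_bump[of p T t e] unfolding stopped_paths_iff by blast+
  fix s assume s: "s \<in> {t..T}"
  have "p s = p t" using assms s unfolding stopped_paths_iff by blast
  then show "bump T t p e s = bump T t p e t"
    using s \<open>t \<in> {0..T}\<close> by (simp add: bump_def)
qed

lemma stopped_paths_stop:
  assumes "continuous_on {0..T} x" "0 \<le> t" "t \<le> T"
  shows "(t, stop T t x) \<in> stopped_paths T"
  using cadlag_paths_stop[OF cadlag_continuous_on[OF assms(1)] assms(2,3)] assms
  unfolding stopped_paths_iff by (auto simp: stop_def)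

lemma bump_0: "p \<in> cadlag_paths T \<Longrightarrow> bump T t p 0 = p"
  by (auto simp: bump_def cadlag_paths_def extensional_def restrict_def fun_eq_iff)

lemma bump_bump: "bump T t (bump T t p e) e' = bump T t p (e + e')"
  by (auto simp: bump_def restrict_def fun_eq_iff)

section \<open>Quantitative forms of the regularity classes\<close>

lemma sup_norm_le:
  assumes "0 \<le> T" "\<And>s. s \<in> {0..T} \<Longrightarrow> norm (x s) \<le> B"
  shows "sup_norm T x \<le> B"
  unfolding sup_norm_def using assms by (intro cSUP_least) auto

text \<open>In this and the next two lemmas, the distances and compact sets of the definitions are
  replaced by pointwise norm bounds on \<open>[0,T]\<close>, the form in which they are known for
  concrete paths.\<close>
lemma lipschitz_functional_bound:
  fixes F :: "('d::finite) functional"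
  assumes "lipschitz_functional T F"
  obtains K where "K > 0" "\<And>t P Q B. (t, P) \<in> stopped_paths T \<Longrightarrow> (t, Q) \<in> stopped_paths T \<Longrightarrow>
      (\<And>s. s \<in> {0..T} \<Longrightarrow> norm (P s - Q s) \<le> B) \<Longrightarrow> \<bar>F (t, P) - F (t, Q)\<bar> \<le> K * B"
proof -
  obtain K where K: "K > 0" "\<And>t \<omega> \<omega>'. t\<in>{0..T} \<Longrightarrow> \<omega>\<in>cadlag_paths T \<Longrightarrow> \<omega>'\<in>cadlag_paths T \<Longrightarrow>
        \<bar>F (t, stop T t \<omega>) - F (t, stop T t \<omega>')\<bar>
          \<le> K * sup_norm T (\<lambda>s. stop T t \<omega> s - stop T t \<omega>' s)"
    using assms unfolding lipschitz_functional_def by blast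
  show thesis
  proof (rule that[OF K(1)])
    fix t B and P Q :: "'d path"
    assume *: "(t, P) \<in> stopped_paths T" "(t, Q) \<in> stopped_paths T"
      "\<And>s. s \<in> {0..T} \<Longrightarrow> norm (P s - Q s) \<le> B"
    have "\<bar>F (t, P) - F (t, Q)\<bar> \<le> K * sup_norm T (\<lambda>s. P s - Q s)"
      using K(2)[of t P Q] stop_stopped_path[OF *(1)] stop_stopped_path[OF *(2)] *(1,2)
      by (simp add: stopped_paths_iff)
    also have "\<dots> \<le> K * B"
      using * K(1) by (intro mult_left_mono sup_norm_le) (auto simp: stopped_paths_iff)
    finally show "\<bar>F (t, P) - F (t, Q)\<bar> \<le> K * B" .
  qed
qed

lemma boundedness_preserving_bound:
  fixes F :: "('d::finite) functional"
  assumes "boundedness_preserving T I F" "0 \<le> T"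
  obtains C where "C > 0" "\<And>t P. (t, P) \<in> stopped_paths T \<Longrightarrow> t \<in> I \<Longrightarrow>
      (\<And>s. s \<in> {0..T} \<Longrightarrow> norm (P s) \<le> R) \<Longrightarrow> \<bar>F (t, P)\<bar> \<le> C"
proof -
  obtain C where C: "C > 0" "\<And>t \<omega>. t \<in> I \<Longrightarrow> \<omega> \<in> cadlag_paths T \<Longrightarrow> t \<le> T \<Longrightarrow>
       \<omega> ` {0..t} \<subseteq> cball 0 R \<Longrightarrow> \<bar>F (t, stop T t \<omega>)\<bar> < C"
    using assms(1)[unfolded boundedness_preserving_def, rule_format, of "cball 0 R" T] assms(2) by auto
  show thesis
  proof (rule that[OF C(1)])
    fix t and P :: "'d path" assume *: "(t, P) \<in> stopped_paths T" "t \<in> I" "\<And>s. s \<in> {0..T} \<Longrightarrow> norm (P s) \<le> R"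
    then have "t \<le> T" "0 \<le> t" "P \<in> cadlag_paths T" by (auto simp: stopped_paths_iff)
    moreover have "P ` {0..t} \<subseteq> cball 0 R" using * \<open>t \<le> T\<close> by auto
    ultimately show "\<bar>F (t, P)\<bar> \<le> C"
      using C(2)[of t P] stop_stopped_path[OF *(1)] *(2) by simp
  qed
qed

lemma left_continuous_bound:
  fixes F :: "('d::finite) functional"
  assumes "left_continuous T F" "(t, P) \<in> stopped_paths T" "\<epsilon> > 0"
  obtains \<eta> where "\<eta> > 0" "\<And>u Q. (u, Q) \<in> stopped_paths T \<Longrightarrow> u < t \<Longrightarrow> t - u \<le> \<eta> \<Longrightarrow>
      (\<And>s. s \<in> {0..T} \<Longrightarrow> norm (P s - Q s) \<le> \<eta>) \<Longrightarrow> \<bar>F (t, P) - F (u, Q)\<bar> < \<epsilon>"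
proof -
  obtain \<eta> where \<eta>: "\<eta> > 0" "\<And>q. q \<in> stopped_paths T \<Longrightarrow> fst q < t \<Longrightarrow> d_inf T (t, P) q < \<eta> \<Longrightarrow>
      \<bar>F (t, P) - F q\<bar> < \<epsilon>"
    using assms(1)[unfolded left_continuous_def, rule_format, OF assms(2,3)] by auto
  show thesis
  proof (rule that[of "\<eta> / 3"])
    show "\<eta> / 3 > 0" using \<eta> by simp
    fix u and Q :: "'d path" assume *: "(u, Q) \<in> stopped_paths T" "u < t" "t - u \<le> \<eta> / 3"
      "\<And>s. s \<in> {0..T} \<Longrightarrow> norm (P s - Q s) \<le> \<eta> / 3"
    have "sup_norm T (\<lambda>s. P s - Q s) \<le> \<eta> / 3"
      using * by (intro sup_norm_le) (auto simp: stopped_paths_iff)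
    then have "d_inf T (t, P) (u, Q) < \<eta>" using * \<eta> by (simp add: d_inf_def)
    then show "\<bar>F (t, P) - F (u, Q)\<bar> < \<epsilon>" using \<eta>(2)[OF *(1)] * by simp
  qed
qed

lemma horizontal_derivative_tendsto:
  assumes "horizontally_differentiable T F" "(t, P) \<in> stopped_paths T" "t < T"
  shows "((\<lambda>h. (F (t + h, P) - F (t, P)) / h) \<longlongrightarrow> hderiv F (t, P)) (at_right 0)"
proof -
  obtain l where l: "((\<lambda>h. (F (t + h, P) - F (t, P)) / h) \<longlongrightarrow> l) (at_right 0)"
    using assms(1)[unfolded horizontally_differentiable_def, rule_format, OF assms(2)] assms(3) by auto
  then have "hderiv F (t, P) = l" by (simp add: hderiv_def tendsto_Lim)
  then show ?thesis using l by simp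
qed

text \<open>Along a path that stays stopped, the functional is left-continuous in time by
  assumption and has a right derivative given by the horizontal derivative.\<close>
lemma horizontal_increment_bound:
  assumes hd: "horizontally_differentiable T F" and lc: "left_continuous T F"
    and P: "(u, P) \<in> stopped_paths T" and uv: "u \<le> v" "v \<le> T"
    and bd: "\<And>x. u \<le> x \<Longrightarrow> x < v \<Longrightarrow> \<bar>hderiv F (x, P) - \<rho>\<bar> \<le> e"
  shows "\<bar>F (v, P) - F (u, P) - \<rho> * (v - u)\<bar> \<le> e * (v - u)"
proof (rule right_derivative_increment_bound[where f = "\<lambda>x. F (x, P)", OF uv(1)])
  fix x assume x: "u < x" "x \<le> v"
  have xP: "(x, P) \<in> stopped_paths T" using stopped_paths_later[OF P] x uv by auto
  show "((\<lambda>x. F (x, P)) \<longlongrightarrow> F (x, P)) (at_left x)"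
  proof (rule tendstoI)
    fix \<epsilon> :: real assume "\<epsilon> > 0"
    then obtain \<eta> where \<eta>: "\<eta> > 0" "\<And>u Q. (u, Q) \<in> stopped_paths T \<Longrightarrow> u < x \<Longrightarrow> x - u \<le> \<eta> \<Longrightarrow>
      (\<And>s. s \<in> {0..T} \<Longrightarrow> norm (P s - Q s) \<le> \<eta>) \<Longrightarrow> \<bar>F (x, P) - F (u, Q)\<bar> < \<epsilon>"
      using left_continuous_bound[OF lc xP] by metis
    show "\<forall>\<^sub>F y in at_left x. dist (F (y, P)) (F (x, P)) < \<epsilon>"
    proof (rule eventually_at_leftI[of "max u (x - \<eta>)"])
      show "max u (x - \<eta>) < x" using \<eta> x by simp
      fix y assume "y \<in> {max u (x - \<eta>)<..<x}"
      then show "dist (F (y, P)) (F (x, P)) < \<epsilon>"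
        using \<eta>(2)[of y P] stopped_paths_later[OF P, of y] x uv \<eta>(1)
        by (auto simp: dist_real_def abs_minus_commute)
    qed
  qed
next
  fix x assume x: "u \<le> x" "x < v"
  have xP: "(x, P) \<in> stopped_paths T" using stopped_paths_later[OF P] x uv by auto
  show "\<exists>l. \<bar>l - \<rho>\<bar> \<le> e \<and> ((\<lambda>h. (F (x + h, P) - F (x, P)) / h) \<longlongrightarrow> l) (at_right 0)"
    using horizontal_derivative_tendsto[OF hd xP] bd[OF x] x uv by auto
qed

section \<open>Vertical Taylor expansion\<close>

lemma GDERIV_unique:
  fixes D :: "'a::euclidean_space"
  assumes "GDERIV f x :> D" "GDERIV f x :> D'"
  shows "D = D'"
proof -
  have "(\<lambda>h. inner h D) = (\<lambda>h. inner h D')"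
    using assms unfolding gderiv_def by (rule has_derivative_unique)
  then have "inner h (D - D') = 0" for h by (metis inner_diff_right right_minus_eq)
  then show ?thesis by (metis inner_eq_zero_iff right_minus_eq)
qed

lemma differentiable_imp_GDERIV:
  fixes f :: "real^'n \<Rightarrow> real"
  assumes "f differentiable (at x)"
  obtains D where "GDERIV f x :> D"
proof -
  obtain f' where f': "(f has_derivative f') (at x)" using assms by (auto simp: differentiable_def)
  then interpret f': linear f' by (simp add: has_derivative_linear)
  define D where "D = (\<chi> i. f' (axis i 1))"
  have "f' h = inner h D" for h
  proof -
    have "f' h = f' (\<Sum>i\<in>UNIV. (h $ i) *\<^sub>R axis i 1)"
      using basis_expansion[of h] by (simp add: scalar_mult_eq_scaleR)
    also have "\<dots> = inner h D" by (simp add: f'.sum f'.scaleR inner_vec_def D_def)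
    finally show ?thesis .
  qed
  then have "f' = (\<lambda>h. inner h D)" by auto
  then show ?thesis using f' that unfolding gderiv_def by simp
qed

lemma vgrad_eqI:
  assumes "GDERIV (\<lambda>e. F (t, bump T t P e)) 0 :> D"
  shows "vgrad T F (t, P) = D"
  unfolding vgrad_def using assms by (auto intro: the_equality GDERIV_unique)

lemma GDERIV_vgrad:
  assumes "vertically_differentiable T F" "(t, P) \<in> stopped_paths T"
  shows "GDERIV (\<lambda>e. F (t, bump T t P e)) 0 :> vgrad T F (t, P)"
proof -
  have "(\<lambda>e. F (t, bump T t P e)) differentiable (at 0)"
    using assms unfolding vertically_differentiable_def by auto
  then obtain D where "GDERIV (\<lambda>e. F (t, bump T t P e)) 0 :> D"
    by (rule differentiable_imp_GDERIV)
  then show ?thesis using vgrad_eqI by metis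
qed

lemma DERIV_along_bump:
  assumes "vertically_differentiable T F" "(t, P) \<in> stopped_paths T"
  shows "DERIV (\<lambda>y. F (t, bump T t P (y *\<^sub>R \<delta>))) x :> \<delta> \<bullet> vgrad T F (t, bump T t P (x *\<^sub>R \<delta>))"
proof -
  define Q where "Q = bump T t P (x *\<^sub>R \<delta>)"
  have "((\<lambda>e. F (t, bump T t Q e)) has_derivative (\<lambda>h. h \<bullet> vgrad T F (t, Q))) (at ((x - x) *\<^sub>R \<delta>))"
    using GDERIV_vgrad[OF assms(1) stopped_paths_bump[OF assms(2), of "x *\<^sub>R \<delta>"]]
    by (simp add: gderiv_def Q_def)
  moreover have "((\<lambda>y. (y - x) *\<^sub>R \<delta>) has_derivative (\<lambda>h. h *\<^sub>R \<delta>)) (at x)"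
    by (auto intro!: derivative_eq_intros)
  ultimately have "((\<lambda>y. F (t, bump T t Q ((y - x) *\<^sub>R \<delta>))) has_derivative
      (\<lambda>h. (h *\<^sub>R \<delta>) \<bullet> vgrad T F (t, Q))) (at x)"
    by (rule has_derivative_compose[rotated])
  moreover have "bump T t Q ((y - x) *\<^sub>R \<delta>) = bump T t P (y *\<^sub>R \<delta>)" for y
    unfolding Q_def bump_bump by (simp add: algebra_simps)
  ultimately show ?thesis by (simp add: has_field_derivative_def Q_def mult_commute_abs mult.commute)
qed

lemma vertical_increment_bound:
  assumes "vertically_differentiable T F" "(t, P) \<in> stopped_paths T"
    and "\<And>\<theta>. 0 \<le> \<theta> \<Longrightarrow> \<theta> \<le> 1 \<Longrightarrow> norm (vgrad T F (t, bump T t P (\<theta> *\<^sub>R \<delta>))) \<le> C"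
  shows "\<bar>F (t, bump T t P \<delta>) - F (t, P)\<bar> \<le> C * norm \<delta>"
proof -
  have P: "bump T t P 0 = P" using assms(2) by (auto simp: stopped_paths_iff intro: bump_0)
  obtain z :: real where z: "0 < z" "z < 1" "F (t, bump T t P (1 *\<^sub>R \<delta>)) - F (t, bump T t P (0 *\<^sub>R \<delta>))
      = (1 - 0) * (\<delta> \<bullet> vgrad T F (t, bump T t P (z *\<^sub>R \<delta>)))"
    using MVT2[of 0 1 "\<lambda>y. F (t, bump T t P (y *\<^sub>R \<delta>))"
        "\<lambda>x. \<delta> \<bullet> vgrad T F (t, bump T t P (x *\<^sub>R \<delta>))"] DERIV_along_bump[OF assms(1,2)] by auto
  have "\<bar>F (t, bump T t P \<delta>) - F (t, P)\<bar> = \<bar>\<delta> \<bullet> vgrad T F (t, bump T t P (z *\<^sub>R \<delta>))\<bar>"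
    using z(3) P by simp
  also have "\<dots> \<le> norm \<delta> * norm (vgrad T F (t, bump T t P (z *\<^sub>R \<delta>)))"
    by (rule Cauchy_Schwarz_ineq2)
  also have "\<dots> \<le> norm \<delta> * C" using assms(3)[of z] z by (intro mult_left_mono) auto
  finally show ?thesis by (simp add: mult.commute)
qed

text \<open>The line \<open>x \<mapsto> F(t, bump x \<delta>)\<close> is twice differentiable
  because a bump of a bump is a bump. The Lagrange form of the remainder suits a Hessian that is
  merely left-continuous.\<close>
lemma vertical_Taylor:
  assumes F: "vertically_differentiable T F"
    and G: "\<And>i. vertically_differentiable T (\<lambda>p. vgrad T F p $ i)"
    and P: "(t, P) \<in> stopped_paths T"
  obtains \<theta> where "0 \<le> \<theta>" "\<theta> \<le> 1"
    "F (t, bump T t P \<delta>) = F (t, P) + vgrad T F (t, P) \<bullet> \<delta>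
       + (\<delta> \<bullet> (vhess T F (t, bump T t P (\<theta> *\<^sub>R \<delta>)) *v \<delta>)) / 2"
proof -
  have P0: "bump T t P 0 = P" using P by (auto simp: stopped_paths_iff intro: bump_0)
  define diff where "diff m = (if m = 0 then (\<lambda>x. F (t, bump T t P (x *\<^sub>R \<delta>)))
     else if m = 1 then (\<lambda>x. \<delta> \<bullet> vgrad T F (t, bump T t P (x *\<^sub>R \<delta>)))
     else (\<lambda>x. \<delta> \<bullet> (vhess T F (t, bump T t P (x *\<^sub>R \<delta>)) *v \<delta>)))" for m :: nat
  have d1: "DERIV (diff 0) x :> diff 1 x" for x
    unfolding diff_def using DERIV_along_bump[OF F P] by simp
  have d2: "DERIV (diff 1) x :> diff (Suc 1) x" for x
  proof -
    have "DERIV (\<lambda>x. \<Sum>i\<in>UNIV. \<delta> $ i * vgrad T F (t, bump T t P (x *\<^sub>R \<delta>)) $ i) x :>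
       (\<Sum>i\<in>UNIV. \<delta> $ i * (\<delta> \<bullet> vgrad T (\<lambda>p. vgrad T F p $ i) (t, bump T t P (x *\<^sub>R \<delta>))))"
      by (intro DERIV_sum DERIV_cmult DERIV_along_bump[OF G P])
    also have "(\<Sum>i\<in>UNIV. \<delta> $ i * (\<delta> \<bullet> vgrad T (\<lambda>p. vgrad T F p $ i) (t, bump T t P (x *\<^sub>R \<delta>))))
       = \<delta> \<bullet> (vhess T F (t, bump T t P (x *\<^sub>R \<delta>)) *v \<delta>)"
      by (simp add: inner_vec_def matrix_vector_mult_def vhess_def sum_distrib_left)
        (subst sum.swap, simp add: mult_ac)
    finally show ?thesis by (simp add: diff_def inner_vec_def)
  qed
  have "\<exists>x::real. 0 < x \<and> x < 1 \<and> diff 0 1 = (\<Sum>m<2. (diff m 0 / fact m) * 1 ^ m) + (diff 2 x / fact 2) * 1 ^ 2"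
  proof (rule Maclaurin)
    show "\<forall>m t. m < 2 \<and> 0 \<le> t \<and> t \<le> 1 \<longrightarrow> DERIV (diff m) t :> diff (Suc m) t"
      using d1 d2 by (auto simp: less_2_cases_iff)
  qed auto
  then obtain x where "0 < x" "x < 1" "diff 0 1 = diff 0 0 + diff 1 0 + diff 2 x / 2"
    by (auto simp: numeral_2_eq_2)
  then show thesis using P0 by (intro that[of x]) (auto simp: diff_def inner_commute)
qed

section \<open>Staircase approximations of a path\<close>

text \<open>The path that jumps at \<open>\<tau> j\<close> to the value of \<open>\<omega>\<close>
  at the next grid point, after following \<open>\<omega>\<close> up to \<open>\<tau> 0\<close>.
  Building it from bumps makes each step one vertical move; started at \<open>0\<close> it
  reproduces the left limits of the piecewise constant path in the pathwise integral.\<close>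
fun staircase :: "real \<Rightarrow> (nat \<Rightarrow> real) \<Rightarrow> ('d::finite) path \<Rightarrow> nat \<Rightarrow> 'd path" where
  "staircase T \<tau> \<omega> 0 = stop T (\<tau> 0) \<omega>"
| "staircase T \<tau> \<omega> (Suc j) = bump T (\<tau> j) (staircase T \<tau> \<omega> j) (\<omega> (\<tau> (Suc j)) - \<omega> (\<tau> j))"

lemma grid_mono:
  fixes \<tau> :: "nat \<Rightarrow> real"
  assumes "\<And>j. j < k \<Longrightarrow> \<tau> j \<le> \<tau> (Suc j)" "i \<le> j" "j \<le> k"
  shows "\<tau> i \<le> \<tau> j"
  using assms(2,3)
proof (induction rule: dec_induct)
  case (step n)
  then show ?case using assms(1)[of n] by simp
qed simp

locale grid =
  fixes T :: real and \<tau> :: "nat \<Rightarrow> real" and k :: nat and \<omega> :: "('d::finite) path"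
  assumes mono: "\<And>j. j < k \<Longrightarrow> \<tau> j \<le> \<tau> (Suc j)"
    and start: "0 \<le> \<tau> 0" and finish: "\<tau> k \<le> T"
    and cont: "continuous_on {0..T} \<omega>"
begin

lemma grid_in: "j \<le> k \<Longrightarrow> 0 \<le> \<tau> j \<and> \<tau> j \<le> T"
  using grid_mono[of k \<tau> 0 j] grid_mono[of k \<tau> j k] mono start finish by force

lemma staircase_stopped:
  assumes "j \<le> k"
  shows "(\<tau> j, staircase T \<tau> \<omega> j) \<in> stopped_paths T \<and>
    (\<forall>z\<in>{\<tau> j..T}. staircase T \<tau> \<omega> j z = \<omega> (\<tau> j))"
  using assms
proof (induction j)
  case 0
  have "(\<tau> 0, stop T (\<tau> 0) \<omega>) \<in> stopped_paths T"
    using stopped_paths_stop[OF cont, of "\<tau> 0"] grid_in[of 0] by simp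
  moreover have "stop T (\<tau> 0) \<omega> z = \<omega> (\<tau> 0)" if "z \<in> {\<tau> 0..T}" for z
    using grid_in[of 0] that by (simp add: stop_def)
  ultimately show ?case by simp
next
  case (Suc j)
  then have IH: "(\<tau> j, staircase T \<tau> \<omega> j) \<in> stopped_paths T"
    "\<And>z. z \<in> {\<tau> j..T} \<Longrightarrow> staircase T \<tau> \<omega> j z = \<omega> (\<tau> j)" and jk: "j < k" by auto
  have "(\<tau> j, staircase T \<tau> \<omega> (Suc j)) \<in> stopped_paths T"
    using stopped_paths_bump[OF IH(1)] by simp
  then have "(\<tau> (Suc j), staircase T \<tau> \<omega> (Suc j)) \<in> stopped_paths T"
    by (rule stopped_paths_later) (use mono[OF jk] grid_in[OF Suc.prems] in auto)
  moreover have "staircase T \<tau> \<omega> (Suc j) z = \<omega> (\<tau> (Suc j))" if "z \<in> {\<tau> (Suc j)..T}" for z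
  proof -
    have z: "\<tau> j \<le> z" "z \<in> {0..T}" using that mono[OF jk] grid_in[of j] jk by auto
    then have "staircase T \<tau> \<omega> j z = \<omega> (\<tau> j)" using IH(2) by simp
    then show ?thesis using z by (simp add: bump_def)
  qed
  ultimately show ?case by blast
qed

lemma staircase_Suc_stopped:
  assumes "j < k"
  shows "(\<tau> j, staircase T \<tau> \<omega> (Suc j)) \<in> stopped_paths T"
  using staircase_stopped[of j] assms by (auto intro: stopped_paths_bump)

text \<open>A staircase only takes values of \<open>\<omega>\<close> at slightly later times, so
  it is uniformly close to the stopped path as soon as the grid is finer than the modulus of
  continuity.\<close>
lemma staircase_value:
  assumes "j \<le> k" "z \<in> {0..T}" and h: "0 \<le> h" "\<And>l. l < k \<Longrightarrow> \<tau> (Suc l) - \<tau> l \<le> h"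
  obtains z' where "z' \<in> {0..T}" "staircase T \<tau> \<omega> j z = \<omega> z'" "min z (\<tau> j) \<le> z'" "z' \<le> min z (\<tau> j) + h"
proof -
  have "\<exists>z'. z' \<in> {0..T} \<and> staircase T \<tau> \<omega> j z = \<omega> z' \<and> min z (\<tau> j) \<le> z' \<and> z' \<le> min z (\<tau> j) + h"
    using assms(1)
  proof (induction j)
    case 0
    then show ?case using assms(2) h(1) grid_in[of 0]
      by (intro exI[of _ "min z (\<tau> 0)"]) (auto simp: stop_def min.commute)
  next
    case (Suc j)
    then have jk: "j < k" by simp
    show ?case
    proof (cases "z < \<tau> j")
      case True
      then obtain z' where "z' \<in> {0..T}" "staircase T \<tau> \<omega> j z = \<omega> z'" "z \<le> z'" "z' \<le> z + h"
        using Suc by (auto simp: min_def split: if_splits)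
      then show ?thesis using True mono[OF jk] assms(2)
        by (intro exI[of _ z']) (auto simp: bump_def)
    next
      case False
      then have "staircase T \<tau> \<omega> j z = \<omega> (\<tau> j)" using staircase_stopped[of j] jk assms(2) by auto
      then have "staircase T \<tau> \<omega> (Suc j) z = \<omega> (\<tau> (Suc j))" using False assms(2) by (simp add: bump_def)
      then show ?thesis using False h(2)[OF jk] h(1) mono[OF jk] grid_in[OF Suc.prems]
        by (intro exI[of _ "\<tau> (Suc j)"]) (auto simp: min_def)
    qed
  qed
  then show thesis using that by blast
qed

lemma staircase_norm_le:
  assumes "j \<le> k" "z \<in> {0..T}" "\<And>z. z \<in> {0..T} \<Longrightarrow> norm (\<omega> z) \<le> R"
  shows "norm (staircase T \<tau> \<omega> j z) \<le> R"
proof -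
  define h where "h = (\<Sum>l<k. \<tau> (Suc l) - \<tau> l)"
  have "\<tau> (Suc l) - \<tau> l \<le> h" if "l < k" for l
    unfolding h_def using mono that
    by (intro member_le_sum[of l "{..<k}" "\<lambda>l. \<tau> (Suc l) - \<tau> l"]) auto
  moreover have "0 \<le> h" unfolding h_def using mono by (intro sum_nonneg) auto
  ultimately obtain z' where "z' \<in> {0..T}" "staircase T \<tau> \<omega> j z = \<omega> z'"
    using staircase_value[OF assms(1,2)] by metis
  then show ?thesis using assms(3) by simp
qed

end

section \<open>Second-order remainder of a functional along a path\<close>

text \<open>All quantitative regularity of \<open>F\<close> on paths of norm at most
  \<open>R\<close>, with a single constant. The condition \<open>norm (P s) + norm v \<le>
  R\<close> keeps the whole segment from \<open>P\<close> to its bump by \<open>v\<close> in that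
  ball.\<close>
locale regular_functional =
  fixes T C R :: real and F :: "('d::finite) functional"
  assumes C_pos: "C > 0"
    and path_lipschitz: "\<And>t P Q B. (t, P) \<in> stopped_paths T \<Longrightarrow> (t, Q) \<in> stopped_paths T \<Longrightarrow>
      (\<And>s. s \<in> {0..T} \<Longrightarrow> norm (P s - Q s) \<le> B) \<Longrightarrow> \<bar>F (t, P) - F (t, Q)\<bar> \<le> C * B"
    and time_lipschitz: "\<And>u v P. (u, P) \<in> stopped_paths T \<Longrightarrow> u \<le> v \<Longrightarrow> v \<le> T \<Longrightarrow>
      (\<And>s. s \<in> {0..T} \<Longrightarrow> norm (P s) \<le> R) \<Longrightarrow> \<bar>F (v, P) - F (u, P)\<bar> \<le> C * (v - u)"
    and grad_time_lipschitz: "\<And>u v P. (u, P) \<in> stopped_paths T \<Longrightarrow> u \<le> v \<Longrightarrow> v \<le> T \<Longrightarrow>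
      (\<And>s. s \<in> {0..T} \<Longrightarrow> norm (P s) \<le> R) \<Longrightarrow> norm (vgrad T F (v, P) - vgrad T F (u, P)) \<le> C * (v - u)"
    and grad_bound: "\<And>t P. (t, P) \<in> stopped_paths T \<Longrightarrow>
      (\<And>s. s \<in> {0..T} \<Longrightarrow> norm (P s) \<le> R) \<Longrightarrow> norm (vgrad T F (t, P)) \<le> C"
    and vertical_expansion: "\<And>t P v. (t, P) \<in> stopped_paths T \<Longrightarrow>
      (\<And>s. s \<in> {0..T} \<Longrightarrow> norm (P s) + norm v \<le> R) \<Longrightarrow>
      \<bar>F (t, bump T t P v) - F (t, P) - vgrad T F (t, P) \<bullet> v\<bar> \<le> C * (norm v)\<^sup>2"
    and grad_vertical_lipschitz: "\<And>t P v. (t, P) \<in> stopped_paths T \<Longrightarrow>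
      (\<And>s. s \<in> {0..T} \<Longrightarrow> norm (P s) + norm v \<le> R) \<Longrightarrow>
      norm (vgrad T F (t, bump T t P v) - vgrad T F (t, P)) \<le> C * norm v"

lemma abel_summation_inner:
  fixes g x :: "nat \<Rightarrow> 'a::real_inner"
  shows "(\<Sum>j<k. g j \<bullet> (x (Suc j) - x j)) - g 0 \<bullet> (x k - x 0)
     = (\<Sum>j<k. (g (Suc j) - g j) \<bullet> (x k - x (Suc j)))"
proof -
  have 1: "(\<Sum>j<k. g j \<bullet> (x (Suc j) - x j)) + (\<Sum>j<k. (g (Suc j) - g j) \<bullet> x (Suc j)) = g k \<bullet> x k - g 0 \<bullet> x 0"
    by (induction k) (auto simp: inner_diff_left inner_diff_right)
  have 2: "(\<Sum>j<k. (g (Suc j) - g j) \<bullet> x k) = (g k - g 0) \<bullet> x k"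
    by (simp add: sum_lessThan_telescope flip: inner_sum_left)
  have "(\<Sum>j<k. (g (Suc j) - g j) \<bullet> (x k - x (Suc j)))
     = (g k - g 0) \<bullet> x k - (\<Sum>j<k. (g (Suc j) - g j) \<bullet> x (Suc j))"
    unfolding inner_diff_right[of _ "x k"] sum_subtractf 2 ..
  then show ?thesis using 1 by (simp add: inner_diff_left inner_diff_right)
qed

context regular_functional
begin

text \<open>Follow the staircase with \<open>k\<close> equal steps from \<open>s\<close> to
  \<open>t\<close>. Its end point is \<open>e\<close>-close to the stopped path, each step costs
  \<open>(t - s) / k\<close> for the horizontal and \<open>e\<^sup>2\<close> for the vertical
  move, and the gradients met on the way are compared with the gradient at \<open>s\<close> by
  Abel summation. The summation is what puts the increment \<open>E\<close> over the whole
  interval, and not a sum of small increments, in front of the total variation of the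
  gradients.\<close>
lemma increment_remainder_bound:
  fixes \<omega> :: "'d path"
  assumes cont: "continuous_on {0..T} \<omega>"
    and R: "\<And>x. x \<in> {0..T} \<Longrightarrow> norm (\<omega> x) \<le> R / 3"
    and st: "0 \<le> s" "s \<le> t" "t \<le> T" and k: "k > 0"
    and e: "\<And>x y. x \<in> {0..T} \<Longrightarrow> y \<in> {0..T} \<Longrightarrow> \<bar>x - y\<bar> \<le> (t - s) / real k \<Longrightarrow> norm (\<omega> x - \<omega> y) \<le> e"
    and E: "\<And>x y. x \<in> {s..t} \<Longrightarrow> y \<in> {s..t} \<Longrightarrow> norm (\<omega> x - \<omega> y) \<le> E"
  shows "\<bar>F (t, stop T t \<omega>) - F (s, stop T s \<omega>) - vgrad T F (s, stop T s \<omega>) \<bullet> (\<omega> t - \<omega> s)\<bar>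
     \<le> C * (e + (t - s) + real k * e\<^sup>2 + ((t - s) + real k * e) * E)"
proof -
  define h where "h = (t - s) / real k"
  define \<tau> where "\<tau> j = s + real j * h" for j
  have h0: "0 \<le> h" using st by (simp add: h_def)
  have \<tau>0: "\<tau> 0 = s" and \<tau>k: "\<tau> k = t" using k by (auto simp: \<tau>_def h_def)
  have \<tau>S: "\<tau> (Suc j) = \<tau> j + h" for j by (simp add: \<tau>_def algebra_simps)
  interpret grid T \<tau> k \<omega>
    by unfold_locales (use h0 \<tau>S \<tau>0 \<tau>k st cont in auto)
  have \<tau>st: "\<tau> j \<in> {s..t}" if "j \<le> k" for j
    using grid_mono[of k \<tau> 0 j] grid_mono[of k \<tau> j k] mono that \<tau>0 \<tau>k by auto
  have R0: "0 \<le> R" using R[of 0] st norm_ge_zero[of "\<omega> 0"] by (auto simp del: norm_ge_zero)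
  define P where "P = staircase T \<tau> \<omega>"
  define \<delta> where "\<delta> j = \<omega> (\<tau> (Suc j)) - \<omega> (\<tau> j)" for j
  define f where "f j = F (\<tau> j, P j)" for j
  define g where "g j = vgrad T F (\<tau> j, P j)" for j
  have Pn: "norm (P j z) \<le> R / 3" if "j \<le> k" "z \<in> {0..T}" for j z
    unfolding P_def using staircase_norm_le[OF that R] .
  have \<delta>e: "norm (\<delta> j) \<le> e" if "j < k" for j
    unfolding \<delta>_def using grid_in[of j] grid_in[of "Suc j"] that \<tau>S h0 by (intro e) (auto simp: h_def)
  have e0: "0 \<le> e" using \<delta>e[OF k] norm_ge_zero order_trans by blast
  have \<delta>R: "norm (\<delta> j) \<le> 2 * R / 3" if "j < k" for j
    using norm_triangle_ineq4[of "\<omega> (\<tau> (Suc j))" "\<omega> (\<tau> j)"] R[of "\<tau> j"] R[of "\<tau> (Suc j)"]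
      grid_in[of j] grid_in[of "Suc j"] that unfolding \<delta>_def by auto
  have step: "\<bar>f (Suc j) - f j - g j \<bullet> \<delta> j\<bar> \<le> C * h + C * e\<^sup>2"
    and gstep: "norm (g (Suc j) - g j) \<le> C * (h + e)" if j: "j < k" for j
  proof -
    have Pj: "(\<tau> j, P j) \<in> stopped_paths T" using staircase_stopped[of j] j by (simp add: P_def)
    have PS: "P (Suc j) = bump T (\<tau> j) (P j) (\<delta> j)" by (simp add: P_def \<delta>_def)
    have PSj: "(\<tau> j, P (Suc j)) \<in> stopped_paths T" using staircase_Suc_stopped[OF j] by (simp add: P_def)
    have b: "norm (P j z) + norm (\<delta> j) \<le> R" if "z \<in> {0..T}" for z
      using Pn[of j z] \<delta>R[OF j] j that by auto
    have b': "norm (P (Suc j) z) \<le> R" if "z \<in> {0..T}" for z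
      using Pn[of "Suc j" z] j that R0 by auto
    have T: "\<tau> (Suc j) \<le> T" using grid_in[of "Suc j"] j by auto
    have "\<bar>F (\<tau> (Suc j), P (Suc j)) - F (\<tau> j, P (Suc j))\<bar> \<le> C * (\<tau> (Suc j) - \<tau> j)"
      using time_lipschitz[OF PSj mono[OF j] T b'] .
    moreover have "\<bar>F (\<tau> j, P (Suc j)) - f j - g j \<bullet> \<delta> j\<bar> \<le> C * (norm (\<delta> j))\<^sup>2"
      unfolding PS f_def g_def using vertical_expansion[OF Pj b] .
    moreover have "C * (norm (\<delta> j))\<^sup>2 \<le> C * e\<^sup>2"
      using C_pos \<delta>e[OF j] by (intro mult_left_mono power_mono) auto
    ultimately show "\<bar>f (Suc j) - f j - g j \<bullet> \<delta> j\<bar> \<le> C * h + C * e\<^sup>2"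
      unfolding f_def \<tau>S by (simp add: abs_le_iff)
    have 1: "norm (vgrad T F (\<tau> (Suc j), P (Suc j)) - vgrad T F (\<tau> j, P (Suc j))) \<le> C * (\<tau> (Suc j) - \<tau> j)"
      using grad_time_lipschitz[OF PSj mono[OF j] T b'] .
    have "norm (vgrad T F (\<tau> j, P (Suc j)) - g j) \<le> C * norm (\<delta> j)"
      unfolding PS g_def using grad_vertical_lipschitz[OF Pj b] .
    also have "\<dots> \<le> C * e" using C_pos \<delta>e[OF j] by simp
    finally have 2: "norm (vgrad T F (\<tau> j, P (Suc j)) - g j) \<le> C * e" .
    show "norm (g (Suc j) - g j) \<le> C * (h + e)"
      using norm_triangle_le[OF add_mono[OF 1 2]] by (simp add: g_def \<tau>S algebra_simps)
  qed
  have A: "\<bar>f k - f 0 - (\<Sum>j<k. g j \<bullet> \<delta> j)\<bar> \<le> C * (t - s) + C * (real k * e\<^sup>2)"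
  proof -
    have "f k - f 0 - (\<Sum>j<k. g j \<bullet> \<delta> j) = (\<Sum>j<k. f (Suc j) - f j - g j \<bullet> \<delta> j)"
      using sum_lessThan_telescope[of f k] by (simp add: sum_subtractf)
    also have "\<bar>\<dots>\<bar> \<le> (\<Sum>j<k. C * h + C * e\<^sup>2)"
      by (rule order_trans[OF sum_abs], rule sum_mono) (use step in blast)
    also have "\<dots> = C * (t - s) + C * (real k * e\<^sup>2)"
      using k by (simp add: h_def field_simps)
    finally show ?thesis .
  qed
  have B: "\<bar>(\<Sum>j<k. g j \<bullet> \<delta> j) - g 0 \<bullet> (\<omega> t - \<omega> s)\<bar> \<le> C * (((t - s) + real k * e) * E)"
  proof -
    have "(\<Sum>j<k. g j \<bullet> \<delta> j) - g 0 \<bullet> (\<omega> t - \<omega> s) = (\<Sum>j<k. (g (Suc j) - g j) \<bullet> (\<omega> t - \<omega> (\<tau> (Suc j))))"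
      using abel_summation_inner[of g "\<lambda>j. \<omega> (\<tau> j)" k] by (simp add: \<delta>_def \<tau>0 \<tau>k)
    also have "\<bar>\<dots>\<bar> \<le> (\<Sum>j<k. (C * (h + e)) * E)"
    proof (rule order_trans[OF sum_abs], rule sum_mono)
      fix j assume j: "j \<in> {..<k}"
      have "\<bar>(g (Suc j) - g j) \<bullet> (\<omega> t - \<omega> (\<tau> (Suc j)))\<bar> \<le> norm (g (Suc j) - g j) * norm (\<omega> t - \<omega> (\<tau> (Suc j)))"
        by (rule Cauchy_Schwarz_ineq2)
      also have "\<dots> \<le> (C * (h + e)) * E"
        using gstep[of j] j E[of t "\<tau> (Suc j)"] \<tau>st[of "Suc j"] st C_pos h0 e0
        by (intro mult_mono) auto
      finally show "\<bar>(g (Suc j) - g j) \<bullet> (\<omega> t - \<omega> (\<tau> (Suc j)))\<bar> \<le> (C * (h + e)) * E" .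
    qed
    also have "\<dots> = C * (((t - s) + real k * e) * E)"
      using k by (simp add: h_def field_simps)
    finally show ?thesis .
  qed
  have D: "\<bar>F (t, stop T t \<omega>) - f k\<bar> \<le> C * e"
    unfolding f_def \<tau>k
  proof (rule path_lipschitz)
    show "(t, stop T t \<omega>) \<in> stopped_paths T" using stopped_paths_stop[OF cont] st by auto
    show "(t, P k) \<in> stopped_paths T" using staircase_stopped[of k] \<tau>k by (simp add: P_def)
    fix z assume z: "z \<in> {0..T}"
    obtain z' where z': "z' \<in> {0..T}" "P k z = \<omega> z'" "min z t \<le> z'" "z' \<le> min z t + h"
      using staircase_value[of k z h] z h0 \<tau>S \<tau>k unfolding P_def by auto
    show "norm (stop T t \<omega> z - P k z) \<le> e"
      using z z' st h0 by (auto simp: stop_def min.commute h_def intro!: e)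
  qed
  have fg: "f 0 = F (s, stop T s \<omega>)" "g 0 = vgrad T F (s, stop T s \<omega>)"
    by (auto simp: f_def g_def P_def \<tau>0)
  have "C * (e + (t - s) + real k * e\<^sup>2 + ((t - s) + real k * e) * E)
      = C * e + (C * (t - s) + C * (real k * e\<^sup>2)) + C * (((t - s) + real k * e) * E)"
    by (simp add: algebra_simps)
  then show ?thesis using A B D unfolding fg by linarith
qed

end

lemma finite_family_bound:
  fixes P :: "'i::finite \<Rightarrow> real \<Rightarrow> bool"
  assumes "\<And>i. \<exists>C>0. P i C" "\<And>i C C'. P i C \<Longrightarrow> C \<le> C' \<Longrightarrow> P i C'"
  obtains C where "C > 0" "\<And>i. P i C"
proof -
  obtain c where c: "\<And>i. c i > 0 \<and> P i (c i)" using assms(1) by metis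
  have le: "c i \<le> sum c UNIV" for i
    using c by (intro member_le_sum) (auto intro: less_imp_le)
  have "sum c UNIV > 0" using c by (intro sum_pos) auto
  then show thesis using that c le assms(2) by blast
qed

lemma norm_vec_le_component_bound:
  fixes v :: "real^'n"
  assumes "\<And>i. \<bar>v $ i\<bar> \<le> c"
  shows "norm v \<le> real CARD('n) * c"
proof -
  have "norm v \<le> (\<Sum>i\<in>UNIV. \<bar>v $ i\<bar>)" by (rule norm_le_l1_cart)
  also have "\<dots> \<le> (\<Sum>i\<in>(UNIV::'n set). c)" using assms by (intro sum_mono) auto
  finally show ?thesis by simp
qed

lemma quadratic_form_bound:
  fixes A :: "real^'n^'n"
  assumes "\<And>i j. \<bar>A $ i $ j\<bar> \<le> c"
  shows "\<bar>v \<bullet> (A *v v)\<bar> \<le> (real CARD('n) * (real CARD('n) * c)) * (norm v)\<^sup>2"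
proof -
  have c: "0 \<le> c" using assms order_trans abs_ge_zero by blast
  have "\<bar>(A *v v) $ i\<bar> \<le> real CARD('n) * c * norm v" for i
  proof -
    have "\<bar>(A *v v) $ i\<bar> \<le> (\<Sum>j\<in>UNIV. \<bar>A $ i $ j * v $ j\<bar>)"
      unfolding matrix_vector_mult_def by (simp add: sum_abs)
    also have "\<dots> \<le> (\<Sum>j\<in>(UNIV::'n set). c * norm v)"
      using assms component_le_norm_cart c by (intro sum_mono) (auto simp: abs_mult intro!: mult_mono)
    finally show ?thesis by simp
  qed
  then have "norm (A *v v) \<le> real CARD('n) * (real CARD('n) * c * norm v)"
    by (rule norm_vec_le_component_bound)
  then have "norm v * norm (A *v v) \<le> norm v * (real CARD('n) * (real CARD('n) * c * norm v))"
    by (intro mult_left_mono) auto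
  then show ?thesis using Cauchy_Schwarz_ineq2[of v "A *v v"]
    by (simp add: power2_eq_square mult_ac)
qed

lemma C1b_D:
  assumes "F \<in> C1b T k"
  shows "horizontally_differentiable T F" "boundedness_preserving T {0..<T} (hderiv F)"
    "left_continuous T F" "\<And>is. length is < k \<Longrightarrow> vertically_differentiable T (vderivs T is F)"
    "\<And>is. length is \<le> k \<Longrightarrow> left_continuous T (vderivs T is F)"
    "\<And>is. 1 \<le> length is \<Longrightarrow> length is \<le> k \<Longrightarrow> boundedness_preserving T {0..T} (vderivs T is F)"
proof -
  have "\<forall>is. length is \<le> k \<longrightarrow> left_continuous T (vderivs T is F)"
    using assms by (simp add: C1b_def)
  from this[rule_format, of "[]"] show "left_continuous T F" by simp
qed (use assms in \<open>auto simp: C1b_def\<close>)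

lemma C1b_time_lipschitz:
  fixes F :: "('d::finite) functional"
  assumes F: "F \<in> C1b T k" and T: "0 \<le> T"
  shows "\<exists>C>0. \<forall>u v P. (u, P) \<in> stopped_paths T \<longrightarrow> u \<le> v \<longrightarrow> v \<le> T \<longrightarrow>
      (\<forall>s\<in>{0..T}. norm (P s) \<le> R) \<longrightarrow> \<bar>F (v, P) - F (u, P)\<bar> \<le> C * (v - u)"
proof -
  obtain C where C: "C > 0" "\<And>t P. (t, P) \<in> stopped_paths T \<Longrightarrow> t \<in> {0..<T} \<Longrightarrow>
      (\<And>s. s \<in> {0..T} \<Longrightarrow> norm (P s) \<le> R) \<Longrightarrow> \<bar>hderiv F (t, P)\<bar> \<le> C"
    using boundedness_preserving_bound[OF C1b_D(2)[OF F] T, of R] by blast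
  have "\<bar>F (v, P) - F (u, P)\<bar> \<le> C * (v - u)"
    if P: "(u, P) \<in> stopped_paths T" and uv: "u \<le> v" "v \<le> T" and R: "\<forall>s\<in>{0..T}. norm (P s) \<le> R" for u v and P :: "'d path"
  proof -
    have "\<bar>hderiv F (x, P) - 0\<bar> \<le> C" if "u \<le> x" "x < v" for x
    proof -
      have "(x, P) \<in> stopped_paths T" using stopped_paths_later[OF P, of x] that uv by auto
      then show ?thesis using C(2)[of x P] R that uv stopped_paths_time[OF P] by auto
    qed
    then show ?thesis
      using horizontal_increment_bound[OF C1b_D(1)[OF F] C1b_D(3)[OF F] P uv, of 0 C] by simp
  qed
  then show ?thesis using C(1) by blast
qed

lemma R_space_D:
  assumes "F \<in> R_space T m \<pi> \<omega>"
  shows "F \<in> C1b T 2" "lipschitz_functional T F" "\<And>i. (\<lambda>p. vgrad T F p $ i) \<in> C1b T 1"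
    "vertically_differentiable T F" "\<And>i. vertically_differentiable T (\<lambda>p. vgrad T F p $ i)"
proof -
  show *: "F \<in> C1b T 2" "lipschitz_functional T F" "\<And>i. (\<lambda>p. vgrad T F p $ i) \<in> C1b T 1"
    using assms by (auto simp: R_space_def)
  show "vertically_differentiable T F" using C1b_D(4)[OF *(1), of "[]"] by simp
  show "vertically_differentiable T (\<lambda>p. vgrad T F p $ i)" for i
    using C1b_D(4)[OF *(3), of "[]" i] by simp
qed

text \<open>Boundedness of the horizontal derivatives of \<open>F\<close> and of its gradient
  gives the estimates in time, boundedness of the first two vertical derivatives gives the
  estimates for bumps.\<close>
lemma R_space_regular:
  fixes F :: "('d::finite) functional"
  assumes F: "F \<in> R_space T m \<pi> \<omega>" and T: "0 \<le> T"
  obtains C where "regular_functional T C R F"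
proof -
  note D = R_space_D[OF F]
  define N where "N = real CARD('d)"
  have N: "N \<ge> 1" unfolding N_def by (simp add: Suc_leI)
  obtain K where K: "K > 0" "\<And>t P Q B. (t, P) \<in> stopped_paths T \<Longrightarrow> (t, Q) \<in> stopped_paths T \<Longrightarrow>
      (\<And>s. s \<in> {0..T} \<Longrightarrow> norm (P s - Q s) \<le> B) \<Longrightarrow> \<bar>F (t, P) - F (t, Q)\<bar> \<le> K * B"
    using lipschitz_functional_bound[OF D(2)] by blast
  define lip where "lip f c \<longleftrightarrow> (\<forall>u v P. (u, P) \<in> stopped_paths T \<longrightarrow> u \<le> v \<longrightarrow> v \<le> T \<longrightarrow>
      (\<forall>s\<in>{0..T}. norm (P s) \<le> R) \<longrightarrow> \<bar>f (v, P) - f (u, P)\<bar> \<le> c * (v - u))"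
    for f :: "'d functional" and c
  have lip_ex: "\<exists>c>0. lip f c" if "f \<in> C1b T k" for f k
    unfolding lip_def by (rule C1b_time_lipschitz[OF that T])
  have lip_mono: "lip f c'" if "lip f c" "c \<le> c'" for f c c'
    unfolding lip_def
  proof (intro allI impI)
    fix u v and P :: "'d path"
    assume *: "(u, P) \<in> stopped_paths T" "u \<le> v" "v \<le> T" "\<forall>s\<in>{0..T}. norm (P s) \<le> R"
    have "c * (v - u) \<le> c' * (v - u)" using that * by (intro mult_right_mono) auto
    then show "\<bar>f (v, P) - f (u, P)\<bar> \<le> c' * (v - u)"
      using that(1)[unfolded lip_def, rule_format, OF *(1-3)] *(4) by fastforce
  qed
  obtain H where H: "H > 0" "lip F H" using lip_ex[OF D(1)] by blast
  obtain H1 where H1: "H1 > 0" "\<And>i. lip (\<lambda>p. vgrad T F p $ i) H1"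
    by (rule finite_family_bound[where P = "\<lambda>i. lip (\<lambda>p. vgrad T F p $ i)"])
      (use lip_ex[OF D(3)] lip_mono in blast)+
  define bnd where "bnd f c \<longleftrightarrow> (\<forall>t P. (t, P) \<in> stopped_paths T \<longrightarrow> (\<forall>s\<in>{0..T}. norm (P s) \<le> R) \<longrightarrow>
      \<bar>f (t, P)\<bar> \<le> c)" for f :: "'d functional" and c
  have bnd_ex: "\<exists>c>0. bnd (vderivs T is F) c" if "1 \<le> length is" "length is \<le> 2" for "is"
    unfolding bnd_def using boundedness_preserving_bound[OF C1b_D(6)[OF D(1) that] T, of R]
    by (metis atLeastAtMost_iff stopped_paths_time)
  have bnd_mono: "bnd f c'" if "bnd f c" "c \<le> c'" for f c c'
    using that unfolding bnd_def by (meson order_trans)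
  have bnd1: "\<exists>c>0. bnd (vderivs T [i] F) c" and bnd2: "\<exists>c>0. bnd (vderivs T [i, j] F) c" for i j
    by (rule bnd_ex; simp)+
  obtain G where G: "G > 0" "\<And>i. bnd (vderivs T [i] F) G"
    by (rule finite_family_bound[where P = "\<lambda>i. bnd (vderivs T [i] F)"])
      (use bnd1 bnd_mono in blast)+
  obtain G2 where G2: "G2 > 0" "\<And>i. bnd (vderivs T [fst i, snd i] F) G2"
    by (rule finite_family_bound[where P = "\<lambda>i. bnd (vderivs T [fst i, snd i] F)" and 'i = "'d \<times> 'd"])
      (use bnd2 bnd_mono in blast)+
  have grad: "norm (vgrad T F (t, P)) \<le> N * G"
    if "(t, P) \<in> stopped_paths T" "\<And>s. s \<in> {0..T} \<Longrightarrow> norm (P s) \<le> R" for t P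
    unfolding N_def using G(2)[unfolded bnd_def] that by (intro norm_vec_le_component_bound) simp
  have hess1: "\<bar>vgrad T (\<lambda>p. vgrad T F p $ i) (t, P) $ j\<bar> \<le> G2"
    if "(t, P) \<in> stopped_paths T" "\<And>s. s \<in> {0..T} \<Longrightarrow> norm (P s) \<le> R" for t P i j
    using G2(2)[of "(j, i)", unfolded bnd_def] that by simp
  have hess: "\<bar>v \<bullet> (vhess T F (t, P) *v v)\<bar> \<le> (N * (N * G2)) * (norm v)\<^sup>2"
    if "(t, P) \<in> stopped_paths T" "\<And>s. s \<in> {0..T} \<Longrightarrow> norm (P s) \<le> R" for t P v
    unfolding N_def using hess1[OF that] by (intro quadratic_form_bound) (simp add: vhess_def)
  have bump_R: "norm (bump T t P (\<theta> *\<^sub>R v) s) \<le> R"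
    if "s \<in> {0..T}" "\<And>s. s \<in> {0..T} \<Longrightarrow> norm (P s) + norm v \<le> R" "0 \<le> \<theta>" "\<theta> \<le> 1"
    for t P \<theta> s and v :: "real^'d"
  proof -
    have "norm (bump T t P (\<theta> *\<^sub>R v) s) \<le> norm (P s) + \<theta> * norm v"
      using that norm_triangle_ineq[of "P s" "\<theta> *\<^sub>R v"] by (auto simp: bump_def)
    also have "\<dots> \<le> norm (P s) + 1 * norm v" using that by (intro add_left_mono mult_right_mono) auto
    finally show ?thesis using that(2)[OF that(1)] by simp
  qed
  define C where "C = K + H + N * H1 + N * G + N * (N * G2)"
  have pos: "0 < N * H1" "0 < N * G" "0 < N * G2" "0 < N * (N * G2)" using N H1(1) G(1) G2(1) by auto
  have Cge: "C \<ge> K" "C \<ge> H" "C \<ge> N * H1" "C \<ge> N * G" "C \<ge> N * (N * G2)"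
    using K(1) H(1) pos by (auto simp: C_def)
  have "regular_functional T C R F"
  proof
    show "0 < C" using Cge K(1) by simp
  next
    fix t B and P Q :: "'d path"
    assume *: "(t, P) \<in> stopped_paths T" "(t, Q) \<in> stopped_paths T"
      "\<And>s. s \<in> {0..T} \<Longrightarrow> norm (P s - Q s) \<le> B"
    have "0 \<le> B" using *(3)[of 0] T norm_ge_zero[of "P 0 - Q 0"] by (auto simp del: norm_ge_zero)
    then have "K * B \<le> C * B" using Cge by (intro mult_right_mono) auto
    then show "\<bar>F (t, P) - F (t, Q)\<bar> \<le> C * B" using K(2)[OF *] by simp
  next
    fix u v and P :: "'d path"
    assume *: "(u, P) \<in> stopped_paths T" "u \<le> v" "v \<le> T" "\<And>s. s \<in> {0..T} \<Longrightarrow> norm (P s) \<le> R"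
    have "H * (v - u) \<le> C * (v - u)" using Cge * by (intro mult_right_mono) auto
    then show "\<bar>F (v, P) - F (u, P)\<bar> \<le> C * (v - u)" using H(2)[unfolded lip_def, rule_format, OF *] by simp
    have "norm (vgrad T F (v, P) - vgrad T F (u, P)) \<le> N * (H1 * (v - u))"
      unfolding N_def using H1(2)[unfolded lip_def, rule_format, OF *] by (intro norm_vec_le_component_bound) simp
    also have "\<dots> \<le> C * (v - u)" using Cge * by (simp add: mult_right_mono flip: mult.assoc)
    finally show "norm (vgrad T F (v, P) - vgrad T F (u, P)) \<le> C * (v - u)" .
  next
    fix t and P :: "'d path"
    assume *: "(t, P) \<in> stopped_paths T" "\<And>s. s \<in> {0..T} \<Longrightarrow> norm (P s) \<le> R"
    show "norm (vgrad T F (t, P)) \<le> C" using grad[OF *] Cge by simp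
  next
    fix t and v :: "real^'d" and P :: "'d path"
    assume *: "(t, P) \<in> stopped_paths T" "\<And>s. s \<in> {0..T} \<Longrightarrow> norm (P s) + norm v \<le> R"
    have bR: "norm (bump T t P (\<theta> *\<^sub>R v) s) \<le> R" if "s \<in> {0..T}" "0 \<le> \<theta>" "\<theta> \<le> 1" for \<theta> s
      using bump_R[of s P v \<theta>] * that by auto
    obtain \<theta> where \<theta>: "0 \<le> \<theta>" "\<theta> \<le> 1" "F (t, bump T t P v) = F (t, P) + vgrad T F (t, P) \<bullet> v
       + (v \<bullet> (vhess T F (t, bump T t P (\<theta> *\<^sub>R v)) *v v)) / 2"
      using vertical_Taylor[OF D(4,5) *(1)] .
    have "\<bar>v \<bullet> (vhess T F (t, bump T t P (\<theta> *\<^sub>R v)) *v v)\<bar> \<le> (N * (N * G2)) * (norm v)\<^sup>2"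
      using \<theta> by (intro hess stopped_paths_bump *(1) bR) auto
    also have "\<dots> \<le> C * (norm v)\<^sup>2" using Cge by (intro mult_right_mono) auto
    finally have le: "\<bar>v \<bullet> (vhess T F (t, bump T t P (\<theta> *\<^sub>R v)) *v v)\<bar> \<le> C * (norm v)\<^sup>2" .
    have "F (t, bump T t P v) - F (t, P) - vgrad T F (t, P) \<bullet> v
       = (v \<bullet> (vhess T F (t, bump T t P (\<theta> *\<^sub>R v)) *v v)) / 2" using \<theta>(3) by simp
    then show "\<bar>F (t, bump T t P v) - F (t, P) - vgrad T F (t, P) \<bullet> v\<bar> \<le> C * (norm v)\<^sup>2"
      using le by (simp only: abs_divide)
    have "\<bar>vgrad T F (t, bump T t P v) $ i - vgrad T F (t, P) $ i\<bar> \<le> (N * G2) * norm v" for i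
    proof (rule vertical_increment_bound[OF D(5) *(1)])
      fix \<theta> :: real assume \<theta>: "0 \<le> \<theta>" "\<theta> \<le> 1"
      show "norm (vgrad T (\<lambda>p. vgrad T F p $ i) (t, bump T t P (\<theta> *\<^sub>R v))) \<le> N * G2"
        unfolding N_def using \<theta>
        by (intro norm_vec_le_component_bound hess1 stopped_paths_bump *(1) bR) auto
    qed
    then have "norm (vgrad T F (t, bump T t P v) - vgrad T F (t, P)) \<le> N * ((N * G2) * norm v)"
      unfolding N_def by (intro norm_vec_le_component_bound) simp
    also have "\<dots> \<le> C * norm v" using Cge by (simp add: mult_right_mono flip: mult.assoc)
    finally show "norm (vgrad T F (t, bump T t P v) - vgrad T F (t, P)) \<le> C * norm v" .
  qed
  then show thesis by (rule that)
qed

section \<open>Sums over a sequence of partitions\<close>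

definition outer :: "real^'n \<Rightarrow> real^'n^'n" where
  "outer v = (\<chi> i j. v $ i * v $ j)"

lemma inner_outer: "A \<bullet> outer v = v \<bullet> (A *v v)"
  by (simp add: outer_def inner_vec_def matrix_vector_mult_def sum_distrib_left mult_ac)

lemma norm_outer: "norm (outer v) = (norm v)\<^sup>2"
proof -
  have "(norm (outer v))\<^sup>2 = (\<Sum>i\<in>UNIV. \<Sum>j\<in>UNIV. (v $ i * v $ i) * (v $ j * v $ j))"
    by (simp add: power2_norm_eq_inner outer_def inner_vec_def mult_ac)
  also have "\<dots> = (v \<bullet> v) * (v \<bullet> v)" by (simp add: inner_vec_def sum_product)
  also have "\<dots> = ((norm v)\<^sup>2)\<^sup>2" by (simp add: dot_square_norm power2_eq_square)
  finally show ?thesis by (rule power2_eq_imp_eq) auto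
qed

lemma mat_1_inner_outer: "mat 1 \<bullet> outer v = (norm v)\<^sup>2"
  by (simp add: inner_outer power2_norm_eq_inner)

lemma outer_inner_outer: "outer g \<bullet> outer v = (g \<bullet> v)\<^sup>2"
proof -
  have "outer g \<bullet> outer v = (\<Sum>i\<in>UNIV. \<Sum>j\<in>UNIV. (g $ i * v $ i) * (g $ j * v $ j))"
    by (simp add: outer_def inner_vec_def mult_ac)
  then show ?thesis by (simp add: inner_vec_def sum_product power2_eq_square)
qed

text \<open>The pairing \<open>tr (H A)\<close> of the harmonicity condition is the Euclidean
  inner product of matrices, in which the quadratic form of a matrix is its pairing with
  \<open>outer v\<close>.\<close>
lemma inner_eq_trace:
  fixes H A :: "real^'n^'n"
  assumes "transpose A = A"
  shows "H \<bullet> A = trace (H ** A)"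
proof -
  have "transpose A $ i $ j = A $ j $ i" for i j by (simp add: transpose_def)
  then have "A $ j $ i = A $ i $ j" for i j unfolding assms by simp
  then show ?thesis by (simp add: trace_def matrix_matrix_mult_def inner_vec_def)
qed

locale partitions =
  fixes T :: real and m :: "nat \<Rightarrow> nat" and \<pi> :: "nat \<Rightarrow> nat \<Rightarrow> real"
  assumes T_pos: "0 < T"
    and part: "partition_seq T m \<pi>"
    and mesh: "\<And>e. e > 0 \<Longrightarrow> \<forall>\<^sub>F n in sequentially. \<forall>i<m n. \<pi> n (Suc i) - \<pi> n i < e"
begin

lemma part_0: "\<pi> n 0 = 0" and part_m: "\<pi> n (m n) = T"
  and part_less: "i < m n \<Longrightarrow> \<pi> n i < \<pi> n (Suc i)"
  using part by (auto simp: partition_seq_def)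

lemma m_pos: "0 < m n"
  using T_pos part_0[of n] part_m[of n] by (cases "m n") auto

lemma part_mono: "i \<le> j \<Longrightarrow> j \<le> m n \<Longrightarrow> \<pi> n i \<le> \<pi> n j"
  using grid_mono[of "m n" "\<pi> n" i j] part_less[of _ n] by (auto intro: less_imp_le)

lemma part_in: "i \<le> m n \<Longrightarrow> \<pi> n i \<in> {0..T}"
  using part_mono[of 0 i n] part_mono[of i "m n" n] part_0 part_m by auto

text \<open>Intervals count only once they are completed, as in the definition of quadratic
  variation.\<close>
definition psum :: "nat \<Rightarrow> (nat \<Rightarrow> 'a::real_normed_vector) \<Rightarrow> real \<Rightarrow> 'a" where
  "psum n f x = (\<Sum>i | i < m n \<and> \<pi> n (Suc i) \<le> x. f i)"

lemma last_partition_point: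
  assumes "0 \<le> x"
  obtains k where "k \<le> m n" "{i. i < m n \<and> \<pi> n (Suc i) \<le> x} = {..<k}" "\<pi> n k \<le> x"
    "k < m n \<Longrightarrow> x < \<pi> n (Suc k)"
proof -
  define k where "k = Max {j. j \<le> m n \<and> \<pi> n j \<le> x}"
  have fin: "finite {j. j \<le> m n \<and> \<pi> n j \<le> x}" by (rule finite_subset[of _ "{..m n}"]) auto
  have "0 \<in> {j. j \<le> m n \<and> \<pi> n j \<le> x}" using assms part_0 by simp
  then have k: "k \<in> {j. j \<le> m n \<and> \<pi> n j \<le> x}" unfolding k_def using fin by (intro Max_in) auto
  have le: "j \<le> k" if "j \<le> m n" "\<pi> n j \<le> x" for j unfolding k_def using fin that by (intro Max_ge) auto
  show thesis
  proof (rule that)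
    show "k \<le> m n" "\<pi> n k \<le> x" using k by auto
    show "{i. i < m n \<and> \<pi> n (Suc i) \<le> x} = {..<k}"
    proof safe
      fix i assume "i < m n" "\<pi> n (Suc i) \<le> x"
      then show "i < k" using le[of "Suc i"] by simp
    next
      fix i assume "i < k"
      then show "i < m n" "\<pi> n (Suc i) \<le> x" using k part_mono[of "Suc i" k n] by auto
    qed
    show "x < \<pi> n (Suc k)" if "k < m n" using le[of "Suc k"] that by force
  qed
qed

lemma psum_0: "psum n f 0 = 0"
proof -
  have empty: "{i. i < m n \<and> \<pi> n (Suc i) \<le> 0} = {}"
  proof -
    have "0 < \<pi> n (Suc i)" if "i < m n" for i using part_less[OF that] part_in[of i n] that by auto
    then show ?thesis by force
  qed
  show ?thesis unfolding psum_def empty by simp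
qed

lemma psum_linear: "psum n (\<lambda>i. H \<bullet> f i - c * g i) x = H \<bullet> psum n f x - c * psum n g x"
  by (simp add: psum_def sum_subtractf inner_sum_right sum_distrib_left)

lemma psum_diff:
  assumes "x \<le> y"
  shows "psum n f y - psum n f x = (\<Sum>i | i < m n \<and> x < \<pi> n (Suc i) \<and> \<pi> n (Suc i) \<le> y. f i)"
proof -
  define B where "B = {i. i < m n \<and> \<pi> n (Suc i) \<le> x}"
  define D where "D = {i. i < m n \<and> x < \<pi> n (Suc i) \<and> \<pi> n (Suc i) \<le> y}"
  have "{i. i < m n \<and> \<pi> n (Suc i) \<le> y} = B \<union> D" using assms by (auto simp: B_def D_def)
  moreover have "sum f (B \<union> D) = sum f B + sum f D"
    by (rule sum.union_disjoint) (auto simp: B_def D_def)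
  ultimately show ?thesis by (simp add: psum_def B_def D_def)
qed

lemma psum_increments_tendsto:
  assumes x: "x \<in> {0..T}" and J: "continuous_on {0..T} J"
  shows "(\<lambda>n. psum n (\<lambda>i. J (\<pi> n (Suc i)) - J (\<pi> n i)) x) \<longlonglongrightarrow> J x - (J 0 :: real)"
proof (rule tendstoI)
  fix e :: real assume "e > 0"
  then obtain d where d: "d > 0" "\<And>y. y \<in> {0..T} \<Longrightarrow> dist y x < d \<Longrightarrow> dist (J y) (J x) < e"
    using J x unfolding continuous_on_iff by metis
  show "\<forall>\<^sub>F n in sequentially. dist (psum n (\<lambda>i. J (\<pi> n (Suc i)) - J (\<pi> n i)) x) (J x - J 0) < e"
    using mesh[OF d(1)]
  proof eventually_elim
    case (elim n)
    obtain k where k: "k \<le> m n" "{i. i < m n \<and> \<pi> n (Suc i) \<le> x} = {..<k}" "\<pi> n k \<le> x"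
      "k < m n \<Longrightarrow> x < \<pi> n (Suc k)" using last_partition_point[of x n] x by auto
    have "psum n (\<lambda>i. J (\<pi> n (Suc i)) - J (\<pi> n i)) x = J (\<pi> n k) - J 0"
      unfolding psum_def k(2) using sum_lessThan_telescope[of "\<lambda>i. J (\<pi> n i)" k] part_0 by simp
    moreover have "dist (\<pi> n k) x < d"
    proof (cases "k < m n")
      case True
      then show ?thesis using elim k(3) k(4)[OF True] by (auto simp: dist_real_def abs_if)
    next
      case False
      then show ?thesis using k part_m[of n] x d by (auto simp: dist_real_def)
    qed
    ultimately show ?case using d(2)[OF part_in[OF k(1)]] by (simp add: dist_real_def)
  qed
qed

lemma psum_length_tendsto:
  "x \<in> {0..T} \<Longrightarrow> (\<lambda>n. psum n (\<lambda>i. \<pi> n (Suc i) - \<pi> n i) x) \<longlonglongrightarrow> x"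
  using psum_increments_tendsto[of x "\<lambda>x. x"] by (simp add: continuous_on_id)

end

text \<open>The matrix \<open>A\<close> is the quadratic variation of \<open>\<omega>\<close>,
  entering through the convergence of the sums of \<open>outer\<close> of the increments.\<close>
locale covariation = partitions +
  fixes \<omega> :: "('d::finite) path" and a A :: "real \<Rightarrow> real^'d^'d"
  assumes path_cont: "continuous_on {0..T} \<omega>"
    and a_cont: "continuous_on {0..T} a"
    and a_sym: "\<And>t. t \<in> {0..T} \<Longrightarrow> transpose (a t) = a t"
    and A_deriv: "\<And>t. t \<in> {0..T} \<Longrightarrow> (A has_vector_derivative a t) (at t within {0..T})"
    and psum_outer_tendsto: "\<And>x. x \<in> {0..T} \<Longrightarrow>
      (\<lambda>n. psum n (\<lambda>i. outer (\<omega> (\<pi> n (Suc i)) - \<omega> (\<pi> n i))) x) \<longlonglongrightarrow> A x"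
begin

abbreviation dw :: "nat \<Rightarrow> nat \<Rightarrow> real^'d" where
  "dw n i \<equiv> \<omega> (\<pi> n (Suc i)) - \<omega> (\<pi> n i)"

abbreviation dt :: "nat \<Rightarrow> nat \<Rightarrow> real" where
  "dt n i \<equiv> \<pi> n (Suc i) - \<pi> n i"

lemma psum_norm_tendsto:
  assumes "x \<in> {0..T}"
  shows "(\<lambda>n. psum n (\<lambda>i. (norm (dw n i))\<^sup>2) x) \<longlonglongrightarrow> mat 1 \<bullet> A x"
proof -
  have "(\<lambda>n. mat 1 \<bullet> psum n (\<lambda>i. outer (dw n i)) x) \<longlonglongrightarrow> mat 1 \<bullet> A x"
    by (intro tendsto_intros psum_outer_tendsto assms)
  then show ?thesis by (simp add: psum_def inner_sum_right mat_1_inner_outer)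
qed

lemma A_lipschitz:
  obtains L where "L > 0" "\<And>x y. x \<in> {0..T} \<Longrightarrow> y \<in> {0..T} \<Longrightarrow> norm (A y - A x) \<le> L * \<bar>y - x\<bar>"
proof -
  have "compact (a ` {0..T})" using a_cont by (intro compact_continuous_image) auto
  then obtain L where L: "L > 0" "\<And>t. t \<in> {0..T} \<Longrightarrow> norm (a t) \<le> L"
    using compact_imp_bounded bounded_pos by (metis image_eqI)
  have "norm (A y - A x) \<le> L * norm (y - x)" if "x \<in> {0..T}" "y \<in> {0..T}" for x y
  proof (rule differentiable_bound[OF convex_real_interval(5)])
    show "(A has_derivative (\<lambda>h. h *\<^sub>R a t)) (at t within {0..T})" if "t \<in> {0..T}" for t
      using A_deriv[OF that] by (simp add: has_vector_derivative_def)
    show "onorm (\<lambda>h. h *\<^sub>R a t) \<le> L" if "t \<in> {0..T}" for t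
      by (rule onorm_le) (use L(2)[OF that] in \<open>simp add: mult.commute[of L] mult_left_mono\<close>)
  qed (use that in auto)
  then show thesis using that L(1) by simp
qed

text \<open>Summed over the intervals in \<open>(u, r]\<close>, the comparison terms converge to
  \<open>H \<bullet> (A r - A u) - (H \<bullet> a r) (r - u)\<close>, which is \<open>o(r -
  u)\<close> because \<open>A\<close> has derivative \<open>a r\<close> at \<open>r\<close>. Hence
  the limit of the sums of \<open>z\<close> has left derivative zero at \<open>r\<close>.\<close>
lemma quadratic_psum_tendsto_0:
  fixes z :: "nat \<Rightarrow> nat \<Rightarrow> real"
  assumes bound: "\<And>n i. i < m n \<Longrightarrow> \<bar>z n i\<bar> \<le> C * (dt n i + (norm (dw n i))\<^sup>2)"
    and left: "\<And>r \<epsilon>. r \<in> {0<..T} \<Longrightarrow> \<epsilon> > 0 \<Longrightarrow> \<exists>\<eta>>0. \<exists>H. \<forall>\<^sub>F n in sequentially. \<forall>i<m n.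
       r - \<eta> < \<pi> n i \<longrightarrow> \<pi> n (Suc i) \<le> r \<longrightarrow>
       \<bar>z n i - (H \<bullet> outer (dw n i) - (H \<bullet> a r) * dt n i)\<bar> \<le> \<epsilon> * (dt n i + (norm (dw n i))\<^sup>2)"
    and x: "x \<in> {0..T}"
  shows "(\<lambda>n. psum n (z n) x) \<longlonglongrightarrow> 0"
proof -
  define S where "S n y = psum n (z n) y" for n y
  define M where "M n y = psum n (\<lambda>i. dt n i + (norm (dw n i))\<^sup>2) y" for n y
  obtain L where L: "L > 0" "\<And>x y. x \<in> {0..T} \<Longrightarrow> y \<in> {0..T} \<Longrightarrow> norm (A y - A x) \<le> L * \<bar>y - x\<bar>"
    using A_lipschitz by metis
  define N where "N = norm (mat 1 :: real^'d^'d)"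
  have N: "0 \<le> N" by (simp add: N_def)
  have M_lim: "(\<lambda>n. M n v - M n u) \<longlonglongrightarrow> (v + mat 1 \<bullet> A v) - (u + mat 1 \<bullet> A u)"
    if "u \<in> {0..T}" "v \<in> {0..T}" for u v
    unfolding M_def psum_def sum.distrib
    using psum_length_tendsto psum_norm_tendsto that unfolding psum_def by (intro tendsto_intros) auto
  have M_le: "(v + mat 1 \<bullet> A v) - (u + mat 1 \<bullet> A u) \<le> (1 + N * L) * (v - u)"
    if "u \<in> {0..T}" "v \<in> {0..T}" "u \<le> v" for u v
  proof -
    have "mat 1 \<bullet> (A v - A u) \<le> N * norm (A v - A u)" unfolding N_def by (rule norm_cauchy_schwarz)
    also have "\<dots> \<le> N * (L * (v - u))" using L(2)[of u v] that N by (intro mult_left_mono) auto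
    finally show ?thesis by (simp add: inner_diff_right algebra_simps)
  qed
  have "(\<lambda>n. S n x - S n 0) \<longlonglongrightarrow> 0"
  proof (rule asymptotic_left_derivative_zero[where C = "\<bar>C\<bar> * (1 + N * L)"])
    show "0 \<le> x" using x by simp
  next
    fix u v \<delta> :: real assume uv: "0 \<le> u" "u \<le> v" "v \<le> x" and \<delta>: "\<delta> > 0"
    have in_T: "u \<in> {0..T}" "v \<in> {0..T}" using uv x by auto
    have "(\<lambda>n. \<bar>C\<bar> * (M n v - M n u)) \<longlonglongrightarrow> \<bar>C\<bar> * ((v + mat 1 \<bullet> A v) - (u + mat 1 \<bullet> A u))"
      by (intro tendsto_intros M_lim in_T)
    moreover have "\<bar>C\<bar> * ((v + mat 1 \<bullet> A v) - (u + mat 1 \<bullet> A u)) < \<bar>C\<bar> * (1 + N * L) * (v - u) + \<delta>"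
      using mult_left_mono[OF M_le[OF in_T uv(2)], of "\<bar>C\<bar>"] \<delta> by (simp add: mult.assoc)
    ultimately have "\<forall>\<^sub>F n in sequentially. \<bar>C\<bar> * (M n v - M n u) < \<bar>C\<bar> * (1 + N * L) * (v - u) + \<delta>"
      by (rule order_tendstoD)
    then show "\<forall>\<^sub>F n in sequentially. \<bar>S n v - S n u\<bar> \<le> \<bar>C\<bar> * (1 + N * L) * (v - u) + \<delta>"
    proof eventually_elim
      case (elim n)
      have "\<bar>S n v - S n u\<bar> \<le> (\<Sum>i | i < m n \<and> u < \<pi> n (Suc i) \<and> \<pi> n (Suc i) \<le> v. \<bar>C\<bar> * (dt n i + (norm (dw n i))\<^sup>2))"
        unfolding S_def psum_diff[OF uv(2)]
      proof (rule order_trans[OF sum_abs], rule sum_mono)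
        fix i assume "i \<in> {i. i < m n \<and> u < \<pi> n (Suc i) \<and> \<pi> n (Suc i) \<le> v}"
        then have i: "i < m n" by simp
        have "C * (dt n i + (norm (dw n i))\<^sup>2) \<le> \<bar>C\<bar> * (dt n i + (norm (dw n i))\<^sup>2)"
          using part_less[OF i] by (intro mult_right_mono) auto
        then show "\<bar>z n i\<bar> \<le> \<bar>C\<bar> * (dt n i + (norm (dw n i))\<^sup>2)" using bound[OF i] by simp
      qed
      also have "\<dots> = \<bar>C\<bar> * (M n v - M n u)"
        unfolding M_def psum_diff[OF uv(2)] by (simp add: sum_distrib_left)
      finally show ?case using elim by simp
    qed
  next
    fix r \<epsilon> :: real assume r: "0 < r" "r \<le> x" and \<epsilon>: "\<epsilon> > 0"
    have rT: "r \<in> {0<..T}" "r \<in> {0..T}" using r x by auto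
    define \<epsilon>' where "\<epsilon>' = \<epsilon> / (2 * (1 + N * L))"
    have NL: "1 + N * L > 0" using N L(1) by (simp add: add_pos_nonneg)
    have \<epsilon>': "\<epsilon>' > 0" using \<epsilon> NL by (simp add: \<epsilon>'_def)
    obtain \<eta>1 H where \<eta>1: "\<eta>1 > 0" and H: "\<forall>\<^sub>F n in sequentially. \<forall>i<m n.
       r - \<eta>1 < \<pi> n i \<longrightarrow> \<pi> n (Suc i) \<le> r \<longrightarrow>
       \<bar>z n i - (H \<bullet> outer (dw n i) - (H \<bullet> a r) * dt n i)\<bar> \<le> \<epsilon>' * (dt n i + (norm (dw n i))\<^sup>2)"
      using left[OF rT(1) \<epsilon>'] by blast
    define h where "h = \<epsilon> / (2 * (norm H + 1))"
    have h: "h > 0" using \<epsilon> by (simp add: h_def add_nonneg_pos)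
    have "norm H * h \<le> (norm H + 1) * h" using h by (intro mult_right_mono) auto
    also have "\<dots> = \<epsilon> / 2" unfolding h_def using add_nonneg_pos[OF norm_ge_zero, of 1 H] by (simp add: field_simps)
    finally have Hh: "norm H * h \<le> \<epsilon> / 2" .
    obtain \<eta>2 where \<eta>2: "\<eta>2 > 0" and A_near: "\<And>y. y \<in> {0..T} \<Longrightarrow> norm (y - r) < \<eta>2 \<Longrightarrow>
        norm (A y - A r - (y - r) *\<^sub>R a r) \<le> h * norm (y - r)"
      using A_deriv[OF rT(2)] h unfolding has_vector_derivative_def has_derivative_within_alt by blast
    show "\<exists>\<eta>>0. \<forall>u \<delta>. r - \<eta> < u \<longrightarrow> u < r \<longrightarrow> 0 \<le> u \<longrightarrow> 0 < \<delta> \<longrightarrow>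
       (\<forall>\<^sub>F n in sequentially. \<bar>S n r - S n u\<bar> \<le> \<epsilon> * (r - u) + \<delta>)"
    proof (intro exI[of _ "min (\<eta>1 / 2) \<eta>2"] conjI allI impI)
      show "0 < min (\<eta>1 / 2) \<eta>2" using \<eta>1 \<eta>2 by simp
      fix u \<delta> :: real assume u: "r - min (\<eta>1 / 2) \<eta>2 < u" "u < r" "0 \<le> u" and \<delta>: "0 < \<delta>"
      have uT: "u \<in> {0..T}" using u rT by auto
      define X where "X n = psum n (\<lambda>i. H \<bullet> outer (dw n i) - (H \<bullet> a r) * dt n i) r
          - psum n (\<lambda>i. H \<bullet> outer (dw n i) - (H \<bullet> a r) * dt n i) u" for n
      have "X = (\<lambda>n. (H \<bullet> psum n (\<lambda>i. outer (dw n i)) r - (H \<bullet> a r) * psum n (dt n) r)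
          - (H \<bullet> psum n (\<lambda>i. outer (dw n i)) u - (H \<bullet> a r) * psum n (dt n) u))"
        by (rule ext) (simp only: X_def psum_linear)
      moreover have "(\<lambda>n. (H \<bullet> psum n (\<lambda>i. outer (dw n i)) r - (H \<bullet> a r) * psum n (dt n) r)
          - (H \<bullet> psum n (\<lambda>i. outer (dw n i)) u - (H \<bullet> a r) * psum n (dt n) u))
          \<longlonglongrightarrow> (H \<bullet> A r - (H \<bullet> a r) * r) - (H \<bullet> A u - (H \<bullet> a r) * u)"
        by (intro tendsto_intros psum_outer_tendsto psum_length_tendsto rT uT)
      ultimately have "X \<longlonglongrightarrow> (H \<bullet> A r - (H \<bullet> a r) * r) - (H \<bullet> A u - (H \<bullet> a r) * u)"
        by (simp only:)
      then have "(\<lambda>n. \<bar>X n\<bar> + \<epsilon>' * (M n r - M n u)) \<longlonglongrightarrow>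
          \<bar>(H \<bullet> A r - (H \<bullet> a r) * r) - (H \<bullet> A u - (H \<bullet> a r) * u)\<bar>
          + \<epsilon>' * ((r + mat 1 \<bullet> A r) - (u + mat 1 \<bullet> A u))"
        by (intro tendsto_intros M_lim rT uT)
      moreover have "\<bar>(H \<bullet> A r - (H \<bullet> a r) * r) - (H \<bullet> A u - (H \<bullet> a r) * u)\<bar>
          + \<epsilon>' * ((r + mat 1 \<bullet> A r) - (u + mat 1 \<bullet> A u)) < \<epsilon> * (r - u) + \<delta>"
      proof -
        have "(H \<bullet> A r - (H \<bullet> a r) * r) - (H \<bullet> A u - (H \<bullet> a r) * u) = - (H \<bullet> (A u - A r - (u - r) *\<^sub>R a r))"
          by (simp add: inner_diff_right algebra_simps)
        also have "\<bar>\<dots>\<bar> \<le> norm H * norm (A u - A r - (u - r) *\<^sub>R a r)"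
          by (simp add: Cauchy_Schwarz_ineq2)
        also have "\<dots> \<le> norm H * (h * (r - u))"
          using A_near[OF uT] u by (intro mult_left_mono) auto
        also have "\<dots> \<le> \<epsilon> / 2 * (r - u)"
          using Hh u by (simp add: mult_right_mono flip: mult.assoc)
        finally have 1: "\<bar>(H \<bullet> A r - (H \<bullet> a r) * r) - (H \<bullet> A u - (H \<bullet> a r) * u)\<bar> \<le> \<epsilon> / 2 * (r - u)" .
        have "\<epsilon>' * ((r + mat 1 \<bullet> A r) - (u + mat 1 \<bullet> A u)) \<le> \<epsilon>' * ((1 + N * L) * (r - u))"
          using M_le[OF uT rT(2)] u \<epsilon>' by (intro mult_left_mono) auto
        also have "\<dots> = (\<epsilon>' * (1 + N * L)) * (r - u)" by (simp only: mult.assoc)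
        also have "\<epsilon>' * (1 + N * L) = \<epsilon> / 2" using NL by (simp add: \<epsilon>'_def field_simps)
        finally show ?thesis using 1 \<delta> by simp
      qed
      ultimately have ev: "\<forall>\<^sub>F n in sequentially. \<bar>X n\<bar> + \<epsilon>' * (M n r - M n u) < \<epsilon> * (r - u) + \<delta>"
        by (rule order_tendstoD)
      have "\<eta>1 / 2 > 0" using \<eta>1 by simp
      from ev H mesh[OF this]
      show "\<forall>\<^sub>F n in sequentially. \<bar>S n r - S n u\<bar> \<le> \<epsilon> * (r - u) + \<delta>"
      proof eventually_elim
        case (elim n)
        let ?I = "{i. i < m n \<and> u < \<pi> n (Suc i) \<and> \<pi> n (Suc i) \<le> r}"
        have eq: "S n r - S n u - X n = (\<Sum>i\<in>?I. z n i - (H \<bullet> outer (dw n i) - (H \<bullet> a r) * dt n i))"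
          unfolding S_def X_def psum_diff[OF less_imp_le[OF u(2)]] by (simp add: sum_subtractf)
        have "\<bar>S n r - S n u - X n\<bar> \<le> (\<Sum>i\<in>?I. \<epsilon>' * (dt n i + (norm (dw n i))\<^sup>2))"
          unfolding eq
        proof (rule order_trans[OF sum_abs], rule sum_mono)
          fix i assume i: "i \<in> ?I"
          then have "r - \<eta>1 < \<pi> n i" using elim(3) u by force
          then show "\<bar>z n i - (H \<bullet> outer (dw n i) - (H \<bullet> a r) * dt n i)\<bar> \<le> \<epsilon>' * (dt n i + (norm (dw n i))\<^sup>2)"
            using elim(2) i by blast
        qed
        also have "\<dots> = \<epsilon>' * (M n r - M n u)"
          unfolding M_def psum_diff[OF less_imp_le[OF u(2)]] by (simp add: sum_distrib_left)
        finally show ?case using elim(1) by linarith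
      qed
    qed
  qed
  then show ?thesis by (simp add: S_def psum_0)
qed

end

section \<open>The change of variable formula for harmonic functionals\<close>

lemma vhess_left_continuous:
  fixes F :: "('d::finite) functional"
  assumes F: "F \<in> C1b T 2" and P: "(r, P) \<in> stopped_paths T" and \<epsilon>: "\<epsilon> > 0"
  obtains \<eta> where "\<eta> > 0" "\<And>u Q. (u, Q) \<in> stopped_paths T \<Longrightarrow> u < r \<Longrightarrow> r - u \<le> \<eta> \<Longrightarrow>
      (\<And>s. s \<in> {0..T} \<Longrightarrow> norm (P s - Q s) \<le> \<eta>) \<Longrightarrow> norm (vhess T F (u, Q) - vhess T F (r, P)) \<le> \<epsilon>"
proof -
  define N where "N = real CARD('d)"
  have N: "N > 0" unfolding N_def by simp
  define e where "e = \<epsilon> / (N * N)"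
  have e: "e > 0" using \<epsilon> N by (simp add: e_def)
  have "\<exists>\<eta>>0. \<forall>u Q. (u, Q) \<in> stopped_paths T \<longrightarrow> u < r \<longrightarrow> r - u \<le> \<eta> \<longrightarrow>
      (\<forall>s\<in>{0..T}. norm (P s - Q s) \<le> \<eta>) \<longrightarrow> \<bar>vderivs T [i, j] F (r, P) - vderivs T [i, j] F (u, Q)\<bar> < e" for i j
  proof -
    have "left_continuous T (vderivs T [i, j] F)" by (rule C1b_D(5)[OF F]) simp
    from left_continuous_bound[OF this P e] show ?thesis by metis
  qed
  then obtain c where c: "\<And>i j. c i j > 0" "\<And>i j u Q. (u, Q) \<in> stopped_paths T \<Longrightarrow> u < r \<Longrightarrow> r - u \<le> c i j \<Longrightarrow>
      (\<forall>s\<in>{0..T}. norm (P s - Q s) \<le> c i j) \<Longrightarrow> \<bar>vderivs T [i, j] F (r, P) - vderivs T [i, j] F (u, Q)\<bar> < e"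
    by metis
  define \<eta> where "\<eta> = Min (range (\<lambda>(i, j). c i j))"
  have \<eta>0: "\<eta> > 0" unfolding \<eta>_def using c(1) by (subst Min_gr_iff) auto
  have \<eta>c: "\<eta> \<le> c i j" for i j unfolding \<eta>_def by (rule Min_le) auto
  show thesis
  proof (rule that[OF \<eta>0])
    fix u and Q :: "'d path"
    assume *: "(u, Q) \<in> stopped_paths T" "u < r" "r - u \<le> \<eta>" "\<And>s. s \<in> {0..T} \<Longrightarrow> norm (P s - Q s) \<le> \<eta>"
    have "\<bar>vderivs T [i, j] F (r, P) - vderivs T [i, j] F (u, Q)\<bar> < e" for i j
    proof (rule c(2)[OF *(1,2)])
      show "r - u \<le> c i j" using *(3) \<eta>c[of i j] by simp
      show "\<forall>s\<in>{0..T}. norm (P s - Q s) \<le> c i j" using *(4) \<eta>c[of i j] by (meson order_trans)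
    qed
    then have "\<bar>(vhess T F (u, Q) - vhess T F (r, P)) $ i $ j\<bar> \<le> e" for i j
      by (simp add: vhess_def abs_minus_commute less_imp_le)
    then have "norm ((vhess T F (u, Q) - vhess T F (r, P)) $ i) \<le> N * e" for i
      unfolding N_def by (rule norm_vec_le_component_bound)
    then have "(\<Sum>i\<in>UNIV. norm ((vhess T F (u, Q) - vhess T F (r, P)) $ i)) \<le> (\<Sum>i\<in>(UNIV::'d set). N * e)"
      by (intro sum_mono) auto
    moreover have "norm (vhess T F (u, Q) - vhess T F (r, P))
        \<le> (\<Sum>i\<in>UNIV. norm ((vhess T F (u, Q) - vhess T F (r, P)) $ i))"
      unfolding norm_vec_def by (rule L2_set_le_sum) simp
    moreover have "(\<Sum>i\<in>(UNIV::'d set). N * e) = \<epsilon>" using N by (simp add: e_def N_def)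
    ultimately show "norm (vhess T F (u, Q) - vhess T F (r, P)) \<le> \<epsilon>" by linarith
  qed
qed

context covariation
begin

lemma grid_partition: "grid T (\<pi> n) (m n) \<omega>"
  using part_less[of _ n] part_0[of n] part_m[of n] path_cont
  by unfold_locales (auto intro: less_imp_le)

lemma step_path_value:
  assumes "l < m n" "\<pi> n l \<le> z" "z < \<pi> n (Suc l)"
  shows "step_path T m \<pi> \<omega> n z = \<omega> (\<pi> n (Suc l))"
proof -
  have z: "z \<noteq> T" using part_in[of "Suc l" n] assms by auto
  have "indicator {\<pi> n i..<\<pi> n (Suc i)} z *\<^sub>R \<omega> (\<pi> n (Suc i)) = (if i = l then \<omega> (\<pi> n (Suc l)) else 0)"
    if "i < m n" for i
    using part_mono[of "Suc i" l n] part_mono[of "Suc l" i n] assms that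
    by (cases i l rule: linorder_cases) (auto simp: indicator_def)
  then have "(\<Sum>i<m n. indicator {\<pi> n i..<\<pi> n (Suc i)} z *\<^sub>R \<omega> (\<pi> n (Suc i))) =
      (\<Sum>i<m n. if i = l then \<omega> (\<pi> n (Suc l)) else 0)" by (intro sum.cong) auto
  then show ?thesis using assms(1) z by (simp add: step_path_def)
qed

lemma staircase_eq_step_path:
  assumes "i < m n" "z \<in> {0..T}"
  shows "staircase T (\<pi> n) \<omega> (Suc i) z =
    (if z < \<pi> n (Suc i) then step_path T m \<pi> \<omega> n z else \<omega> (\<pi> n (Suc i)))"
  using assms(1)
proof (induction i)
  case 0
  then show ?case using step_path_value[of 0 n z] assms(2) part_0[of n]
    by (simp add: bump_def stop_def)
next
  case (Suc i)
  then have IH: "staircase T (\<pi> n) \<omega> (Suc i) z =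
    (if z < \<pi> n (Suc i) then step_path T m \<pi> \<omega> n z else \<omega> (\<pi> n (Suc i)))" by simp
  have le: "\<pi> n (Suc i) < \<pi> n (Suc (Suc i))" using part_less[of "Suc i" n] Suc.prems by simp
  have "staircase T (\<pi> n) \<omega> (Suc (Suc i)) z = staircase T (\<pi> n) \<omega> (Suc i) z
      + (if \<pi> n (Suc i) \<le> z then \<omega> (\<pi> n (Suc (Suc i))) - \<omega> (\<pi> n (Suc i)) else 0)"
    unfolding staircase.simps(2)[of T "\<pi> n" \<omega> "Suc i"] using assms(2) by (simp add: bump_def)
  then show ?case unfolding IH using le step_path_value[of "Suc i" n z] Suc.prems by auto
qed

text \<open>At time \<open>0\<close> the convention for the left limit makes the stopped
  approximation constant with value \<open>\<omega>(\<pi> n 1)\<close>, which is the staircase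
  after its first step.\<close>
lemma stop_left_step_path:
  assumes "i < m n"
  shows "stop_left T (\<pi> n i) (step_path T m \<pi> \<omega> n) = staircase T (\<pi> n) \<omega> (if i = 0 then 1 else i)"
proof (cases i)
  case 0
  have "stop_left T 0 (step_path T m \<pi> \<omega> n) z = staircase T (\<pi> n) \<omega> 1 z" for z
  proof (cases "z \<in> {0..T}")
    case True
    have "step_path T m \<pi> \<omega> n 0 = \<omega> (\<pi> n 1)"
      using step_path_value[of 0 n 0] assms 0 part_0[of n] part_less[of 0 n] by simp
    then show ?thesis using True part_0[of n] by (simp add: stop_left_def left_lim_def bump_def stop_def)
  next
    case False
    then show ?thesis unfolding stop_left_def One_nat_def staircase.simps bump_def restrict_def
      by (simp only: if_False)
  qed
  then show ?thesis using 0 part_0[of n] by (simp add: fun_eq_iff)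
next
  case (Suc l)
  have l: "l < m n" using Suc assms by simp
  have pos: "\<pi> n i > 0" using part_less[OF l] part_in[of l n] l Suc by auto
  have ev: "\<forall>\<^sub>F z in at_left (\<pi> n i). step_path T m \<pi> \<omega> n z = \<omega> (\<pi> n i)"
    using part_less[OF l] step_path_value[OF l] Suc
    by (intro eventually_at_leftI[of "\<pi> n l"]) auto
  have "left_lim (step_path T m \<pi> \<omega> n) (\<pi> n i) = \<omega> (\<pi> n i)"
    using pos tendsto_Lim[OF _ tendsto_eventually[OF ev]] by (simp add: left_lim_def)
  then have "stop_left T (\<pi> n i) (step_path T m \<pi> \<omega> n) z = staircase T (\<pi> n) \<omega> i z" for z
  proof (cases "z \<in> {0..T}")
    case True
    then show ?thesis using \<open>left_lim _ _ = _\<close> staircase_eq_step_path[OF l True] Suc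
      by (simp add: stop_left_def)
  next
    case False
    then show ?thesis unfolding stop_left_def Suc staircase.simps bump_def restrict_def
      by (simp only: if_False)
  qed
  then show ?thesis using Suc by (simp add: fun_eq_iff)
qed

lemma path_uniformly_continuous:
  assumes "e > 0"
  obtains d where "d > 0" "\<And>x y. x \<in> {0..T} \<Longrightarrow> y \<in> {0..T} \<Longrightarrow> \<bar>x - y\<bar> < d \<Longrightarrow> norm (\<omega> x - \<omega> y) < e"
proof -
  have "uniformly_continuous_on {0..T} \<omega>"
    using path_cont by (intro compact_uniformly_continuous) auto
  then show thesis using assms that unfolding uniformly_continuous_on_def dist_norm by (metis real_norm_def)
qed

lemma jumps_small:
  assumes "e > 0"
  shows "\<forall>\<^sub>F n in sequentially. \<forall>i<m n. norm (dw n i) \<le> e"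
proof -
  obtain d where d: "d > 0" "\<And>x y. x \<in> {0..T} \<Longrightarrow> y \<in> {0..T} \<Longrightarrow> \<bar>x - y\<bar> < d \<Longrightarrow> norm (\<omega> x - \<omega> y) < e"
    using path_uniformly_continuous[OF assms] by blast
  show ?thesis using mesh[OF d(1)]
  proof eventually_elim
    case (elim n)
    show ?case
    proof (intro allI impI less_imp_le d(2))
      fix i assume "i < m n"
      then show "\<pi> n (Suc i) \<in> {0..T}" "\<pi> n i \<in> {0..T}" "\<bar>\<pi> n (Suc i) - \<pi> n i\<bar> < d"
        using part_in[of i n] part_in[of "Suc i" n] elim part_less[of i n] by auto
    qed
  qed
qed

lemma staircase_near:
  assumes r: "r \<in> {0..T}" and e: "e > 0"
  obtains \<eta> where "\<eta> > 0" "\<forall>\<^sub>F n in sequentially. \<forall>j\<le>m n. \<bar>r - \<pi> n j\<bar> \<le> \<eta> \<longrightarrow>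
      (\<forall>z\<in>{0..T}. norm (stop T r \<omega> z - staircase T (\<pi> n) \<omega> j z) \<le> e)"
proof -
  obtain d where d: "d > 0" "\<And>x y. x \<in> {0..T} \<Longrightarrow> y \<in> {0..T} \<Longrightarrow> \<bar>x - y\<bar> < d \<Longrightarrow> norm (\<omega> x - \<omega> y) < e"
    using path_uniformly_continuous[OF e] by blast
  have d3: "d / 3 > 0" using d by simp
  show thesis
  proof (rule that[OF d3])
    show "\<forall>\<^sub>F n in sequentially. \<forall>j\<le>m n. \<bar>r - \<pi> n j\<bar> \<le> d / 3 \<longrightarrow>
      (\<forall>z\<in>{0..T}. norm (stop T r \<omega> z - staircase T (\<pi> n) \<omega> j z) \<le> e)"
      using mesh[OF d3]
    proof eventually_elim
      case (elim n)
      interpret grid T "\<pi> n" "m n" \<omega> by (rule grid_partition)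
      show ?case
      proof (intro allI impI ballI)
        fix j z assume j: "j \<le> m n" "\<bar>r - \<pi> n j\<bar> \<le> d / 3" and z: "z \<in> {0..T}"
        obtain z' where z': "z' \<in> {0..T}" "staircase T (\<pi> n) \<omega> j z = \<omega> z'" "min z (\<pi> n j) \<le> z'"
          "z' \<le> min z (\<pi> n j) + d / 3"
          using staircase_value[OF j(1) z, of "d / 3"] elim d3 by (metis less_imp_le)
        have "\<bar>min r z - z'\<bar> < d" using z' j(2) d3 by (auto simp: min_def abs_if split: if_splits)
        then have "norm (\<omega> (min r z) - \<omega> z') < e" using z' z r by (intro d(2)) auto
        then show "norm (stop T r \<omega> z - staircase T (\<pi> n) \<omega> j z) \<le> e" using z z' by (simp add: stop_def)
      qed
    qed
  qed
qed

lemma path_bound: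
  obtains B where "B > 0" "\<And>x. x \<in> {0..T} \<Longrightarrow> norm (\<omega> x) \<le> B"
proof -
  have "compact (\<omega> ` {0..T})" using path_cont by (intro compact_continuous_image) auto
  then show thesis using compact_imp_bounded bounded_pos that by (metis image_eqI)
qed

lemma R_space_regular_along:
  assumes "F \<in> R_space T m \<pi> \<omega>"
  obtains C R where "regular_functional T C R F" "\<And>x. x \<in> {0..T} \<Longrightarrow> norm (\<omega> x) \<le> R / 3" "R > 0"
proof -
  obtain B where B: "B > 0" "\<And>x. x \<in> {0..T} \<Longrightarrow> norm (\<omega> x) \<le> B" by (rule path_bound) blast
  obtain C where "regular_functional T C (3 * B) F"
    using R_space_regular[OF assms less_imp_le[OF T_pos]] by blast
  then show thesis using that[of C "3 * B"] B by auto
qed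

text \<open>The part of a step of the functional along the staircase that the summand of the
  pathwise integral does not account for.\<close>
definition Ito_error :: "'d functional \<Rightarrow> nat \<Rightarrow> nat \<Rightarrow> real" where
  "Ito_error F n i =
     F (\<pi> n (Suc i), staircase T (\<pi> n) \<omega> (Suc i)) - F (\<pi> n i, staircase T (\<pi> n) \<omega> i)
       - vgrad T F (\<pi> n i, staircase T (\<pi> n) \<omega> i) \<bullet> dw n i"

lemma norm_dw_le:
  assumes "\<And>x. x \<in> {0..T} \<Longrightarrow> norm (\<omega> x) \<le> R / 3" "i < m n"
  shows "norm (dw n i) \<le> 2 * R / 3"
  using norm_triangle_ineq4[of "\<omega> (\<pi> n (Suc i))" "\<omega> (\<pi> n i)"] assms(1)[of "\<pi> n i"]
    assms(1)[of "\<pi> n (Suc i)"] part_in[of i n] part_in[of "Suc i" n] assms(2) by auto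

lemma Ito_error_bound:
  assumes reg: "regular_functional T C R F"
    and R: "\<And>x. x \<in> {0..T} \<Longrightarrow> norm (\<omega> x) \<le> R / 3" and i: "i < m n"
  shows "\<bar>Ito_error F n i\<bar> \<le> C * (dt n i + (norm (dw n i))\<^sup>2)"
proof -
  interpret grid T "\<pi> n" "m n" \<omega> by (rule grid_partition)
  interpret regular_functional T C R F by (rule reg)
  let ?P = "staircase T (\<pi> n) \<omega> i" and ?Q = "staircase T (\<pi> n) \<omega> (Suc i)"
  have P: "(\<pi> n i, ?P) \<in> stopped_paths T" using staircase_stopped[of i] i by auto
  have Q: "(\<pi> n i, ?Q) \<in> stopped_paths T" by (rule staircase_Suc_stopped[OF i])
  have "0 \<le> R" using R[of 0] T_pos norm_ge_zero[of "\<omega> 0"] by (auto simp del: norm_ge_zero)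
  then have QR: "norm (?Q z) \<le> R" if "z \<in> {0..T}" for z
    using staircase_norm_le[of "Suc i" z "R / 3"] i that R by fastforce
  have PR: "norm (?P z) + norm (dw n i) \<le> R" if "z \<in> {0..T}" for z
    using staircase_norm_le[of i z "R / 3"] i that R norm_dw_le[OF R i] by fastforce
  have "\<bar>F (\<pi> n (Suc i), ?Q) - F (\<pi> n i, ?Q)\<bar> \<le> C * dt n i"
    using time_lipschitz[OF Q _ _ QR] part_less[OF i] part_in[of "Suc i" n] i by auto
  moreover have "\<bar>F (\<pi> n i, ?Q) - F (\<pi> n i, ?P) - vgrad T F (\<pi> n i, ?P) \<bullet> dw n i\<bar> \<le> C * (norm (dw n i))\<^sup>2"
    using vertical_expansion[OF P PR] by simp
  ultimately show ?thesis unfolding Ito_error_def distrib_left by linarith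
qed

end

lemma inner_close:
  fixes X X0 Y Y0 :: "'a::real_inner"
  assumes "norm (X - X0) \<le> \<delta>" "norm (Y - Y0) \<le> \<delta>" "\<delta> \<le> 1"
  shows "\<bar>X \<bullet> Y - X0 \<bullet> Y0\<bar> \<le> \<delta> * (norm Y0 + 1 + norm X0)"
proof -
  have \<delta>: "0 \<le> \<delta>" using assms(1) norm_ge_zero order_trans by blast
  have "norm Y \<le> norm Y0 + 1" using norm_triangle_sub[of Y Y0] assms(2,3) by linarith
  then have 1: "norm (X - X0) * norm Y \<le> \<delta> * (norm Y0 + 1)" using assms \<delta> by (intro mult_mono) auto
  have 2: "norm X0 * norm (Y - Y0) \<le> norm X0 * \<delta>" using assms by (intro mult_left_mono) auto
  have "X \<bullet> Y - X0 \<bullet> Y0 = (X - X0) \<bullet> Y + X0 \<bullet> (Y - Y0)"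
    by (simp add: inner_diff_left inner_diff_right)
  also have "\<bar>\<dots>\<bar> \<le> norm (X - X0) * norm Y + norm X0 * norm (Y - Y0)"
    by (rule order_trans[OF abs_triangle_ineq] add_mono Cauchy_Schwarz_ineq2)+
  finally show ?thesis using 1 2 by (simp add: algebra_simps)
qed

context covariation
begin

lemma harmonic_D:
  assumes "F \<in> harmonic_functionals T m \<pi> a \<omega>"
  shows "F \<in> R_space T m \<pi> \<omega>"
    and "\<And>u P. (u, P) \<in> stopped_paths T \<Longrightarrow> u < T \<Longrightarrow> hderiv F (u, P) = - (vhess T F (u, P) \<bullet> a u) / 2"
proof -
  show "F \<in> R_space T m \<pi> \<omega>" using assms by (simp add: harmonic_functionals_def)
  fix u and P :: "'d path" assume P: "(u, P) \<in> stopped_paths T" "u < T"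
  have "hderiv F (u, P) + 1 / 2 * trace (vhess T F (u, P) ** a u) = 0"
    using assms P unfolding harmonic_functionals_def by fastforce
  moreover have "u \<in> {0..T}" using stopped_paths_time[OF P(1)] by simp
  ultimately show "hderiv F (u, P) = - (vhess T F (u, P) \<bullet> a u) / 2"
    using inner_eq_trace[OF a_sym, of u "vhess T F (u, P)"] by simp
qed

text \<open>With \<open>H\<close> half the Hessian at \<open>(r, \<omega>\<^sub>r)\<close>: just
  before \<open>r\<close>, left-continuity of the Hessian makes the second-order Taylor term close
  to \<open>H \<bullet> \<delta> \<delta>\<^sup>T\<close>, and by harmonicity it also makes the
  horizontal increment close to \<open>- (H \<bullet> a r) \<Delta>t\<close>.\<close>
lemma Ito_error_tendsto_0:
  assumes F: "F \<in> harmonic_functionals T m \<pi> a \<omega>" and x: "x \<in> {0..T}"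
  shows "(\<lambda>n. psum n (Ito_error F n) x) \<longlonglongrightarrow> 0"
proof -
  note RF = harmonic_D(1)[OF F]
  obtain C R where reg: "regular_functional T C R F" and R: "\<And>x. x \<in> {0..T} \<Longrightarrow> norm (\<omega> x) \<le> R / 3"
    using R_space_regular_along[OF RF] by blast
  show ?thesis
  proof (rule quadratic_psum_tendsto_0[OF _ _ x])
    show "\<bar>Ito_error F n i\<bar> \<le> C * (dt n i + (norm (dw n i))\<^sup>2)" if "i < m n" for n i
      by (rule Ito_error_bound[OF reg R that])
  next
    fix r \<epsilon> :: real assume r: "r \<in> {0<..T}" and \<epsilon>: "\<epsilon> > 0"
    have rT: "r \<in> {0..T}" using r by auto
    define P0 where "P0 = stop T r \<omega>"
    have P0: "(r, P0) \<in> stopped_paths T" unfolding P0_def using rT by (intro stopped_paths_stop path_cont) auto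
    define H0 where "H0 = vhess T F (r, P0)"
    \<comment> \<open>This tolerance absorbs the product rule error when Hessian and \<open>a\<close> both move.\<close>
    define \<epsilon>1 where "\<epsilon>1 = min 1 (\<epsilon> / (norm (a r) + 1 + norm H0))"
    have pos: "norm (a r) + 1 + norm H0 > 0" by (simp add: add_nonneg_pos add_pos_nonneg)
    have \<epsilon>1: "\<epsilon>1 > 0" "\<epsilon>1 \<le> 1" using \<epsilon> pos by (auto simp: \<epsilon>1_def)
    have \<epsilon>1_le: "\<epsilon>1 * (norm (a r) + 1 + norm H0) \<le> \<epsilon>"
    proof -
      have "\<epsilon>1 * (norm (a r) + 1 + norm H0) \<le> (\<epsilon> / (norm (a r) + 1 + norm H0)) * (norm (a r) + 1 + norm H0)"
        using pos by (intro mult_right_mono) (auto simp: \<epsilon>1_def)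
      then show ?thesis using pos by simp
    qed
    have "\<epsilon>1 * 1 \<le> \<epsilon>1 * (norm (a r) + 1 + norm H0)" using \<epsilon>1 by (intro mult_left_mono) auto
    then have \<epsilon>1_\<epsilon>: "\<epsilon>1 \<le> \<epsilon>" using \<epsilon>1_le by simp
    obtain \<eta>1 where \<eta>1: "\<eta>1 > 0" and hess: "\<And>u Q. (u, Q) \<in> stopped_paths T \<Longrightarrow> u < r \<Longrightarrow> r - u \<le> \<eta>1 \<Longrightarrow>
        (\<And>s. s \<in> {0..T} \<Longrightarrow> norm (P0 s - Q s) \<le> \<eta>1) \<Longrightarrow> norm (vhess T F (u, Q) - H0) \<le> \<epsilon>1"
      unfolding H0_def using vhess_left_continuous[OF R_space_D(1)[OF RF] P0 \<epsilon>1(1)] by metis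
    have half: "\<eta>1 / 2 > 0" using \<eta>1 by simp
    obtain \<eta>2 where \<eta>2: "\<eta>2 > 0" and near: "\<forall>\<^sub>F n in sequentially. \<forall>j\<le>m n. \<bar>r - \<pi> n j\<bar> \<le> \<eta>2 \<longrightarrow>
        (\<forall>z\<in>{0..T}. norm (P0 z - staircase T (\<pi> n) \<omega> j z) \<le> \<eta>1 / 2)"
      unfolding P0_def using staircase_near[OF rT half] by blast
    obtain \<eta>3 where \<eta>3: "\<eta>3 > 0" and a_near: "\<And>u. u \<in> {0..T} \<Longrightarrow> dist u r < \<eta>3 \<Longrightarrow> dist (a u) (a r) < \<epsilon>1"
      using a_cont rT \<epsilon>1(1) unfolding continuous_on_iff by metis
    define \<eta> where "\<eta> = min \<eta>1 (min \<eta>2 \<eta>3)"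
    show "\<exists>\<eta>>0. \<exists>H. \<forall>\<^sub>F n in sequentially. \<forall>i<m n. r - \<eta> < \<pi> n i \<longrightarrow> \<pi> n (Suc i) \<le> r \<longrightarrow>
       \<bar>Ito_error F n i - (H \<bullet> outer (dw n i) - (H \<bullet> a r) * dt n i)\<bar> \<le> \<epsilon> * (dt n i + (norm (dw n i))\<^sup>2)"
    proof (intro exI[of _ \<eta>] conjI exI[of _ "(1/2) *\<^sub>R H0"])
      show "\<eta> > 0" using \<eta>1 \<eta>2 \<eta>3 by (simp add: \<eta>_def)
      show "\<forall>\<^sub>F n in sequentially. \<forall>i<m n. r - \<eta> < \<pi> n i \<longrightarrow> \<pi> n (Suc i) \<le> r \<longrightarrow>
        \<bar>Ito_error F n i - ((1/2) *\<^sub>R H0 \<bullet> outer (dw n i) - ((1/2) *\<^sub>R H0 \<bullet> a r) * dt n i)\<bar>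
          \<le> \<epsilon> * (dt n i + (norm (dw n i))\<^sup>2)"
        using near jumps_small[OF half]
      proof eventually_elim
        case (elim n)
        interpret grid T "\<pi> n" "m n" \<omega> by (rule grid_partition)
        show ?case
        proof (intro allI impI)
          fix i assume i: "i < m n" and lower: "r - \<eta> < \<pi> n i" and upper: "\<pi> n (Suc i) \<le> r"
          let ?P = "staircase T (\<pi> n) \<omega> i" and ?Q = "staircase T (\<pi> n) \<omega> (Suc i)"
          have P: "(\<pi> n i, ?P) \<in> stopped_paths T" using staircase_stopped[of i] i by auto
          have Q: "(\<pi> n i, ?Q) \<in> stopped_paths T" by (rule staircase_Suc_stopped[OF i])
          note less = part_less[OF i]
          have range: "0 \<le> \<pi> n i" "\<pi> n (Suc i) \<le> T" using part_in[of i n] part_in[of "Suc i" n] i by auto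
          have nearP: "norm (P0 z - ?P z) \<le> \<eta>1 / 2" if "z \<in> {0..T}" for z
            using elim(1) i that lower upper less by (auto simp: \<eta>_def)
          have nearQ: "norm (P0 z - ?Q z) \<le> \<eta>1 / 2" if "z \<in> {0..T}" for z
            using elim(1)[rule_format, of "Suc i" z] i that lower upper less by (simp add: \<eta>_def)
          have "\<bar>F (\<pi> n (Suc i), ?Q) - F (\<pi> n i, ?Q) - (- (H0 \<bullet> a r) / 2) * (\<pi> n (Suc i) - \<pi> n i)\<bar>
              \<le> (\<epsilon> / 2) * (\<pi> n (Suc i) - \<pi> n i)"
          proof (rule horizontal_increment_bound)
            show "horizontally_differentiable T F" "left_continuous T F"
              using C1b_D(1,3)[OF R_space_D(1)[OF RF]] .
            show "(\<pi> n i, ?Q) \<in> stopped_paths T" by (rule Q)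
            show "\<pi> n i \<le> \<pi> n (Suc i)" "\<pi> n (Suc i) \<le> T" using less range by auto
            fix u assume u: "\<pi> n i \<le> u" "u < \<pi> n (Suc i)"
            have uQ: "(u, ?Q) \<in> stopped_paths T"
              by (rule stopped_paths_later[OF Q]) (use u range in auto)
            have "norm (vhess T F (u, ?Q) - H0) \<le> \<epsilon>1"
            proof (rule hess[OF uQ])
              show "u < r" "r - u \<le> \<eta>1" using u lower upper by (auto simp: \<eta>_def)
              show "norm (P0 s - ?Q s) \<le> \<eta>1" if "s \<in> {0..T}" for s using nearQ[OF that] \<eta>1 by simp
            qed
            moreover have "norm (a u - a r) \<le> \<epsilon>1"
            proof -
              have "r - \<eta>3 < u" "u < r" "u \<in> {0..T}" using u lower upper range by (auto simp: \<eta>_def)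
              then show ?thesis using a_near[of u] by (simp add: dist_norm)
            qed
            ultimately have "\<bar>vhess T F (u, ?Q) \<bullet> a u - H0 \<bullet> a r\<bar> \<le> \<epsilon>"
              using inner_close[of "vhess T F (u, ?Q)" H0 \<epsilon>1 "a u" "a r"] \<epsilon>1 \<epsilon>1_le by simp
            moreover have "hderiv F (u, ?Q) = - (vhess T F (u, ?Q) \<bullet> a u) / 2"
              using harmonic_D(2)[OF F uQ] u range by simp
            ultimately show "\<bar>hderiv F (u, ?Q) - - (H0 \<bullet> a r) / 2\<bar> \<le> \<epsilon> / 2" by linarith
          qed
          then have time: "\<bar>F (\<pi> n (Suc i), ?Q) - F (\<pi> n i, ?Q) + (H0 \<bullet> a r) / 2 * dt n i\<bar> \<le> \<epsilon> / 2 * dt n i"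
            by simp
          obtain \<theta> where \<theta>: "0 \<le> \<theta>" "\<theta> \<le> 1" and taylor: "F (\<pi> n i, bump T (\<pi> n i) ?P (dw n i)) =
              F (\<pi> n i, ?P) + vgrad T F (\<pi> n i, ?P) \<bullet> dw n i +
              (dw n i \<bullet> (vhess T F (\<pi> n i, bump T (\<pi> n i) ?P (\<theta> *\<^sub>R dw n i)) *v dw n i)) / 2"
            using vertical_Taylor[OF R_space_D(4)[OF RF] R_space_D(5)[OF RF] P] by metis
          define H1 where "H1 = vhess T F (\<pi> n i, bump T (\<pi> n i) ?P (\<theta> *\<^sub>R dw n i))"
          have space: "F (\<pi> n i, ?Q) - F (\<pi> n i, ?P) - vgrad T F (\<pi> n i, ?P) \<bullet> dw n i = (H1 \<bullet> outer (dw n i)) / 2"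
            using taylor by (simp add: H1_def inner_outer)
          have "norm (H1 - H0) \<le> \<epsilon>1"
            unfolding H1_def
          proof (rule hess[OF stopped_paths_bump[OF P]])
            show "\<pi> n i < r" "r - \<pi> n i \<le> \<eta>1" using less lower upper by (auto simp: \<eta>_def)
            fix s assume s: "s \<in> {0..T}"
            have "norm (\<theta> *\<^sub>R dw n i) \<le> 1 * norm (dw n i)"
              unfolding norm_scaleR using \<theta> by (intro mult_right_mono) auto
            also have "\<dots> \<le> \<eta>1 / 2" using elim(2) i by simp
            finally have v: "norm (\<theta> *\<^sub>R dw n i) \<le> \<eta>1 / 2" .
            show "norm (P0 s - bump T (\<pi> n i) ?P (\<theta> *\<^sub>R dw n i) s) \<le> \<eta>1"
            proof (cases "\<pi> n i \<le> s")
              case True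
              have eq: "P0 s - bump T (\<pi> n i) ?P (\<theta> *\<^sub>R dw n i) s = (P0 s - ?P s) - \<theta> *\<^sub>R dw n i"
                using s True by (simp add: bump_def)
              show ?thesis unfolding eq
                using norm_triangle_ineq4[of "P0 s - ?P s" "\<theta> *\<^sub>R dw n i"] nearP[OF s] v by linarith
            next
              case False
              then show ?thesis using nearP[OF s] s \<eta>1 by (simp add: bump_def)
            qed
          qed
          then have "norm (H1 - H0) * (norm (dw n i))\<^sup>2 \<le> \<epsilon> * (norm (dw n i))\<^sup>2"
            using \<epsilon>1_\<epsilon> by (intro mult_right_mono) auto
          then have "\<bar>(H1 - H0) \<bullet> outer (dw n i)\<bar> \<le> \<epsilon> * (norm (dw n i))\<^sup>2"
            using Cauchy_Schwarz_ineq2[of "H1 - H0" "outer (dw n i)"] by (simp add: norm_outer)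
          then have "\<bar>H1 \<bullet> outer (dw n i) - H0 \<bullet> outer (dw n i)\<bar> \<le> \<epsilon> * (norm (dw n i))\<^sup>2"
            by (simp add: inner_diff_left)
          moreover define h1 h0 e1 e2 where "h1 = H1 \<bullet> outer (dw n i)" and "h0 = H0 \<bullet> outer (dw n i)"
            and "e1 = \<epsilon> * (norm (dw n i))\<^sup>2" and "e2 = \<epsilon> * dt n i"
          moreover define f k where "f = F (\<pi> n (Suc i), ?Q) - F (\<pi> n i, ?Q)" and "k = (H0 \<bullet> a r) * dt n i"
          moreover have "Ito_error F n i = f + h1 / 2"
            using space by (simp add: Ito_error_def f_def h1_def)
          moreover have "0 \<le> e1" "0 \<le> e2" using \<epsilon> less by (auto simp: e1_def e2_def)
          moreover have "\<bar>f + k / 2\<bar> \<le> e2 / 2" using time by (simp add: f_def k_def e2_def)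
          ultimately have "\<bar>Ito_error F n i - (h0 / 2 - k / 2)\<bar> \<le> e2 + e1" by linarith
          then show "\<bar>Ito_error F n i - ((1/2) *\<^sub>R H0 \<bullet> outer (dw n i) - ((1/2) *\<^sub>R H0 \<bullet> a r) * dt n i)\<bar>
              \<le> \<epsilon> * (dt n i + (norm (dw n i))\<^sup>2)"
            by (simp add: h0_def k_def e1_def e2_def distrib_left)
        qed
      qed
    qed
  qed
qed

text \<open>The steps of the functional along the staircase telescope. What remains besides the
  errors vanishes in the limit: the first summand, where the left limit at \<open>0\<close>
  differs from the staircase; the summand of the interval containing \<open>t\<close>, which is
  only partly integrated; and the distance of the staircase at the last partition point from the
  path stopped at \<open>t\<close>.\<close>
lemma integral_sum_tendsto:
  assumes F: "F \<in> harmonic_functionals T m \<pi> a \<omega>" and t: "t \<in> {0..T}"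
  shows "integral_sum T m \<pi> \<omega> F t \<longlonglongrightarrow> F (t, stop T t \<omega>) - F (0, stop T 0 \<omega>)"
proof (rule tendstoI)
  fix e :: real assume e: "e > 0"
  obtain C R where reg: "regular_functional T C R F" and R: "\<And>x. x \<in> {0..T} \<Longrightarrow> norm (\<omega> x) \<le> R / 3"
      and R0: "R > 0"
    using R_space_regular_along[OF harmonic_D(1)[OF F]] by blast
  interpret regular_functional T C R F by (rule reg)
  define \<epsilon> where "\<epsilon> = e / (5 * C + 2)"
  have \<epsilon>: "\<epsilon> > 0" using e C_pos by (simp add: \<epsilon>_def)
  have \<epsilon>e: "5 * (C * \<epsilon>) + \<epsilon> < e"
  proof -
    have "5 * (C * \<epsilon>) + 2 * \<epsilon> = (5 * C + 2) * \<epsilon>" by (simp add: algebra_simps)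
    also have "\<dots> = e" using C_pos by (simp add: \<epsilon>_def)
    finally show ?thesis using \<epsilon> by linarith
  qed
  obtain \<eta> where \<eta>: "\<eta> > 0" and near: "\<forall>\<^sub>F n in sequentially. \<forall>j\<le>m n. \<bar>t - \<pi> n j\<bar> \<le> \<eta> \<longrightarrow>
      (\<forall>z\<in>{0..T}. norm (stop T t \<omega> z - staircase T (\<pi> n) \<omega> j z) \<le> \<epsilon>)"
    using staircase_near[OF t \<epsilon>] by blast
  obtain d where d: "d > 0" "\<And>x y. x \<in> {0..T} \<Longrightarrow> y \<in> {0..T} \<Longrightarrow> \<bar>x - y\<bar> < d \<Longrightarrow> norm (\<omega> x - \<omega> y) < \<epsilon>"
    using path_uniformly_continuous[OF \<epsilon>] by blast
  define \<mu> where "\<mu> = min \<eta> (min \<epsilon> d)"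
  have \<mu>: "\<mu> > 0" using \<eta> \<epsilon> d by (simp add: \<mu>_def)
  have "\<forall>\<^sub>F n in sequentially. dist (psum n (Ito_error F n) t) 0 < \<epsilon>"
    by (rule tendstoD[OF Ito_error_tendsto_0[OF F t] \<epsilon>])
  from this near jumps_small[OF \<epsilon>] mesh[OF \<mu>]
  show "\<forall>\<^sub>F n in sequentially. dist (integral_sum T m \<pi> \<omega> F t n) (F (t, stop T t \<omega>) - F (0, stop T 0 \<omega>)) < e"
  proof eventually_elim
    case (elim n)
    interpret grid T "\<pi> n" "m n" \<omega> by (rule grid_partition)
    let ?P = "staircase T (\<pi> n) \<omega>"
    have PR: "norm (?P j z) \<le> R" if "j \<le> m n" "z \<in> {0..T}" for j z
      using staircase_norm_le[of j z "R / 3"] that R R0 by fastforce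
    obtain k where k: "k \<le> m n" "{i. i < m n \<and> \<pi> n (Suc i) \<le> t} = {..<k}" "\<pi> n k \<le> t"
      "k < m n \<Longrightarrow> t < \<pi> n (Suc k)" using last_partition_point[of t n] t by auto
    have tk: "t - \<pi> n k < \<mu>"
    proof (cases "k < m n")
      case True
      then show ?thesis using elim(4) k(3) k(4)[OF True] by force
    next
      case False
      then show ?thesis using k part_m[of n] t \<mu> by auto
    qed
    have k_in: "\<pi> n k \<in> {0..T}" by (rule part_in[OF k(1)])
    define G where "G i = vgrad T F (\<pi> n i, ?P i)" for i
    define G' where "G' i = vgrad T F (\<pi> n i, stop_left T (\<pi> n i) (step_path T m \<pi> \<omega> n))" for i
    have G: "norm (G i) \<le> C" if "i \<le> m n" for i
      unfolding G_def using staircase_stopped[OF that] PR[OF that] by (intro grad_bound) auto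
    have G'_eq: "G' i = G i" if "i < m n" "i > 0" for i
      using stop_left_step_path[OF that(1)] that by (simp add: G_def G'_def)
    have G'0: "norm (G' 0) \<le> C"
      unfolding G'_def stop_left_step_path[OF m_pos]
      using staircase_Suc_stopped[of 0] m_pos[of n] Suc_leI[OF m_pos[of n]] PR[of 1] by (intro grad_bound) auto
    define last where "last = (if k < m n then G' k \<bullet> (\<omega> t - \<omega> (\<pi> n k)) else 0)"
    have "integral_sum T m \<pi> \<omega> F t n = (\<Sum>i<k. G' i \<bullet> dw n i) + last"
    proof -
      define f where "f i = G' i \<bullet> (\<omega> (min (\<pi> n (Suc i)) t) - \<omega> (min (\<pi> n i) t))" for i
      have full: "f i = G' i \<bullet> dw n i" if "i < k" for i
      proof -
        have "\<pi> n (Suc i) \<le> t" using k(2) that by blast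
        moreover have "\<pi> n i < \<pi> n (Suc i)" using part_less[of i n] that k(1) by auto
        ultimately show ?thesis by (simp add: f_def)
      qed
      have zero: "f i = 0" if "k < i" "i < m n" for i
      proof -
        have "t < \<pi> n i" using k(4) part_mono[of "Suc k" i n] that by auto
        moreover have "\<pi> n i < \<pi> n (Suc i)" using part_less[of i n] that by auto
        ultimately show ?thesis by (simp add: f_def)
      qed
      have "sum f {..<m n} = sum f {..<k} + last"
      proof (cases "k < m n")
        case True
        have "{..<m n} = {..<Suc k} \<union> {Suc k..<m n}" using True by auto
        moreover have "sum f ({..<Suc k} \<union> {Suc k..<m n}) = sum f {..<Suc k} + sum f {Suc k..<m n}"
          by (rule sum.union_disjoint) auto
        ultimately have "sum f {..<m n} = sum f {..<Suc k} + sum f {Suc k..<m n}" by metis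
        moreover have "sum f {Suc k..<m n} = 0" using zero by (intro sum.neutral) auto
        moreover have "f k = last" using True k(3) k(4)[OF True] by (simp add: f_def last_def)
        ultimately show ?thesis by simp
      next
        case False
        then show ?thesis using k(1) by (simp add: last_def)
      qed
      moreover have "sum f {..<k} = (\<Sum>i<k. G' i \<bullet> dw n i)" using full by (intro sum.cong) auto
      ultimately show ?thesis by (simp add: integral_sum_def f_def G'_def)
    qed
    moreover have "\<bar>last\<bar> \<le> C * \<epsilon>"
    proof (cases "k < m n")
      case True
      have "norm (\<omega> t - \<omega> (\<pi> n k)) \<le> \<epsilon>"
        using d(2)[of t "\<pi> n k"] t k_in k(3) tk by (auto simp: \<mu>_def intro: less_imp_le)
      moreover have "norm (G' k) \<le> C" using G'_eq[of k] G[of k] G'0 True by (cases "k = 0") auto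
      ultimately have "norm (G' k) * norm (\<omega> t - \<omega> (\<pi> n k)) \<le> C * \<epsilon>"
        using C_pos by (intro mult_mono) auto
      then show ?thesis
        using True Cauchy_Schwarz_ineq2[of "G' k" "\<omega> t - \<omega> (\<pi> n k)"] by (simp add: last_def)
    next
      case False
      then show ?thesis using C_pos \<epsilon> by (simp add: last_def)
    qed
    moreover have "\<bar>(\<Sum>i<k. G' i \<bullet> dw n i) - (\<Sum>i<k. G i \<bullet> dw n i)\<bar> \<le> 2 * (C * \<epsilon>)"
    proof (cases k)
      case 0
      then show ?thesis using C_pos \<epsilon> by simp
    next
      case (Suc l)
      have "(\<Sum>i<k. G' i \<bullet> dw n i) - (\<Sum>i<k. G i \<bullet> dw n i) = (G' 0 - G 0) \<bullet> dw n 0"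
        unfolding Suc sum.lessThan_Suc_shift using G'_eq Suc k(1) by (simp add: inner_diff_left)
      also have "\<bar>\<dots>\<bar> \<le> norm (G' 0 - G 0) * norm (dw n 0)" by (rule Cauchy_Schwarz_ineq2)
      also have "\<dots> \<le> (2 * C) * \<epsilon>"
        using norm_triangle_ineq4[of "G' 0" "G 0"] G[of 0] G'0 elim(3) m_pos[of n] C_pos
        by (intro mult_mono) auto
      finally show ?thesis by simp
    qed
    moreover have "(\<Sum>i<k. G i \<bullet> dw n i) = F (\<pi> n k, ?P k) - F (0, stop T 0 \<omega>) - psum n (Ito_error F n) t"
    proof -
      define f where "f i = F (\<pi> n i, ?P i)" for i
      have "psum n (Ito_error F n) t = (\<Sum>i<k. f (Suc i) - f i) - (\<Sum>i<k. G i \<bullet> dw n i)"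
        unfolding psum_def k(2) by (simp only: Ito_error_def[abs_def] f_def G_def sum_subtractf)
      moreover have "(\<Sum>i<k. f (Suc i) - f i) = f k - f 0" by (rule sum_lessThan_telescope)
      moreover have "f 0 = F (0, stop T 0 \<omega>)" using part_0[of n] by (simp add: f_def)
      ultimately show ?thesis by (simp add: f_def)
    qed
    moreover have "\<bar>F (\<pi> n k, ?P k) - F (t, stop T t \<omega>)\<bar> \<le> 2 * (C * \<epsilon>)"
    proof -
      have Pk: "(\<pi> n k, ?P k) \<in> stopped_paths T" using staircase_stopped[OF k(1)] by auto
      have tT: "0 \<le> t" "t \<le> T" using t by auto
      have tPk: "(t, ?P k) \<in> stopped_paths T" by (rule stopped_paths_later[OF Pk k(3) tT(2)])
      have "\<bar>F (t, ?P k) - F (\<pi> n k, ?P k)\<bar> \<le> C * (t - \<pi> n k)"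
        by (rule time_lipschitz[OF Pk k(3) tT(2) PR[OF k(1)]])
      also have "\<dots> \<le> C * \<epsilon>" using tk C_pos by (intro mult_left_mono) (auto simp: \<mu>_def)
      finally have 1: "\<bar>F (t, ?P k) - F (\<pi> n k, ?P k)\<bar> \<le> C * \<epsilon>" .
      have "\<bar>t - \<pi> n k\<bar> \<le> \<eta>" using tk k(3) by (auto simp: \<mu>_def)
      then have "\<bar>F (t, stop T t \<omega>) - F (t, ?P k)\<bar> \<le> C * \<epsilon>"
        using elim(2) k(1) by (intro path_lipschitz[OF stopped_paths_stop[OF path_cont tT] tPk]) blast
      then show ?thesis using 1 by linarith
    qed
    ultimately show ?case using elim(1) \<epsilon>e by (simp add: dist_real_def)
  qed
qed

end

section \<open>Remainders along Hoelder paths\<close>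

lemma tendsto_outer:
  assumes "(g \<longlongrightarrow> v) G"
  shows "((\<lambda>x. outer (g x)) \<longlongrightarrow> outer v) G"
  unfolding outer_def using assms by (intro tendsto_vec_lambda tendsto_intros)

text \<open>The choice of \<open>k\<close> near \<open>h powr (- \<nu>)\<close> balances the error
  \<open>e\<close> of the staircase, which decreases in \<open>k\<close>, against the total
  variation \<open>k e\<close> of the gradients times the increment \<open>h powr \<nu>\<close> of
  the path, which increases in \<open>k\<close>: both become of order \<open>h powr (\<nu> +
  \<nu>\<^sup>2)\<close>.\<close>
lemma holder_substep_bound:
  fixes h \<nu> K :: real
  assumes h: "0 < h" "h \<le> 1" and \<nu>: "0 < \<nu>" "\<nu> < 1" and K: "0 < K"
  defines "k \<equiv> nat \<lceil>h powr (- \<nu>)\<rceil>"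
  defines "e \<equiv> K * (h / real k) powr \<nu>" and "p \<equiv> min 1 (\<nu> + \<nu>\<^sup>2)"
  shows "0 < k" "e + h + real k * e\<^sup>2 + (h + real k * e) * (K * h powr \<nu>) \<le> (1 + 2 * K + 4 * K\<^sup>2) * h powr p"
proof -
  have hp: "h powr (- \<nu>) \<ge> 1" using h \<nu> powr_le1[of \<nu> h] by (simp add: powr_minus one_le_inverse)
  have k1: "h powr (- \<nu>) \<le> real k" unfolding k_def by linarith
  have k2: "real k \<le> 2 * h powr (- \<nu>)" unfolding k_def using hp by linarith
  show k0: "0 < k" using k1 hp by (cases "k = 0") auto
  have "h / real k \<le> h / h powr (- \<nu>)" using k1 hp h by (intro divide_left_mono) auto
  also have "\<dots> = h powr (1 + \<nu>)" using h by (simp add: powr_minus powr_add field_simps)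
  finally have "(h / real k) powr \<nu> \<le> (h powr (1 + \<nu>)) powr \<nu>" using h \<nu> by (intro powr_mono2) auto
  also have "\<dots> = h powr (\<nu> + \<nu>\<^sup>2)" by (simp add: powr_powr algebra_simps power2_eq_square)
  finally have e1: "e \<le> K * h powr (\<nu> + \<nu>\<^sup>2)" using K by (simp add: e_def)
  have e0: "0 \<le> e" using K by (simp add: e_def)
  have "real k * e \<le> (2 * h powr (- \<nu>)) * (K * h powr (\<nu> + \<nu>\<^sup>2))"
    using k2 e1 e0 by (intro mult_mono) auto
  also have "\<dots> = 2 * K * h powr (\<nu>\<^sup>2)" using powr_add[of h "- \<nu>" "\<nu> + \<nu>\<^sup>2"] by simp
  finally have ke: "real k * e \<le> 2 * K * h powr (\<nu>\<^sup>2)" .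
  have hq1: "h powr (\<nu>\<^sup>2) \<le> 1" using h by (simp add: powr_le1)
  have "\<nu>\<^sup>2 \<le> 1" using \<nu> by (simp add: power_le_one)
  then have hq2: "h \<le> h powr (\<nu>\<^sup>2)" using powr_mono'[of "\<nu>\<^sup>2" 1 h] h by simp
  have hq: "h powr (\<nu> + \<nu>\<^sup>2) \<le> h powr p" unfolding p_def using h by (intro powr_mono') auto
  have hh: "h \<le> h powr p" using powr_mono'[of p 1 h] h by (simp add: p_def)
  have "real k * e\<^sup>2 = (real k * e) * e" by (simp add: power2_eq_square)
  also have "\<dots> \<le> (2 * K * 1) * (K * h powr (\<nu> + \<nu>\<^sup>2))"
  proof (rule mult_mono[OF _ e1 _ e0])
    have "2 * K * h powr (\<nu>\<^sup>2) \<le> 2 * K * 1" using hq1 K by (intro mult_left_mono) auto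
    then show "real k * e \<le> 2 * K * 1" using ke by linarith
  qed (use K in simp)
  finally have 1: "real k * e\<^sup>2 \<le> 2 * K\<^sup>2 * h powr (\<nu> + \<nu>\<^sup>2)" by (simp add: power2_eq_square mult_ac)
  have "(h + real k * e) * (K * h powr \<nu>) \<le> ((1 + 2 * K) * h powr (\<nu>\<^sup>2)) * (K * h powr \<nu>)"
    using hq2 ke K by (intro mult_right_mono) (auto simp: algebra_simps)
  also have "\<dots> = (1 + 2 * K) * K * h powr (\<nu> + \<nu>\<^sup>2)" by (simp add: powr_add mult_ac)
  finally have 2: "(h + real k * e) * (K * h powr \<nu>) \<le> (1 + 2 * K) * K * h powr (\<nu> + \<nu>\<^sup>2)" .
  have "e + h + real k * e\<^sup>2 + (h + real k * e) * (K * h powr \<nu>)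
      \<le> h + (2 * K + 4 * K\<^sup>2) * h powr (\<nu> + \<nu>\<^sup>2)"
    using e1 1 2 by (simp add: algebra_simps power2_eq_square)
  also have "\<dots> \<le> h powr p + (2 * K + 4 * K\<^sup>2) * h powr p"
    using hh hq K by (intro add_mono mult_left_mono) auto
  finally show "e + h + real k * e\<^sup>2 + (h + real k * e) * (K * h powr \<nu>) \<le> (1 + 2 * K + 4 * K\<^sup>2) * h powr p"
    by (simp add: algebra_simps)
qed

lemma (in regular_functional) holder_remainder_bound:
  fixes \<omega> :: "'d path"
  assumes cont: "continuous_on {0..T} \<omega>"
    and R: "\<And>x. x \<in> {0..T} \<Longrightarrow> norm (\<omega> x) \<le> R / 3"
    and K: "0 < K" "\<And>x y. x \<in> {0..T} \<Longrightarrow> y \<in> {0..T} \<Longrightarrow> norm (\<omega> x - \<omega> y) \<le> K * \<bar>x - y\<bar> powr \<nu>"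
    and \<nu>: "0 < \<nu>" "\<nu> < 1"
    and st: "0 \<le> s" "s < t" "t \<le> T" "t - s \<le> 1"
  shows "\<bar>F (t, stop T t \<omega>) - F (s, stop T s \<omega>) - vgrad T F (s, stop T s \<omega>) \<bullet> (\<omega> t - \<omega> s)\<bar>
     \<le> C * (1 + 2 * K + 4 * K\<^sup>2) * (t - s) powr min 1 (\<nu> + \<nu>\<^sup>2)"
proof -
  define h where "h = t - s"
  define k where "k = nat \<lceil>h powr (- \<nu>)\<rceil>"
  define e where "e = K * (h / real k) powr \<nu>"
  have h: "0 < h" "h \<le> 1" using st by (auto simp: h_def)
  note * = holder_substep_bound[OF h \<nu> K(1), folded k_def, folded e_def]
  have powr_le: "norm (\<omega> x - \<omega> y) \<le> K * c powr \<nu>"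
    if "x \<in> {0..T}" "y \<in> {0..T}" "\<bar>x - y\<bar> \<le> c" for x y c
  proof -
    have "\<bar>x - y\<bar> powr \<nu> \<le> c powr \<nu>" using that \<nu> by (intro powr_mono2) auto
    then show ?thesis using K(2)[OF that(1,2)] K(1) by (smt (verit) mult_left_mono)
  qed
  have "\<bar>F (t, stop T t \<omega>) - F (s, stop T s \<omega>) - vgrad T F (s, stop T s \<omega>) \<bullet> (\<omega> t - \<omega> s)\<bar>
     \<le> C * (e + (t - s) + real k * e\<^sup>2 + ((t - s) + real k * e) * (K * h powr \<nu>))"
  proof (rule increment_remainder_bound[OF cont R st(1) less_imp_le[OF st(2)] st(3) *(1)])
    show "norm (\<omega> x - \<omega> y) \<le> e" if "x \<in> {0..T}" "y \<in> {0..T}" "\<bar>x - y\<bar> \<le> (t - s) / real k" for x y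
      unfolding e_def using that by (intro powr_le) (auto simp: h_def)
    show "norm (\<omega> x - \<omega> y) \<le> K * h powr \<nu>" if "x \<in> {s..t}" "y \<in> {s..t}" for x y
      using that st by (intro powr_le) (auto simp: h_def)
  qed
  also have "\<dots> \<le> C * ((1 + 2 * K + 4 * K\<^sup>2) * h powr min 1 (\<nu> + \<nu>\<^sup>2))"
    using *(2) C_pos unfolding h_def by (intro mult_left_mono) auto
  finally show ?thesis by (simp add: h_def mult_ac)
qed

context partitions
begin

text \<open>Minkowski's inequality for the Euclidean norms of the sequences of increments.\<close>
lemma psum_square_perturbation:
  assumes "(\<lambda>n. psum n (\<lambda>i. (f n i - h n i :: real)\<^sup>2) x) \<longlonglongrightarrow> 0"
    and "(\<lambda>n. psum n (\<lambda>i. (h n i)\<^sup>2) x) \<longlonglongrightarrow> J"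
  shows "(\<lambda>n. psum n (\<lambda>i. (f n i)\<^sup>2) x) \<longlonglongrightarrow> J"
proof -
  define A where "A n = {i. i < m n \<and> \<pi> n (Suc i) \<le> x}" for n
  have L2: "(L2_set f (A n))\<^sup>2 = psum n (\<lambda>i. (f i)\<^sup>2) x" for f n
    unfolding L2_set_def psum_def A_def by (simp add: sum_nonneg)
  have diff: "(\<lambda>n. L2_set (\<lambda>i. f n i - h n i) (A n)) \<longlonglongrightarrow> 0"
    using tendsto_real_sqrt[OF assms(1)] by (simp add: L2_set_def psum_def A_def)
  have hJ: "(\<lambda>n. L2_set (h n) (A n)) \<longlonglongrightarrow> sqrt J"
    using tendsto_real_sqrt[OF assms(2)] by (simp add: L2_set_def psum_def A_def)
  have le: "norm (L2_set (f n) (A n) - L2_set (h n) (A n)) \<le> L2_set (\<lambda>i. f n i - h n i) (A n)" for n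
    using L2_set_triangle_ineq[of "\<lambda>i. f n i - h n i" "h n" "A n"]
      L2_set_triangle_ineq[of "\<lambda>i. h n i - f n i" "f n" "A n"]
    by (simp add: L2_set_def power2_commute[of "h n _"])
  have "(\<lambda>n. L2_set (f n) (A n) - L2_set (h n) (A n)) \<longlonglongrightarrow> 0"
    by (rule Lim_null_comparison[OF _ diff]) (use le in simp)
  from tendsto_add[OF this hJ] have "(\<lambda>n. L2_set (f n) (A n)) \<longlonglongrightarrow> sqrt J" by simp
  then have "(\<lambda>n. (L2_set (f n) (A n))\<^sup>2) \<longlonglongrightarrow> (sqrt J)\<^sup>2" by (rule tendsto_power)
  moreover have "0 \<le> J"
    by (rule LIMSEQ_le_const[OF assms(2)]) (auto simp: psum_def sum_nonneg)
  ultimately show ?thesis by (simp add: L2)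
qed

text \<open>Up to the factor \<open>M\<^sup>2\<close>, each square is at most the length of the
  interval times the mesh to the power \<open>2 p - 1 > 0\<close>.\<close>
lemma psum_holder_square_tendsto_0:
  assumes "1 / 2 < p" "0 < M"
    and bound: "\<And>n i. i < m n \<Longrightarrow> \<pi> n (Suc i) - \<pi> n i \<le> 1 \<Longrightarrow> \<bar>z n i\<bar> \<le> M * (\<pi> n (Suc i) - \<pi> n i) powr p"
  shows "(\<lambda>n. psum n (\<lambda>i. (z n i)\<^sup>2) x) \<longlonglongrightarrow> 0"
proof (rule tendstoI)
  fix e :: real assume e: "e > 0"
  define q where "q = 2 * p - 1"
  have q: "q > 0" using assms(1) by (simp add: q_def)
  define c where "c = e / (M\<^sup>2 * T + 1)"
  have MT: "M\<^sup>2 * T + 1 > 0" using T_pos by (simp add: add_nonneg_pos)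
  have c: "c > 0" using e MT by (simp add: c_def)
  define \<mu> where "\<mu> = min 1 (c powr (1 / q))"
  have \<mu>: "\<mu> > 0" "\<mu> \<le> 1" using c by (auto simp: \<mu>_def)
  have "\<mu> powr q \<le> (c powr (1 / q)) powr q" using \<mu> q by (intro powr_mono2) (auto simp: \<mu>_def)
  also have "\<dots> = c" using c q by (simp add: powr_powr)
  finally have \<mu>c: "\<mu> powr q \<le> c" .
  show "\<forall>\<^sub>F n in sequentially. dist (psum n (\<lambda>i. (z n i)\<^sup>2) x) 0 < e"
    using mesh[OF \<mu>(1)]
  proof eventually_elim
    case (elim n)
    let ?A = "{i. i < m n \<and> \<pi> n (Suc i) \<le> x}"
    have "psum n (\<lambda>i. (z n i)\<^sup>2) x \<le> (\<Sum>i\<in>?A. (M\<^sup>2 * c) * (\<pi> n (Suc i) - \<pi> n i))"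
      unfolding psum_def
    proof (rule sum_mono)
      fix i assume "i \<in> ?A"
      then have i: "i < m n" by simp
      define h where "h = \<pi> n (Suc i) - \<pi> n i"
      have h: "0 < h" "h \<le> \<mu>" using part_less[OF i] elim i by (auto simp: h_def less_imp_le)
      have "(z n i)\<^sup>2 \<le> (M * h powr p)\<^sup>2"
        using bound[OF i] h \<mu>(2) by (intro abs_le_square_iff[THEN iffD1]) (auto simp: h_def)
      also have "\<dots> = M\<^sup>2 * (h powr q * h)"
        using h powr_add[of h p p] powr_add[of h q 1] by (simp add: q_def power2_eq_square mult_ac)
      also have "\<dots> \<le> M\<^sup>2 * (c * h)"
      proof -
        have "h powr q \<le> \<mu> powr q" using h q by (intro powr_mono2) auto
        then show ?thesis using \<mu>c h by (intro mult_left_mono mult_right_mono) auto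
      qed
      finally show "(z n i)\<^sup>2 \<le> (M\<^sup>2 * c) * (\<pi> n (Suc i) - \<pi> n i)" by (simp add: h_def mult_ac)
    qed
    also have "\<dots> \<le> (\<Sum>i<m n. (M\<^sup>2 * c) * (\<pi> n (Suc i) - \<pi> n i))"
      using c part_less[of _ n] by (intro sum_mono2) (auto intro!: mult_nonneg_nonneg simp: less_imp_le)
    also have "\<dots> = M\<^sup>2 * c * T"
      using sum_lessThan_telescope[of "\<pi> n" "m n"] part_0[of n] part_m[of n]
      by (simp flip: sum_distrib_left)
    also have "\<dots> < (M\<^sup>2 * T + 1) * c" using c by (simp add: algebra_simps)
    also have "\<dots> = e" using MT by (simp add: c_def)
    finally have "psum n (\<lambda>i. (z n i)\<^sup>2) x < e" .
    moreover have "0 \<le> psum n (\<lambda>i. (z n i)\<^sup>2) x" by (auto simp: psum_def intro: sum_nonneg)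
    ultimately show ?case by simp
  qed
qed

end

context covariation
begin

lemma stop_near:
  assumes "e > 0"
  obtains d where "d > 0" "\<And>s t z. s \<in> {0..T} \<Longrightarrow> t \<in> {0..T} \<Longrightarrow> \<bar>s - t\<bar> < d \<Longrightarrow> z \<in> {0..T} \<Longrightarrow>
    norm (stop T s \<omega> z - stop T t \<omega> z) \<le> e"
proof -
  obtain d where d: "d > 0" "\<And>x y. x \<in> {0..T} \<Longrightarrow> y \<in> {0..T} \<Longrightarrow> \<bar>x - y\<bar> < d \<Longrightarrow> norm (\<omega> x - \<omega> y) < e"
    using path_uniformly_continuous[OF assms] by blast
  show thesis
  proof (rule that[OF d(1)])
    fix s t z assume *: "s \<in> {0..T}" "t \<in> {0..T}" "\<bar>s - t\<bar> < d" "z \<in> {0..T}"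
    then have "norm (\<omega> (min s z) - \<omega> (min t z)) < e"
      by (intro d(2)) (auto simp: min_def abs_if split: if_splits)
    then show "norm (stop T s \<omega> z - stop T t \<omega> z) \<le> e" using * by (simp add: stop_def)
  qed
qed

lemma stop_norm_le:
  assumes "\<And>x. x \<in> {0..T} \<Longrightarrow> norm (\<omega> x) \<le> R" "s \<in> {0..T}" "z \<in> {0..T}"
  shows "norm (stop T s \<omega> z) \<le> R"
proof -
  have "min s z \<in> {0..T}" using assms(2,3) by (auto simp: min_def)
  then show ?thesis using assms(1)[of "min s z"] assms(3) by (simp add: stop_def)
qed

lemma functional_along_continuous:
  assumes F: "F \<in> R_space T m \<pi> \<omega>"
  shows "continuous_on {0..T} (\<lambda>t. F (t, stop T t \<omega>))"
proof -
  obtain C R where reg: "regular_functional T C R F" and R: "\<And>x. x \<in> {0..T} \<Longrightarrow> norm (\<omega> x) \<le> R / 3" and R0: "R > 0"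
    using R_space_regular_along[OF F] by blast
  interpret regular_functional T C R F by (rule reg)
  have R': "norm (\<omega> x) \<le> R" if "x \<in> {0..T}" for x using R[OF that] R0 by simp
  have "\<exists>d>0. \<forall>t s. t \<in> {0..T} \<longrightarrow> s \<in> {0..T} \<longrightarrow> s \<le> t \<longrightarrow> t - s < d \<longrightarrow>
      \<bar>F (t, stop T t \<omega>) - F (s, stop T s \<omega>)\<bar> < e" if e: "e > 0" for e
  proof -
    define \<epsilon> where "\<epsilon> = e / (4 * C)"
    have \<epsilon>: "\<epsilon> > 0" "C * \<epsilon> = e / 4" using e C_pos by (auto simp: \<epsilon>_def)
    obtain d where d: "d > 0" "\<And>s t z. s \<in> {0..T} \<Longrightarrow> t \<in> {0..T} \<Longrightarrow> \<bar>s - t\<bar> < d \<Longrightarrow> z \<in> {0..T} \<Longrightarrow>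
        norm (stop T s \<omega> z - stop T t \<omega> z) \<le> \<epsilon>" using stop_near[OF \<epsilon>(1)] by blast
    have "\<bar>F (t, stop T t \<omega>) - F (s, stop T s \<omega>)\<bar> < e"
      if "t \<in> {0..T}" "s \<in> {0..T}" "s \<le> t" "t - s < min d \<epsilon>" for s t
    proof -
      have s: "(s, stop T s \<omega>) \<in> stopped_paths T" and t: "(t, stop T t \<omega>) \<in> stopped_paths T"
        using stopped_paths_stop[OF path_cont] that by auto
      have ts: "(t, stop T s \<omega>) \<in> stopped_paths T" by (rule stopped_paths_later[OF s]) (use that in auto)
      have "\<bar>F (t, stop T s \<omega>) - F (s, stop T s \<omega>)\<bar> \<le> C * (t - s)"
        using that stop_norm_le[OF R' that(2)] by (intro time_lipschitz[OF s]) auto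
      also have "\<dots> \<le> C * \<epsilon>" using that C_pos by (intro mult_left_mono) auto
      finally have 1: "\<bar>F (t, stop T s \<omega>) - F (s, stop T s \<omega>)\<bar> \<le> C * \<epsilon>" .
      have "\<bar>F (t, stop T t \<omega>) - F (t, stop T s \<omega>)\<bar> \<le> C * \<epsilon>"
        using that by (intro path_lipschitz[OF t ts] d(2)) auto
      then show ?thesis using 1 \<epsilon>(2) e by linarith
    qed
    moreover have "min d \<epsilon> > 0" using d(1) \<epsilon>(1) by simp
    ultimately show ?thesis by blast
  qed
  note key = this
  show ?thesis
    unfolding continuous_on_iff
  proof (intro ballI allI impI)
    fix t e :: real assume t: "t \<in> {0..T}" and e: "0 < e"
    obtain d where d: "d > 0" "\<And>t s. t \<in> {0..T} \<Longrightarrow> s \<in> {0..T} \<Longrightarrow> s \<le> t \<Longrightarrow> t - s < d \<Longrightarrow>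
      \<bar>F (t, stop T t \<omega>) - F (s, stop T s \<omega>)\<bar> < e" using key[OF e] by blast
    show "\<exists>d>0. \<forall>s\<in>{0..T}. dist s t < d \<longrightarrow> dist (F (s, stop T s \<omega>)) (F (t, stop T t \<omega>)) < e"
    proof (intro exI[of _ d] conjI ballI impI)
      fix s assume s: "s \<in> {0..T}" "dist s t < d"
      show "dist (F (s, stop T s \<omega>)) (F (t, stop T t \<omega>)) < e"
      proof (cases "s \<le> t")
        case True
        then show ?thesis using d(2)[OF t s(1) True] s by (auto simp: dist_real_def abs_minus_commute)
      next
        case False
        then have "t \<le> s" by simp
        then show ?thesis using d(2)[OF s(1) t] s by (auto simp: dist_real_def)
      qed
    qed (rule d(1))
  qed
qed

lemma gradient_along_left_limit:
  assumes F: "F \<in> R_space T m \<pi> \<omega>" and r: "r \<in> {0<..T}"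
  shows "((\<lambda>u. vgrad T F (u, stop T u \<omega>)) \<longlongrightarrow> vgrad T F (r, stop T r \<omega>)) (at_left r)"
proof (rule vec_tendstoI)
  fix i
  have rP: "(r, stop T r \<omega>) \<in> stopped_paths T" using r by (intro stopped_paths_stop path_cont) auto
  have lc: "left_continuous T (\<lambda>p. vgrad T F p $ i)" by (rule C1b_D(3)[OF R_space_D(3)[OF F]])
  show "((\<lambda>u. vgrad T F (u, stop T u \<omega>) $ i) \<longlongrightarrow> vgrad T F (r, stop T r \<omega>) $ i) (at_left r)"
  proof (rule tendstoI)
    fix e :: real assume "e > 0"
    then obtain \<eta> where \<eta>: "\<eta> > 0" "\<And>u Q. (u, Q) \<in> stopped_paths T \<Longrightarrow> u < r \<Longrightarrow> r - u \<le> \<eta> \<Longrightarrow>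
      (\<And>s. s \<in> {0..T} \<Longrightarrow> norm (stop T r \<omega> s - Q s) \<le> \<eta>) \<Longrightarrow>
      \<bar>vgrad T F (r, stop T r \<omega>) $ i - vgrad T F (u, Q) $ i\<bar> < e"
      using left_continuous_bound[OF lc rP] by metis
    obtain d where d: "d > 0" "\<And>s t z. s \<in> {0..T} \<Longrightarrow> t \<in> {0..T} \<Longrightarrow> \<bar>s - t\<bar> < d \<Longrightarrow> z \<in> {0..T} \<Longrightarrow>
        norm (stop T s \<omega> z - stop T t \<omega> z) \<le> \<eta>" using stop_near[OF \<eta>(1)] by blast
    show "\<forall>\<^sub>F u in at_left r. dist (vgrad T F (u, stop T u \<omega>) $ i) (vgrad T F (r, stop T r \<omega>) $ i) < e"
    proof (rule eventually_at_leftI[of "max 0 (max (r - \<eta>) (r - d))"])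
      show "max 0 (max (r - \<eta>) (r - d)) < r" using r \<eta> d by auto
      fix u assume u: "u \<in> {max 0 (max (r - \<eta>) (r - d))<..<r}"
      then have uT: "u \<in> {0..T}" using r by auto
      have "\<bar>vgrad T F (r, stop T r \<omega>) $ i - vgrad T F (u, stop T u \<omega>) $ i\<bar> < e"
      proof (rule \<eta>(2))
        show "(u, stop T u \<omega>) \<in> stopped_paths T" using uT by (intro stopped_paths_stop path_cont) auto
        show "u < r" "r - u \<le> \<eta>" using u by auto
        show "norm (stop T r \<omega> s - stop T u \<omega> s) \<le> \<eta>" if "s \<in> {0..T}" for s
          using u uT r that by (intro d(2)) auto
      qed
      then show "dist (vgrad T F (u, stop T u \<omega>) $ i) (vgrad T F (r, stop T r \<omega>) $ i) < e"
        by (simp add: dist_real_def abs_minus_commute)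
    qed
  qed
qed

lemma gradient_along_bounded:
  assumes F: "F \<in> R_space T m \<pi> \<omega>"
  obtains C where "C > 0" "\<And>t. t \<in> {0..T} \<Longrightarrow> norm (vgrad T F (t, stop T t \<omega>)) \<le> C"
proof -
  obtain C R where reg: "regular_functional T C R F" and R: "\<And>x. x \<in> {0..T} \<Longrightarrow> norm (\<omega> x) \<le> R / 3" and R0: "R > 0"
    using R_space_regular_along[OF F] by blast
  interpret regular_functional T C R F by (rule reg)
  have R': "norm (\<omega> x) \<le> R" if "x \<in> {0..T}" for x using R[OF that] R0 by simp
  have "norm (vgrad T F (t, stop T t \<omega>)) \<le> C" if "t \<in> {0..T}" for t
    using that stop_norm_le[OF R' that] by (intro grad_bound stopped_paths_stop path_cont) auto
  then show thesis using that C_pos by blast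
qed

end

section \<open>Quadratic variation of a left-continuous integrand\<close>

text \<open>At \<open>u > 0\<close> the function is the limit of its values at the last partition
  points before \<open>u\<close>, hence a pointwise limit of step functions.\<close>
lemma (in partitions) left_limits_set_borel_measurable:
  fixes g :: "real \<Rightarrow> 'b::{real_normed_vector, second_countable_topology}"
  assumes "\<And>r. r \<in> {0<..T} \<Longrightarrow> (g \<longlongrightarrow> g r) (at_left r)"
  shows "set_borel_measurable lborel {0..T} g"
proof -
  define s where "s n u = indicator {0} u *\<^sub>R g 0 +
    (\<Sum>i<m n. indicator {\<pi> n i<..\<pi> n (Suc i)} u *\<^sub>R g (\<pi> n i))" for n u
  have "(\<lambda>n. s n u) \<longlonglongrightarrow> indicator {0..T} u *\<^sub>R g u" for u
  proof -
    have zero: "s n u = indicator {0} u *\<^sub>R g 0" if "u \<notin> {0<..T}" for n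
    proof -
      have "indicator {\<pi> n i<..\<pi> n (Suc i)} u *\<^sub>R g (\<pi> n i) = 0" if "i < m n" for i
        using part_in[of i n] part_in[of "Suc i" n] \<open>u \<notin> {0<..T}\<close> that by (auto simp: indicator_def)
      then have "(\<Sum>i<m n. indicator {\<pi> n i<..\<pi> n (Suc i)} u *\<^sub>R g (\<pi> n i)) = 0"
        by (intro sum.neutral) auto
      then show ?thesis by (simp add: s_def)
    qed
    show ?thesis
    proof (cases "u \<in> {0<..T}")
      case False
      then have "s n u = indicator {0..T} u *\<^sub>R g u" for n
        using zero[OF False] T_pos by (auto simp: indicator_def)
      then show ?thesis by simp
    next
      case u: True
      show ?thesis
      proof (rule tendstoI)
        fix e :: real assume "e > 0"
        then have "\<forall>\<^sub>F v in at_left u. dist (g v) (g u) < e" by (intro tendstoD assms u)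
        then obtain b where b: "b < u" "\<And>v. b < v \<Longrightarrow> v < u \<Longrightarrow> dist (g v) (g u) < e"
          unfolding eventually_at_left_field by auto
        have "u - b > 0" using b by simp
        from mesh[OF this] show "\<forall>\<^sub>F n in sequentially. dist (s n u) (indicator {0..T} u *\<^sub>R g u) < e"
        proof eventually_elim
          case (elim n)
          define j where "j = (LEAST j. u \<le> \<pi> n j)"
          have "u \<le> \<pi> n (m n)" using u part_m[of n] by auto
          then have j: "u \<le> \<pi> n j" "j \<le> m n" unfolding j_def by (rule LeastI, rule Least_le)
          have "j \<noteq> 0"
          proof
            assume "j = 0"
            then show False using j(1) u part_0[of n] by simp
          qed
          then obtain l where l: "j = Suc l" by (cases j) auto
          have lm: "l < m n" using j(2) l by simp
          have "\<pi> n l < u" using not_less_Least[of l "\<lambda>j. u \<le> \<pi> n j"] l by (simp add: j_def[symmetric] not_le)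
          have ul: "\<pi> n l < u" "u \<le> \<pi> n (Suc l)" using \<open>\<pi> n l < u\<close> j(1) l by auto
          have "indicator {\<pi> n i<..\<pi> n (Suc i)} u *\<^sub>R g (\<pi> n i) = (if i = l then g (\<pi> n l) else 0)"
            if "i < m n" for i
            using part_mono[of "Suc i" l n] part_mono[of "Suc l" i n] ul lm that
            by (cases i l rule: linorder_cases) (auto simp: indicator_def)
          then have "(\<Sum>i<m n. indicator {\<pi> n i<..\<pi> n (Suc i)} u *\<^sub>R g (\<pi> n i)) =
              (\<Sum>i<m n. if i = l then g (\<pi> n l) else 0)" by (intro sum.cong) auto
          then have "s n u = g (\<pi> n l)" using lm u by (simp add: s_def)
          moreover have "\<pi> n (Suc l) - \<pi> n l < u - b" using elim lm by blast
          then have "b < \<pi> n l" using ul by linarith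
          ultimately show ?case using b(2)[of "\<pi> n l"] ul(1) u by simp
        qed
      qed
    qed
  qed
  moreover have "s n \<in> borel_measurable lborel" for n
    unfolding s_def by measurable
  ultimately have "(\<lambda>u. indicator {0..T} u *\<^sub>R g u) \<in> borel_measurable lborel"
    by (rule borel_measurable_LIMSEQ_metric[rotated])
  then show ?thesis by (simp add: set_borel_measurable_def)
qed

locale left_continuous_integrand = covariation T m \<pi> \<omega> a A
  for T :: real and m \<pi> and \<omega> :: "('d::finite) path" and a A +
  fixes g :: "real \<Rightarrow> real^'d" and C :: real
  assumes g_bound: "\<And>t. t \<in> {0..T} \<Longrightarrow> norm (g t) \<le> C"
    and g_left: "\<And>r. r \<in> {0<..T} \<Longrightarrow> (g \<longlongrightarrow> g r) (at_left r)"
begin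

definition energy_density :: "real \<Rightarrow> real" where
  "energy_density u = g u \<bullet> (a u *v g u)"

definition energy :: "real \<Rightarrow> real" where
  "energy x = integral {0..x} energy_density"

lemma energy_density_outer: "energy_density u = outer (g u) \<bullet> a u"
  by (simp add: energy_density_def inner_commute flip: inner_outer)

lemma energy_density_left:
  assumes r: "r \<in> {0<..T}"
  shows "(energy_density \<longlongrightarrow> energy_density r) (at_left r)"
proof -
  have "(a \<longlongrightarrow> a r) (at r within {0..T})" using a_cont r unfolding continuous_on_def by auto
  then have "(a \<longlongrightarrow> a r) (at r within {0..r})" by (rule tendsto_within_subset) (use r in auto)
  moreover have "at r within {0..r} = at_left r" using r by (auto intro: at_within_Icc_at_left)
  ultimately have "(a \<longlongrightarrow> a r) (at_left r)" by simp
  then show ?thesis unfolding energy_density_outer by (intro tendsto_inner tendsto_outer g_left r)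
qed

lemma energy_density_bounded:
  obtains Q where "Q > 0" "\<And>u. u \<in> {0..T} \<Longrightarrow> \<bar>energy_density u\<bar> \<le> Q"
proof -
  have "compact (a ` {0..T})" using a_cont by (intro compact_continuous_image) auto
  then obtain L where L: "L > 0" "\<And>t. t \<in> {0..T} \<Longrightarrow> norm (a t) \<le> L"
    using compact_imp_bounded bounded_pos by (metis image_eqI)
  have "\<bar>energy_density u\<bar> \<le> C\<^sup>2 * L + 1" if u: "u \<in> {0..T}" for u
  proof -
    have "\<bar>energy_density u\<bar> \<le> norm (outer (g u)) * norm (a u)"
      unfolding energy_density_outer by (rule Cauchy_Schwarz_ineq2)
    also have "\<dots> \<le> C\<^sup>2 * L"
      using g_bound[OF u] L u by (intro mult_mono) (auto simp: norm_outer intro: power_mono)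
    finally show ?thesis by simp
  qed
  moreover have "C\<^sup>2 * L + 1 > 0" using L(1) by (simp add: add_nonneg_pos)
  ultimately show thesis using that by blast
qed

lemma energy_density_set_integrable: "set_integrable lborel {0..T} energy_density"
proof -
  obtain Q where Q: "Q > 0" "\<And>u. u \<in> {0..T} \<Longrightarrow> \<bar>energy_density u\<bar> \<le> Q" using energy_density_bounded by blast
  have "(\<lambda>u. indicator {0..T} u *\<^sub>R energy_density u) \<in> borel_measurable lborel"
    using left_limits_set_borel_measurable[OF energy_density_left] by (simp add: set_borel_measurable_def)
  then show ?thesis
    unfolding set_integrable_def
    by (intro integrableI_bounded_set[where A = "{0..T}" and B = Q]) (use Q in \<open>auto simp: emeasure_lborel_Icc_eq\<close>)
qed

lemma energy_density_integrable_on: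
  assumes "0 \<le> x" "x \<le> y" "y \<le> T"
  shows "energy_density integrable_on {x..y}"
  using set_borel_integral_eq_integral(1)[OF energy_density_set_integrable]
  by (rule integrable_on_subinterval) (use assms in auto)

lemma LINT_energy_density: "(LINT u:{0..T}|lborel. energy_density u) = energy T"
  using set_borel_integral_eq_integral(2)[OF energy_density_set_integrable] by (simp add: energy_def)

lemma energy_increment:
  assumes xy: "0 \<le> x" "x \<le> y" "y \<le> T" and \<rho>: "\<And>u. u \<in> {x..y} \<Longrightarrow> \<bar>energy_density u - \<rho>\<bar> \<le> e"
  shows "\<bar>energy y - energy x - \<rho> * (y - x)\<bar> \<le> e * (y - x)"
proof -
  have "integral {0..x} energy_density + integral {x..y} energy_density = integral {0..y} energy_density"
    by (rule Henstock_Kurzweil_Integration.integral_combine) (use xy energy_density_integrable_on in auto)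
  then have "energy y - energy x = integral {x..y} energy_density" by (simp add: energy_def)
  moreover have int: "((\<lambda>u. energy_density u - \<rho>) has_integral (integral {x..y} energy_density - \<rho> * (y - x))) {x..y}"
    using has_integral_diff[OF integrable_integral[OF energy_density_integrable_on[OF xy]] has_integral_const_real[of \<rho> x y]] xy
    by (simp add: mult.commute)
  moreover have "norm (integral {x..y} energy_density - \<rho> * (y - x)) \<le> e * measure lborel {x..y}"
  proof (rule has_integral_bound_real[OF _ _ int])
    show "0 \<le> e" using \<rho>[of x] xy by auto
    show "finite ({} :: real set)" by simp
  qed (use \<rho> in auto)
  ultimately show ?thesis using xy by simp
qed

lemma energy_lipschitz:
  obtains Q where "Q > 0" "\<And>x y. 0 \<le> x \<Longrightarrow> x \<le> y \<Longrightarrow> y \<le> T \<Longrightarrow> \<bar>energy y - energy x\<bar> \<le> Q * (y - x)"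
proof -
  obtain Q where Q: "Q > 0" "\<And>u. u \<in> {0..T} \<Longrightarrow> \<bar>energy_density u\<bar> \<le> Q" using energy_density_bounded by blast
  have "\<bar>energy y - energy x\<bar> \<le> Q * (y - x)" if "0 \<le> x" "x \<le> y" "y \<le> T" for x y
    using energy_increment[OF that, of 0 Q] Q(2) that by auto
  then show thesis using that Q(1) by blast
qed

lemma energy_continuous: "continuous_on {0..T} energy"
  unfolding continuous_on_iff
proof (intro ballI allI impI)
  fix t e :: real assume t: "t \<in> {0..T}" and e: "0 < e"
  obtain Q where Q: "Q > 0" "\<And>x y. 0 \<le> x \<Longrightarrow> x \<le> y \<Longrightarrow> y \<le> T \<Longrightarrow> \<bar>energy y - energy x\<bar> \<le> Q * (y - x)"
    using energy_lipschitz by blast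
  show "\<exists>d>0. \<forall>s\<in>{0..T}. dist s t < d \<longrightarrow> dist (energy s) (energy t) < e"
  proof (intro exI[of _ "e / Q"] conjI ballI impI)
    show "0 < e / Q" using e Q by simp
    fix s assume s: "s \<in> {0..T}" "dist s t < e / Q"
    have "\<bar>energy s - energy t\<bar> \<le> Q * \<bar>s - t\<bar>"
      using Q(2)[of s t] Q(2)[of t s] s t by (cases "s \<le> t") (auto simp: abs_minus_commute)
    also have "\<dots> < e" using s(2) Q(1) by (simp add: dist_real_def field_simps)
    finally show "dist (energy s) (energy t) < e" by (simp add: dist_real_def)
  qed
qed

lemma energy_density_near:
  assumes r: "r \<in> {0<..T}" and e: "e > 0"
  obtains \<eta> where "\<eta> > 0" "\<And>u. r - \<eta> < u \<Longrightarrow> u \<le> r \<Longrightarrow> \<bar>energy_density u - energy_density r\<bar> \<le> e"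
proof -
  obtain b where b: "b < r" "\<And>v. b < v \<Longrightarrow> v < r \<Longrightarrow> dist (energy_density v) (energy_density r) < e"
    using tendstoD[OF energy_density_left[OF r] e] unfolding eventually_at_left_field by auto
  show thesis
  proof (rule that[of "r - b"])
    show "\<bar>energy_density u - energy_density r\<bar> \<le> e" if "r - (r - b) < u" "u \<le> r" for u
      using b(2)[of u] that e by (cases "u = r") (auto simp: dist_real_def)
  qed (use b in simp)
qed

lemma energy_mono:
  assumes "\<And>u. u \<in> {0..T} \<Longrightarrow> 0 \<le> energy_density u"
  shows "mono_on {0..T} energy"
proof (rule mono_onI)
  fix x y assume xy: "x \<in> {0..T}" "y \<in> {0..T}" "x \<le> y"
  have "integral {0..x} energy_density \<le> integral {0..y} energy_density"
    using xy assms by (intro integral_subset_le energy_density_integrable_on) auto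
  then show "energy x \<le> energy y" by (simp add: energy_def)
qed

text \<open>If the density were positive at \<open>r\<close>, left-continuity would make it
  positive on an interval before \<open>r\<close>, and the energy would increase there.\<close>
lemma energy_density_eq_0:
  assumes nonneg: "\<And>u. u \<in> {0..T} \<Longrightarrow> 0 \<le> energy_density u" and zero: "energy T = 0" and r: "r \<in> {0<..T}"
  shows "energy_density r = 0"
proof (rule ccontr)
  assume ne: "energy_density r \<noteq> 0"
  then have pos: "energy_density r > 0" using nonneg[of r] r by auto
  obtain \<eta> where \<eta>: "\<eta> > 0" "\<And>u. r - \<eta> < u \<Longrightarrow> u \<le> r \<Longrightarrow> \<bar>energy_density u - energy_density r\<bar> \<le> energy_density r / 2"
    using energy_density_near[OF r, of "energy_density r / 2"] pos by auto
  define x where "x = max 0 (r - \<eta> / 2)"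
  have x: "0 \<le> x" "x < r" "r - \<eta> < x" using \<eta> r by (auto simp: x_def)
  have "\<bar>energy r - energy x - energy_density r * (r - x)\<bar> \<le> energy_density r / 2 * (r - x)"
    using x r \<eta>(2) by (intro energy_increment) auto
  moreover define d where "d = energy_density r * (r - x)"
  moreover have "0 < d" using pos x by (simp add: d_def)
  moreover have "energy_density r / 2 * (r - x) = d / 2" by (simp add: d_def)
  ultimately have "energy r > energy x" by linarith
  moreover have "energy 0 \<le> energy x" "energy r \<le> energy T"
    using mono_onD[OF energy_mono[OF nonneg]] x r by auto
  moreover have "energy 0 = 0" by (simp add: energy_def)
  ultimately show False using zero by simp
qed

text \<open>Near \<open>r\<close> on the left, \<open>(g \<bullet> \<delta>)\<^sup>2\<close> is
  the pairing of \<open>outer (g r)\<close> with \<open>outer \<delta>\<close> up to a small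
  multiple of \<open>\<delta>\<^sup>2\<close>, and the increment of the energy is the pairing of
  \<open>outer (g r)\<close> with \<open>a r\<close> times \<open>\<Delta>t\<close>.\<close>
lemma gradient_square_psum_tendsto:
  assumes x: "x \<in> {0..T}"
  shows "(\<lambda>n. psum n (\<lambda>i. (g (\<pi> n i) \<bullet> dw n i)\<^sup>2) x) \<longlonglongrightarrow> energy x"
proof -
  define z where "z n i = (g (\<pi> n i) \<bullet> dw n i)\<^sup>2 - (energy (\<pi> n (Suc i)) - energy (\<pi> n i))" for n i
  obtain Q where Q: "Q > 0" "\<And>x y. 0 \<le> x \<Longrightarrow> x \<le> y \<Longrightarrow> y \<le> T \<Longrightarrow> \<bar>energy y - energy x\<bar> \<le> Q * (y - x)"
    using energy_lipschitz by blast
  have C0: "0 \<le> C" using g_bound[of 0] T_pos norm_ge_zero[of "g 0"] by (auto simp del: norm_ge_zero)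
  have square: "(v \<bullet> w)\<^sup>2 \<le> (norm v)\<^sup>2 * (norm w)\<^sup>2" for v w :: "real^'d"
    using Cauchy_Schwarz_ineq[of v w] by (simp add: power2_norm_eq_inner)
  have "(\<lambda>n. psum n (z n) x) \<longlonglongrightarrow> 0"
  proof (rule quadratic_psum_tendsto_0[OF _ _ x])
    fix n i assume i: "i < m n"
    have "(g (\<pi> n i) \<bullet> dw n i)\<^sup>2 \<le> C\<^sup>2 * (norm (dw n i))\<^sup>2"
      using square[of "g (\<pi> n i)" "dw n i"] g_bound[OF part_in[of i n]] i
      by (meson less_imp_le mult_right_mono norm_ge_zero order_trans power_mono zero_le_power2)
    moreover have "\<bar>energy (\<pi> n (Suc i)) - energy (\<pi> n i)\<bar> \<le> Q * dt n i"
      using part_in[of i n] part_in[of "Suc i" n] part_less[OF i] i by (intro Q(2)) auto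
    ultimately have "\<bar>z n i\<bar> \<le> C\<^sup>2 * (norm (dw n i))\<^sup>2 + Q * dt n i"
      using zero_le_power2[of "g (\<pi> n i) \<bullet> dw n i"] unfolding z_def by linarith
    also have "\<dots> \<le> (C\<^sup>2 + Q) * (dt n i + (norm (dw n i))\<^sup>2)"
    proof -
      have "0 \<le> C\<^sup>2 * dt n i" "0 \<le> Q * (norm (dw n i))\<^sup>2" using Q(1) part_less[OF i] by auto
      then show ?thesis unfolding distrib_left distrib_right by linarith
    qed
    finally show "\<bar>z n i\<bar> \<le> (C\<^sup>2 + Q) * (dt n i + (norm (dw n i))\<^sup>2)" .
  next
    fix r \<epsilon> :: real assume r: "r \<in> {0<..T}" and \<epsilon>: "\<epsilon> > 0"
    obtain \<eta>1 where \<eta>1: "\<eta>1 > 0" "\<And>u. r - \<eta>1 < u \<Longrightarrow> u \<le> r \<Longrightarrow> \<bar>energy_density u - energy_density r\<bar> \<le> \<epsilon>"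
      using energy_density_near[OF r \<epsilon>] by blast
    have "\<epsilon> / (2 * C + 1) > 0" using \<epsilon> C0 by simp
    then obtain b where b: "b < r" "\<And>v. b < v \<Longrightarrow> v < r \<Longrightarrow> dist (g v) (g r) < \<epsilon> / (2 * C + 1)"
      using tendstoD[OF g_left[OF r]] unfolding eventually_at_left_field by blast
    show "\<exists>\<eta>>0. \<exists>H. \<forall>\<^sub>F n in sequentially. \<forall>i<m n. r - \<eta> < \<pi> n i \<longrightarrow> \<pi> n (Suc i) \<le> r \<longrightarrow>
       \<bar>z n i - (H \<bullet> outer (dw n i) - (H \<bullet> a r) * dt n i)\<bar> \<le> \<epsilon> * (dt n i + (norm (dw n i))\<^sup>2)"
    proof (intro exI[of _ "min \<eta>1 (r - b)"] exI[of _ "outer (g r)"] conjI always_eventually allI impI)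
      show "0 < min \<eta>1 (r - b)" using \<eta>1 b by simp
      fix n i assume i: "i < m n" and lower: "r - min \<eta>1 (r - b) < \<pi> n i" and upper: "\<pi> n (Suc i) \<le> r"
      note less = part_less[OF i]
      have in_T: "\<pi> n i \<in> {0..T}" "\<pi> n (Suc i) \<in> {0..T}" "r \<in> {0..T}"
        using part_in[of i n] part_in[of "Suc i" n] i r by auto
      have E: "\<bar>energy (\<pi> n (Suc i)) - energy (\<pi> n i) - energy_density r * dt n i\<bar> \<le> \<epsilon> * dt n i"
        using in_T less lower upper \<eta>1(2) by (intro energy_increment) auto
      have gr: "norm (g (\<pi> n i) - g r) \<le> \<epsilon> / (2 * C + 1)"
      proof -
        have "b < \<pi> n i" "\<pi> n i < r" using lower upper less by auto
        then show ?thesis using b(2)[of "\<pi> n i"] by (simp add: dist_norm)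
      qed
      have sum_le: "norm (g (\<pi> n i) + g r) \<le> 2 * C + 1"
        using norm_triangle_ineq[of "g (\<pi> n i)" "g r"] g_bound[OF in_T(1)] g_bound[OF in_T(3)] by linarith
      have "\<bar>(g (\<pi> n i) \<bullet> dw n i)\<^sup>2 - (g r \<bullet> dw n i)\<^sup>2\<bar>
          = \<bar>(g (\<pi> n i) - g r) \<bullet> dw n i\<bar> * \<bar>(g (\<pi> n i) + g r) \<bullet> dw n i\<bar>"
        by (simp add: power2_eq_square inner_diff_left inner_add_left algebra_simps flip: abs_mult)
      also have "\<dots> \<le> (norm (g (\<pi> n i) - g r) * norm (dw n i)) * (norm (g (\<pi> n i) + g r) * norm (dw n i))"
        by (intro mult_mono Cauchy_Schwarz_ineq2) auto
      also have "\<dots> \<le> (\<epsilon> / (2 * C + 1) * norm (dw n i)) * ((2 * C + 1) * norm (dw n i))"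
        using gr sum_le \<epsilon> C0 by (intro mult_mono) auto
      also have "\<dots> = \<epsilon> * (norm (dw n i))\<^sup>2" using C0 by (simp add: power2_eq_square)
      finally have D: "\<bar>(g (\<pi> n i) \<bullet> dw n i)\<^sup>2 - (g r \<bullet> dw n i)\<^sup>2\<bar> \<le> \<epsilon> * (norm (dw n i))\<^sup>2" .
      have "outer (g r) \<bullet> outer (dw n i) - (outer (g r) \<bullet> a r) * dt n i = (g r \<bullet> dw n i)\<^sup>2 - energy_density r * dt n i"
        by (simp add: outer_inner_outer energy_density_outer)
      then show "\<bar>z n i - (outer (g r) \<bullet> outer (dw n i) - (outer (g r) \<bullet> a r) * dt n i)\<bar>
          \<le> \<epsilon> * (dt n i + (norm (dw n i))\<^sup>2)"
        using E D unfolding z_def distrib_left by linarith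
    qed
  qed
  from tendsto_add[OF this psum_increments_tendsto[OF x energy_continuous]]
  show ?thesis by (simp add: z_def psum_def sum_subtractf energy_def)
qed

end

section \<open>Translation of functionals by constants\<close>

lemma GDERIV_diff_const_iff: "GDERIV (\<lambda>e. f e - c) x :> D \<longleftrightarrow> GDERIV f x :> D"
proof
  assume "GDERIV (\<lambda>e. f e - c) x :> D"
  from GDERIV_add[OF this GDERIV_const[of c]] show "GDERIV f x :> D" by simp
next
  assume "GDERIV f x :> D"
  from GDERIV_diff[OF this GDERIV_const[of c]] show "GDERIV (\<lambda>e. f e - c) x :> D" by simp
qed

lemma vgrad_diff_const: "vgrad T (\<lambda>p. F p - c) = vgrad T F"
  unfolding vgrad_def GDERIV_diff_const_iff ..

lemma vderivs_diff_const:
  "is \<noteq> [] \<Longrightarrow> vderivs T is (\<lambda>p. F p - c) = vderivs T is F"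
proof (induction "is")
  case (Cons i js)
  then show ?case by (cases "js = []") (simp_all add: vgrad_diff_const)
qed simp

lemma hderiv_diff_const: "hderiv (\<lambda>p. F p - c) = hderiv F"
  by (simp add: hderiv_def)

lemma nonanticipative_diff_const:
  "nonanticipative T F \<Longrightarrow> nonanticipative T (\<lambda>p. F p - c)"
  unfolding nonanticipative_def by (intro borel_measurable_diff borel_measurable_const)

lemma left_continuous_diff_const: "left_continuous T (\<lambda>p. F p - c) = left_continuous T F"
  by (simp add: left_continuous_def)

lemma vertically_differentiable_diff_const:
  "vertically_differentiable T F \<Longrightarrow> vertically_differentiable T (\<lambda>p. F p - c)"
  unfolding vertically_differentiable_def by (auto intro!: differentiable_diff)

lemma C1b_diff_const:
  assumes "F \<in> C1b T k"
  shows "(\<lambda>p. F p - c) \<in> C1b T k"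
proof -
  have vd: "vertically_differentiable T (vderivs T is (\<lambda>p. F p - c))" if "length is < k" for "is"
    using C1b_D(4)[OF assms that] vertically_differentiable_diff_const[of T F c]
    by (cases "is = []") (auto simp: vderivs_diff_const)
  have na: "nonanticipative T (vderivs T is (\<lambda>p. F p - c)) \<and> left_continuous T (vderivs T is (\<lambda>p. F p - c))"
    if "length is \<le> k" for "is"
  proof (cases "is = []")
    case True
    have "nonanticipative T F" using assms by (simp add: C1b_def)
    then show ?thesis using True C1b_D(3)[OF assms]
      by (simp add: nonanticipative_diff_const left_continuous_diff_const)
  next
    case False
    then show ?thesis using assms that by (simp add: C1b_def vderivs_diff_const)
  qed
  have bp: "boundedness_preserving T {0..T} (vderivs T is (\<lambda>p. F p - c))" if "1 \<le> length is" "length is \<le> k" for "is"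
  proof -
    have "is \<noteq> []" using that by auto
    then show ?thesis using C1b_D(6)[OF assms that] by (simp add: vderivs_diff_const)
  qed
  show ?thesis
    using assms vd na bp nonanticipative_diff_const[of T F c]
    by (simp add: C1b_def hderiv_diff_const horizontally_differentiable_def)
qed

text \<open>Harmonicity and the regularity class are insensitive to additive constants, as bounds
  are imposed on derivatives only. Subtracting the initial value thus represents an integral,
  which starts at \<open>0\<close>, by a harmonic functional.\<close>
lemma harmonic_diff_const:
  assumes "F \<in> harmonic_functionals T m \<pi> a \<omega>"
  shows "(\<lambda>p. F p - c) \<in> harmonic_functionals T m \<pi> a \<omega>"
proof -
  have "lipschitz_functional T (\<lambda>p. F p - c)"
    using assms nonanticipative_diff_const[of T F c]
    by (simp add: harmonic_functionals_def R_space_def lipschitz_functional_def)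
  moreover have "vhess T (\<lambda>p. F p - c) = vhess T F"
    unfolding vhess_def by (simp del: vderivs.simps add: vderivs_diff_const)
  ultimately show ?thesis
    using assms C1b_diff_const[of F T 2 c]
    by (simp add: harmonic_functionals_def R_space_def vgrad_diff_const hderiv_diff_const)
qed

section \<open>The mesh and the space of paths of finite quadratic variation\<close>

text \<open>A quadratic variation with positive derivative is strictly increasing. If long
  intervals occurred for infinitely many \<open>n\<close>, one of finitely many fixed cells would
  be free of partition points for infinitely many \<open>n\<close>, and the quadratic variation
  would not increase there.\<close>
lemma mesh_tendsto_0:
  assumes T: "0 < T" and part: "partition_seq T m \<pi>"
    and conv: "\<And>t. t \<in> {0..T} \<Longrightarrow> convergent (qv_sum m \<pi> x t)"
    and deriv: "\<And>t. t \<in> {0..T} \<Longrightarrow> (qv m \<pi> x has_real_derivative d t) (at t within {0..T})"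
    and d: "\<And>t. t \<in> {0..T} \<Longrightarrow> 0 < d t"
    and e: "e > 0"
  shows "\<forall>\<^sub>F n in sequentially. \<forall>i<m n. \<pi> n (Suc i) - \<pi> n i < e"
proof (rule ccontr)
  assume "\<not> ?thesis"
  then have fr: "\<exists>\<^sub>F n in sequentially. \<exists>i<m n. e \<le> \<pi> n (Suc i) - \<pi> n i"
    by (simp add: not_eventually not_less)
  have less: "\<pi> n i < \<pi> n (Suc i)" if "i < m n" for n i using part that by (simp add: partition_seq_def)
  have mono: "\<pi> n i \<le> \<pi> n j" if "i \<le> j" "j \<le> m n" for n i j
    using grid_mono[of "m n" "\<pi> n" i j] less[of _ n] that by (auto intro: less_imp_le)
  have range: "0 \<le> \<pi> n i" "\<pi> n i \<le> T" if "i \<le> m n" for n i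
    using mono[of 0 i n] mono[of i "m n" n] that part by (auto simp: partition_seq_def)
  obtain M :: nat where M: "2 * T / e < real M" using reals_Archimedean2 by blast
  have M0: "M > 0" using M T e by (cases "M = 0") (auto simp: divide_less_0_iff)
  define c where "c = T / real M"
  have c: "c > 0" using T M0 by (simp add: c_def)
  have ce: "2 * c < e" using M e M0 by (simp add: c_def field_simps)
  define empty where "empty n k \<longleftrightarrow> (\<exists>i<m n. \<pi> n i \<le> real k * c \<and> real k * c + c \<le> \<pi> n (Suc i))" for n k
  have "\<exists>k\<in>{..M}. empty n k" if long: "\<exists>i<m n. e \<le> \<pi> n (Suc i) - \<pi> n i" for n
  proof -
    obtain i where i: "i < m n" "e \<le> \<pi> n (Suc i) - \<pi> n i" using long by blast
    define k where "k = nat \<lceil>\<pi> n i / c\<rceil>"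
    have "0 \<le> \<pi> n i / c" using range[of i n] i c by simp
    then have k: "\<pi> n i / c \<le> real k" "real k < \<pi> n i / c + 1" unfolding k_def by linarith+
    have kc: "\<pi> n i \<le> real k * c" "real k * c < \<pi> n i + c"
      using k c by (auto simp: field_simps)
    then have le: "real k * c + c \<le> \<pi> n (Suc i)" using i ce by linarith
    then have "real k * c \<le> real M * c" using range[of "Suc i" n] i c M0 by (simp add: c_def)
    then have "k \<le> M" using c by simp
    then show ?thesis using i kc le unfolding empty_def by auto
  qed
  then have "\<exists>\<^sub>F n in sequentially. \<exists>k\<in>{..M}. empty n k" using frequently_mono[OF _ fr] by auto
  then obtain k where k: "\<exists>\<^sub>F n in sequentially. empty n k"
    using frequently_bex_finite[of "{..M}" "\<lambda>n k. empty n k"] by auto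
  define u where "u = real k * c"
  \<comment> \<open>Half a cell suffices: the open end keeps \<open>v\<close> strictly below the next partition point.\<close>
  define v where "v = u + c / 2"
  have uv: "0 \<le> u" "u < v" using c by (auto simp: u_def v_def)
  obtain n where "empty n k" using k frequently_ex by blast
  then have "u + c \<le> T" using range unfolding empty_def u_def by (meson Suc_leI order_trans)
  then have vT: "v \<le> T" using c by (simp add: v_def)
  have in_T: "u \<in> {0..T}" "v \<in> {0..T}" using uv vT by auto
  have "\<exists>\<xi>\<in>{u<..<v}. qv m \<pi> x v - qv m \<pi> x u = d \<xi> * (v - u)"
    using uv vT by (intro mvt_simple) (auto intro!: has_derivative_subset[OF deriv[unfolded has_field_derivative_def]])
  then have lt: "qv m \<pi> x u < qv m \<pi> x v" using d uv vT by (smt (verit) atLeastAtMost_iff greaterThanLessThan_iff mult_pos_pos)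
  have "(\<lambda>n. qv_sum m \<pi> x v n - qv_sum m \<pi> x u n) \<longlonglongrightarrow> qv m \<pi> x v - qv m \<pi> x u"
    unfolding qv_def using conv in_T by (intro tendsto_diff) (auto simp: convergent_LIMSEQ_iff)
  then have "\<forall>\<^sub>F n in sequentially. qv_sum m \<pi> x v n - qv_sum m \<pi> x u n > 0"
    using lt by (intro order_tendstoD) auto
  then have "\<exists>\<^sub>F n in sequentially. empty n k \<and> qv_sum m \<pi> x v n - qv_sum m \<pi> x u n > 0"
    using k by (rule frequently_eventually_frequently[rotated])
  then obtain n where n: "empty n k" "qv_sum m \<pi> x v n - qv_sum m \<pi> x u n > 0"
    using frequently_ex by blast
  obtain i where i: "i < m n" "\<pi> n i \<le> u" "u + c \<le> \<pi> n (Suc i)" using n(1) unfolding empty_def u_def by blast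
  have "\<pi> n (Suc j) \<le> u \<longleftrightarrow> \<pi> n (Suc j) \<le> v" if j: "j < m n" for j
  proof (cases "j < i")
    case True
    then have "\<pi> n (Suc j) \<le> u" using mono[of "Suc j" i n] i by auto
    then show ?thesis using uv by auto
  next
    case False
    then have "v < \<pi> n (Suc j)" using mono[of "Suc i" "Suc j" n] i j c by (auto simp: v_def)
    then show ?thesis using uv by auto
  qed
  then have "{j. j < m n \<and> \<pi> n (Suc j) \<le> u} = {j. j < m n \<and> \<pi> n (Suc j) \<le> v}" by blast
  then show False using n(2) by (simp add: qv_sum_def)
qed

context partitions
begin

lemma qv_sum_psum: "qv_sum m \<pi> x t n = psum n (\<lambda>i. (x (\<pi> n (Suc i)) - x (\<pi> n i))\<^sup>2) t"
  by (simp add: qv_sum_def psum_def)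

lemma continuous_Q_scalar:
  assumes x: "continuous_on {0..T} x" and c: "continuous_on {0..T} c" "mono_on {0..T} c"
    and lim: "\<And>t. t \<in> {0..T} \<Longrightarrow> (\<lambda>n. psum n (\<lambda>i. (x (\<pi> n (Suc i)) - x (\<pi> n i))\<^sup>2) t) \<longlonglongrightarrow> c t"
  shows "x \<in> Q_scalar T m \<pi>" and "\<And>t. t \<in> {0..T} \<Longrightarrow> qv m \<pi> x t = c t"
proof -
  have lim': "qv_sum m \<pi> x t \<longlonglongrightarrow> c t" if "t \<in> {0..T}" for t
    using lim[OF that] by (simp add: qv_sum_psum[abs_def])
  show qv: "qv m \<pi> x t = c t" if "t \<in> {0..T}" for t
    unfolding qv_def by (rule limI[OF lim'[OF that]])
  have jump: "x s - left_lim x s = 0" if s: "s \<in> {0<..T}" for s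
  proof -
    have "(x \<longlongrightarrow> x s) (at s within {0..s})"
      using continuous_on_subset[OF x, of "{0..s}"] s by (simp add: continuous_on_def)
    moreover have "at s within {0..s} = at_left s" using s by (auto intro: at_within_Icc_at_left)
    ultimately have "Lim (at_left s) x = x s" by (intro tendsto_Lim) auto
    then show ?thesis using s by (simp add: left_lim_def)
  qed
  have "((\<lambda>s. (x s - left_lim x s)\<^sup>2) has_sum (qv m \<pi> x t - c t)) {0<..t}" if t: "t \<in> {0..T}" for t
    unfolding qv[OF t] using jump t by (auto intro!: has_sum_0)
  then show "x \<in> Q_scalar T m \<pi>"
    unfolding Q_scalar_def using cadlag_continuous_on[OF x] c convergentI[OF lim'] by blast
qed

end

section \<open>The isometry along a Hoelder path\<close>

locale holder_covariation = covariation T m \<pi> \<omega> a A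
  for T :: real and m \<pi> and \<omega> :: "('d::finite) path" and a A +
  fixes \<nu> :: real
  assumes a_pos: "\<And>t v. t \<in> {0..T} \<Longrightarrow> v \<noteq> 0 \<Longrightarrow> v \<bullet> (a t *v v) > 0"
    and \<nu>_range: "0 < \<nu>" "\<nu> < 1" and \<nu>_large: "1 / 2 < \<nu> + \<nu>\<^sup>2"
    and holder: "holder_on T \<nu> \<omega>"
begin

abbreviation fval :: "'d functional \<Rightarrow> real \<Rightarrow> real" where
  "fval F t \<equiv> F (t, stop T t \<omega>)"

abbreviation fgrad :: "'d functional \<Rightarrow> real \<Rightarrow> real^'d" where
  "fgrad F t \<equiv> vgrad T F (t, stop T t \<omega>)"

abbreviation inc :: "(real \<Rightarrow> real) \<Rightarrow> nat \<Rightarrow> nat \<Rightarrow> real" where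
  "inc x n i \<equiv> x (\<pi> n (Suc i)) - x (\<pi> n i)"

lemma remainder_square_psum_tendsto_0:
  assumes F: "F \<in> R_space T m \<pi> \<omega>"
  shows "(\<lambda>n. psum n (\<lambda>i. (inc (fval F) n i - fgrad F (\<pi> n i) \<bullet> dw n i)\<^sup>2) x) \<longlonglongrightarrow> 0"
proof -
  obtain C R where reg: "regular_functional T C R F" and R: "\<And>x. x \<in> {0..T} \<Longrightarrow> norm (\<omega> x) \<le> R / 3"
    using R_space_regular_along[OF F] by blast
  interpret regular_functional T C R F by (rule reg)
  obtain K0 where K0: "\<And>s t. s \<in> {0..T} \<Longrightarrow> t \<in> {0..T} \<Longrightarrow> norm (\<omega> t - \<omega> s) \<le> K0 * \<bar>t - s\<bar> powr \<nu>"
    using holder unfolding holder_on_def by blast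
  define K where "K = \<bar>K0\<bar> + 1"
  have K: "K > 0" by (simp add: K_def)
  have hK: "norm (\<omega> x - \<omega> y) \<le> K * \<bar>x - y\<bar> powr \<nu>" if "x \<in> {0..T}" "y \<in> {0..T}" for x y
  proof -
    have "K0 * \<bar>x - y\<bar> powr \<nu> \<le> K * \<bar>x - y\<bar> powr \<nu>" by (intro mult_right_mono) (auto simp: K_def)
    then show ?thesis using K0[OF that(2,1)] by simp
  qed
  show ?thesis
  proof (rule psum_holder_square_tendsto_0[of "min 1 (\<nu> + \<nu>\<^sup>2)" "C * (1 + 2 * K + 4 * K\<^sup>2)"])
    show "1 / 2 < min 1 (\<nu> + \<nu>\<^sup>2)" using \<nu>_large by simp
    show "0 < C * (1 + 2 * K + 4 * K\<^sup>2)" using C_pos K by (intro mult_pos_pos add_pos_pos) auto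
    fix n i assume i: "i < m n" "dt n i \<le> 1"
    show "\<bar>inc (fval F) n i - fgrad F (\<pi> n i) \<bullet> dw n i\<bar> \<le> C * (1 + 2 * K + 4 * K\<^sup>2) * dt n i powr min 1 (\<nu> + \<nu>\<^sup>2)"
      using part_in[of i n] part_in[of "Suc i" n] part_less[OF i(1)] i
      by (intro holder_remainder_bound path_cont R K hK \<nu>_range) auto
  qed
qed

text \<open>This handles two functionals at once: if the gradients agree, the values along
  \<open>\<omega>\<close> differ by a path of zero quadratic variation; if the values have the
  same increments, the gradients differ by an integrand of zero energy.\<close>
lemma remainder_difference_tendsto_0:
  assumes F: "F \<in> R_space T m \<pi> \<omega>" and G: "G \<in> R_space T m \<pi> \<omega>"
  shows "(\<lambda>n. psum n (\<lambda>i. ((inc (fval F) n i - inc (fval G) n i)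
      - (fgrad F (\<pi> n i) - fgrad G (\<pi> n i)) \<bullet> dw n i)\<^sup>2) x) \<longlonglongrightarrow> 0"
proof (rule psum_square_perturbation[OF _ remainder_square_psum_tendsto_0[OF F]])
  have "(inc (fval F) n i - inc (fval G) n i - (fgrad F (\<pi> n i) - fgrad G (\<pi> n i)) \<bullet> dw n i
      - (inc (fval F) n i - fgrad F (\<pi> n i) \<bullet> dw n i))\<^sup>2
      = (inc (fval G) n i - fgrad G (\<pi> n i) \<bullet> dw n i)\<^sup>2" for n i
  proof -
    have "inc (fval F) n i - inc (fval G) n i - (fgrad F (\<pi> n i) - fgrad G (\<pi> n i)) \<bullet> dw n i
      - (inc (fval F) n i - fgrad F (\<pi> n i) \<bullet> dw n i) = - (inc (fval G) n i - fgrad G (\<pi> n i) \<bullet> dw n i)"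
      unfolding inner_diff_left[of "fgrad F _"] by simp
    then show ?thesis by (simp only: power2_minus)
  qed
  then show "(\<lambda>n. psum n (\<lambda>i. (inc (fval F) n i - inc (fval G) n i - (fgrad F (\<pi> n i) - fgrad G (\<pi> n i)) \<bullet> dw n i
      - (inc (fval F) n i - fgrad F (\<pi> n i) \<bullet> dw n i))\<^sup>2) x) \<longlonglongrightarrow> 0"
    using remainder_square_psum_tendsto_0[OF G, of x] by (simp only:)
qed

lemma gradient_integrand:
  assumes "F \<in> R_space T m \<pi> \<omega>"
  obtains C where "left_continuous_integrand T m \<pi> \<omega> a A (fgrad F) C"
proof -
  obtain C where "\<And>t. t \<in> {0..T} \<Longrightarrow> norm (fgrad F t) \<le> C" using gradient_along_bounded[OF assms] by blast
  then have "left_continuous_integrand T m \<pi> \<omega> a A (fgrad F) C"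
    using gradient_along_left_limit[OF assms] by unfold_locales
  then show thesis by (rule that)
qed

lemma quadratic_form_nonneg: "t \<in> {0..T} \<Longrightarrow> 0 \<le> v \<bullet> (a t *v v)"
  using a_pos[of t v] by (cases "v = 0") auto

lemma along_quadratic_variation:
  assumes F: "F \<in> R_space T m \<pi> \<omega>"
  shows "along T \<omega> F \<in> Q_scalar T m \<pi>"
    and "along T \<omega> (vgrad T F) \<in> L2_space T a"
    and "qv_norm T m \<pi> (along T \<omega> F) = L2_norm T a (along T \<omega> (vgrad T F))"
proof -
  obtain C where int: "left_continuous_integrand T m \<pi> \<omega> a A (fgrad F) C"
    using gradient_integrand[OF F] .
  interpret left_continuous_integrand T m \<pi> \<omega> a A "fgrad F" C by (rule int)
  have val: "along T \<omega> F t = fval F t" if "t \<in> {0..T}" for t using that by (simp add: along_def)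
  have grad: "along T \<omega> (vgrad T F) t = fgrad F t" if "t \<in> {0..T}" for t using that by (simp add: along_def)
  have nonneg: "0 \<le> energy_density u" if "u \<in> {0..T}" for u
    unfolding energy_density_def by (rule quadratic_form_nonneg[OF that])
  have lim: "(\<lambda>n. psum n (\<lambda>i. (inc (along T \<omega> F) n i)\<^sup>2) t) \<longlonglongrightarrow> energy t" if t: "t \<in> {0..T}" for t
  proof -
    have "(\<lambda>n. psum n (\<lambda>i. (inc (fval F) n i)\<^sup>2) t) \<longlonglongrightarrow> energy t"
      by (rule psum_square_perturbation[OF remainder_square_psum_tendsto_0[OF F] gradient_square_psum_tendsto[OF t]])
    moreover have "psum n (\<lambda>i. (inc (along T \<omega> F) n i)\<^sup>2) t = psum n (\<lambda>i. (inc (fval F) n i)\<^sup>2) t" for n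
      unfolding psum_def using part_in[of _ n] by (intro sum.cong) (auto simp: val)
    ultimately show ?thesis by simp
  qed
  have cont: "continuous_on {0..T} (along T \<omega> F)"
    using functional_along_continuous[OF F] by (rule continuous_on_eq) (simp add: val)
  note Q = continuous_Q_scalar[OF cont energy_continuous energy_mono[OF nonneg] lim]
  show "along T \<omega> F \<in> Q_scalar T m \<pi>" using Q(1) by blast
  have dens: "along T \<omega> (vgrad T F) u \<bullet> (a u *v along T \<omega> (vgrad T F) u) = energy_density u" if "u \<in> {0..T}" for u
    using grad[OF that] by (simp add: energy_density_def)
  show "along T \<omega> (vgrad T F) \<in> L2_space T a"
    unfolding L2_space_def mem_Collect_eq
  proof
    have "(\<lambda>u. indicator {0..T} u *\<^sub>R along T \<omega> (vgrad T F) u) = (\<lambda>u. indicator {0..T} u *\<^sub>R fgrad F u)"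
    proof
      fix u
      show "indicator {0..T} u *\<^sub>R along T \<omega> (vgrad T F) u = indicator {0..T} u *\<^sub>R fgrad F u"
        using grad[of u] by (cases "u \<in> {0..T}") simp_all
    qed
    then show "set_borel_measurable lborel {0..T} (along T \<omega> (vgrad T F))"
      using left_limits_set_borel_measurable[OF g_left] by (simp add: set_borel_measurable_def)
    show "set_integrable lborel {0..T} (\<lambda>u. along T \<omega> (vgrad T F) u \<bullet> (a u *v along T \<omega> (vgrad T F) u))"
      using energy_density_set_integrable dens by (subst set_integrable_cong[OF refl refl, of _ _ energy_density]) auto
  qed
  have "(LINT u:{0..T}|lborel. along T \<omega> (vgrad T F) u \<bullet> (a u *v along T \<omega> (vgrad T F) u))
      = (LINT u:{0..T}|lborel. energy_density u)"
    using dens by (intro set_lebesgue_integral_cong) auto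
  moreover have "qv m \<pi> (along T \<omega> F) T = energy T" using Q(2)[of T] T_pos by auto
  ultimately show "qv_norm T m \<pi> (along T \<omega> F) = L2_norm T a (along T \<omega> (vgrad T F))"
    by (simp add: qv_norm_def L2_norm_def LINT_energy_density)
qed

lemma pathwise_integral_eq:
  assumes F: "F \<in> harmonic_functionals T m \<pi> a \<omega>"
  shows "pathwise_integral T m \<pi> \<omega> F = along T \<omega> (\<lambda>p. F p - F (0, stop T 0 \<omega>))"
proof
  fix t
  show "pathwise_integral T m \<pi> \<omega> F t = along T \<omega> (\<lambda>p. F p - F (0, stop T 0 \<omega>)) t"
    unfolding pathwise_integral_def along_def restrict_def
    using limI[OF integral_sum_tendsto[OF F, of t]] by simp
qed

lemma same_gradient_qv_0:
  assumes F: "F \<in> R_space T m \<pi> \<omega>" and G: "G \<in> R_space T m \<pi> \<omega>"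
    and eq: "along T \<omega> (vgrad T F) = along T \<omega> (vgrad T G)"
  shows "(\<lambda>t. along T \<omega> F t - along T \<omega> G t) \<in> Q_scalar T m \<pi>"
    and "qv_norm T m \<pi> (\<lambda>t. along T \<omega> F t - along T \<omega> G t) = 0"
proof -
  let ?D = "\<lambda>t. along T \<omega> F t - along T \<omega> G t"
  have grad: "fgrad F t = fgrad G t" if "t \<in> {0..T}" for t
    using fun_cong[OF eq, of t] that by (simp add: along_def)
  have val: "?D t = fval F t - fval G t" if "t \<in> {0..T}" for t using that by (simp add: along_def)
  have lim: "(\<lambda>n. psum n (\<lambda>i. (inc ?D n i)\<^sup>2) t) \<longlonglongrightarrow> 0" if t: "t \<in> {0..T}" for t
  proof -
    have "psum n (\<lambda>i. (inc ?D n i)\<^sup>2) t = psum n (\<lambda>i. ((inc (fval F) n i - inc (fval G) n i)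
      - (fgrad F (\<pi> n i) - fgrad G (\<pi> n i)) \<bullet> dw n i)\<^sup>2) t" for n
      unfolding psum_def
    proof (rule sum.cong[OF refl])
      fix i assume "i \<in> {i. i < m n \<and> \<pi> n (Suc i) \<le> t}"
      then have i: "\<pi> n i \<in> {0..T}" "\<pi> n (Suc i) \<in> {0..T}" using part_in[of i n] part_in[of "Suc i" n] by auto
      have "inc ?D n i = inc (fval F) n i - inc (fval G) n i - (fgrad F (\<pi> n i) - fgrad G (\<pi> n i)) \<bullet> dw n i"
        unfolding val[OF i(1)] val[OF i(2)] grad[OF i(1)] by simp
      then show "(inc ?D n i)\<^sup>2 = (inc (fval F) n i - inc (fval G) n i - (fgrad F (\<pi> n i) - fgrad G (\<pi> n i)) \<bullet> dw n i)\<^sup>2"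
        by (rule arg_cong)
    qed
    then show ?thesis using remainder_difference_tendsto_0[OF F G, of t] by (simp only:)
  qed
  have "continuous_on {0..T} (\<lambda>t. fval F t - fval G t)"
    by (intro continuous_on_diff functional_along_continuous F G)
  then have cont: "continuous_on {0..T} ?D" by (rule continuous_on_eq) (simp add: val)
  note Q = continuous_Q_scalar[OF cont continuous_on_const mono_on_const lim]
  show "?D \<in> Q_scalar T m \<pi>" using Q(1) by blast
  have "qv m \<pi> ?D T = 0" using Q(2)[of T] T_pos by auto
  then show "qv_norm T m \<pi> ?D = 0" by (simp add: qv_norm_def)
qed

text \<open>The gradient at \<open>(h, \<omega>\<^sub>0)\<close> is close to the one at \<open>(0,
  \<omega>\<^sub>0)\<close> by its regularity in time. To compare it with the gradient at
  \<open>(h, \<omega>\<^sub>h)\<close>, read both off from bumps of size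
  \<open>\<epsilon>\<close>: the bumped and unbumped values differ by at most the Lipschitz
  constant times the distance of the paths, the expansion errs by
  \<open>\<epsilon>\<^sup>2\<close>, and division by \<open>\<epsilon>\<close> leaves an error of
  order \<open>\<epsilon>\<close> if the paths are
  \<open>\<epsilon>\<^sup>2\<close>-close.\<close>
lemma gradient_right_limit_0:
  assumes F: "F \<in> R_space T m \<pi> \<omega>"
  shows "(fgrad F \<longlongrightarrow> fgrad F 0) (at_right 0)"
proof (rule tendstoI)
  fix e :: real assume e: "e > 0"
  obtain C R where reg: "regular_functional T C R F" and R: "\<And>x. x \<in> {0..T} \<Longrightarrow> norm (\<omega> x) \<le> R / 3" and R0: "R > 0"
    using R_space_regular_along[OF F] by blast
  interpret regular_functional T C R F by (rule reg)
  have R': "norm (\<omega> x) \<le> R" if "x \<in> {0..T}" for x using R[OF that] R0 by simp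
  define \<epsilon> where "\<epsilon> = min (R / 3) (e / (8 * C))"
  have \<epsilon>: "\<epsilon> > 0" "\<epsilon> \<le> R / 3" using R0 e C_pos by (auto simp: \<epsilon>_def)
  have "\<epsilon> \<le> e / (8 * C)" by (simp add: \<epsilon>_def)
  then have \<epsilon>e: "4 * C * \<epsilon> \<le> e / 2" using C_pos by (simp add: field_simps)
  have "\<epsilon>\<^sup>2 > 0" using \<epsilon> by simp
  then obtain d where d: "d > 0" "\<And>s t z. s \<in> {0..T} \<Longrightarrow> t \<in> {0..T} \<Longrightarrow> \<bar>s - t\<bar> < d \<Longrightarrow> z \<in> {0..T} \<Longrightarrow>
      norm (stop T s \<omega> z - stop T t \<omega> z) \<le> \<epsilon>\<^sup>2" using stop_near by blast
  define b where "b = min T (min d (e / (4 * C)))"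
  show "\<forall>\<^sub>F h in at_right 0. dist (fgrad F h) (fgrad F 0) < e"
  proof (rule eventually_at_rightI[of 0 b])
    show "0 < b" using T_pos d e C_pos by (simp add: b_def)
    fix h assume "h \<in> {0<..<b}"
    then have h: "0 < h" "h \<le> T" "h < d" "h < e / (4 * C)" by (auto simp: b_def)
    have hT: "h \<in> {0..T}" "0 \<in> {0..T}" using h by auto
    let ?P = "stop T h \<omega>" and ?Q = "stop T 0 \<omega>"
    have P: "(h, ?P) \<in> stopped_paths T" and Q0: "(0, ?Q) \<in> stopped_paths T"
      using stopped_paths_stop[OF path_cont] hT by auto
    have Q: "(h, ?Q) \<in> stopped_paths T" by (rule stopped_paths_later[OF Q0]) (use h in auto)
    define D where "D = vgrad T F (h, ?P) - vgrad T F (h, ?Q)"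
    \<comment> \<open>The direction in which the difference of the gradients is fully visible.\<close>
    define v where "v = \<epsilon> *\<^sub>R sgn D"
    have nv: "norm v \<le> \<epsilon>" using \<epsilon> by (simp add: v_def norm_sgn)
    have room: "norm (stop T s \<omega> z) + norm v \<le> R" if "s \<in> {0..T}" "z \<in> {0..T}" for s z
      using stop_norm_le[OF R that] nv \<epsilon> R0 by auto
    have v2: "C * (norm v)\<^sup>2 \<le> C * \<epsilon>\<^sup>2" using nv C_pos by (intro mult_left_mono power_mono) auto
    have exP: "\<bar>F (h, bump T h ?P v) - F (h, ?P) - vgrad T F (h, ?P) \<bullet> v\<bar> \<le> C * \<epsilon>\<^sup>2"
      using vertical_expansion[OF P room[OF hT(1)]] v2 by simp
    have exQ: "\<bar>F (h, bump T h ?Q v) - F (h, ?Q) - vgrad T F (h, ?Q) \<bullet> v\<bar> \<le> C * \<epsilon>\<^sup>2"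
      using vertical_expansion[OF Q room[OF hT(2)]] v2 by simp
    have near: "norm (?P z - ?Q z) \<le> \<epsilon>\<^sup>2" if "z \<in> {0..T}" for z
      using h hT that by (intro d(2)) auto
    have lip: "\<bar>F (h, ?P) - F (h, ?Q)\<bar> \<le> C * \<epsilon>\<^sup>2" by (rule path_lipschitz[OF P Q near])
    have lip': "\<bar>F (h, bump T h ?P v) - F (h, bump T h ?Q v)\<bar> \<le> C * \<epsilon>\<^sup>2"
    proof (rule path_lipschitz[OF stopped_paths_bump[OF P] stopped_paths_bump[OF Q]])
      fix z assume z: "z \<in> {0..T}"
      have eq: "bump T h ?P v z - bump T h ?Q v z = ?P z - ?Q z" using z by (simp add: bump_def)
      show "norm (bump T h ?P v z - bump T h ?Q v z) \<le> \<epsilon>\<^sup>2" unfolding eq by (rule near[OF z])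
    qed
    have "D \<bullet> v = \<epsilon> * norm D"
      by (cases "D = 0") (simp_all add: v_def sgn_div_norm dot_square_norm power2_eq_square)
    moreover have "D \<bullet> v = vgrad T F (h, ?P) \<bullet> v - vgrad T F (h, ?Q) \<bullet> v" by (simp add: D_def inner_diff_left)
    ultimately have "\<epsilon> * norm D \<le> 4 * (C * \<epsilon>\<^sup>2)" using exP exQ lip lip' by linarith
    then have "\<epsilon> * norm D \<le> \<epsilon> * (4 * C * \<epsilon>)" by (simp add: power2_eq_square mult_ac)
    then have "norm D \<le> 4 * C * \<epsilon>" using \<epsilon> by simp
    then have 1: "norm D \<le> e / 2" using \<epsilon>e by simp
    have "norm (vgrad T F (h, ?Q) - vgrad T F (0, ?Q)) \<le> C * (h - 0)"
      using h hT stop_norm_le[OF R' hT(2)] by (intro grad_time_lipschitz[OF Q0]) auto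
    also have "\<dots> < e / 2" using h(4) C_pos e by (simp add: field_simps)
    finally have 2: "norm (vgrad T F (h, ?Q) - vgrad T F (0, ?Q)) < e / 2" .
    have eq: "fgrad F h - fgrad F 0 = D + (vgrad T F (h, ?Q) - vgrad T F (0, ?Q))" by (simp add: D_def)
    show "dist (fgrad F h) (fgrad F 0) < e"
      unfolding dist_norm eq
      using norm_triangle_ineq[of D "vgrad T F (h, ?Q) - vgrad T F (0, ?Q)"] 1 2 by linarith
  qed
qed

lemma same_increments_same_gradient:
  assumes F: "F \<in> R_space T m \<pi> \<omega>" and G: "G \<in> R_space T m \<pi> \<omega>"
    and eq: "\<And>t. t \<in> {0..T} \<Longrightarrow> fval F t - fval F 0 = fval G t - fval G 0"
  shows "along T \<omega> (vgrad T F) = along T \<omega> (vgrad T G)"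
proof -
  define g where "g t = fgrad F t - fgrad G t" for t
  obtain C1 C2 where C: "\<And>t. t \<in> {0..T} \<Longrightarrow> norm (fgrad F t) \<le> C1" "\<And>t. t \<in> {0..T} \<Longrightarrow> norm (fgrad G t) \<le> C2"
    using gradient_along_bounded[OF F] gradient_along_bounded[OF G] by metis
  interpret left_continuous_integrand T m \<pi> \<omega> a A g "C1 + C2"
  proof
    show "norm (g t) \<le> C1 + C2" if "t \<in> {0..T}" for t
      unfolding g_def by (rule order_trans[OF norm_triangle_ineq4 add_mono[OF C(1) C(2)]]) (use that in auto)
    show "(g \<longlongrightarrow> g r) (at_left r)" if "r \<in> {0<..T}" for r
      unfolding g_def by (intro tendsto_diff gradient_along_left_limit F G that)
  qed
  have T: "T \<in> {0..T}" using T_pos by simp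
  have nonneg: "0 \<le> energy_density u" if "u \<in> {0..T}" for u
    unfolding energy_density_def by (rule quadratic_form_nonneg[OF that])
  have "psum n (\<lambda>i. ((inc (fval F) n i - inc (fval G) n i)
      - (fgrad F (\<pi> n i) - fgrad G (\<pi> n i)) \<bullet> dw n i)\<^sup>2) T = psum n (\<lambda>i. (g (\<pi> n i) \<bullet> dw n i)\<^sup>2) T" for n
    unfolding psum_def
  proof (rule sum.cong[OF refl])
    fix i assume "i \<in> {i. i < m n \<and> \<pi> n (Suc i) \<le> T}"
    then have i: "\<pi> n i \<in> {0..T}" "\<pi> n (Suc i) \<in> {0..T}" using part_in[of i n] part_in[of "Suc i" n] by auto
    have "inc (fval F) n i - inc (fval G) n i = 0" using eq[OF i(1)] eq[OF i(2)] by linarith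
    then show "((inc (fval F) n i - inc (fval G) n i)
      - (fgrad F (\<pi> n i) - fgrad G (\<pi> n i)) \<bullet> dw n i)\<^sup>2 = (g (\<pi> n i) \<bullet> dw n i)\<^sup>2"
      by (simp add: g_def)
  qed
  then have "(\<lambda>n. psum n (\<lambda>i. (g (\<pi> n i) \<bullet> dw n i)\<^sup>2) T) \<longlonglongrightarrow> 0"
    using remainder_difference_tendsto_0[OF F G, of T] by (simp only:)
  then have zero: "energy T = 0" using LIMSEQ_unique[OF gradient_square_psum_tendsto[OF T]] by simp
  have g0: "g r = 0" if "r \<in> {0<..T}" for r
  proof (rule ccontr)
    assume "g r \<noteq> 0"
    then show False
      using energy_density_eq_0[OF nonneg zero that] a_pos[of r "g r"] that by (auto simp: energy_density_def)
  qed
  have "fgrad F 0 = fgrad G 0"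
  proof (rule tendsto_unique)
    show "(fgrad F \<longlongrightarrow> fgrad F 0) (at_right 0)" by (rule gradient_right_limit_0[OF F])
    have "\<forall>\<^sub>F h in at_right 0. fgrad G h = fgrad F h"
      by (rule eventually_at_rightI[of 0 T]) (use g0 T_pos in \<open>auto simp: g_def\<close>)
    then show "(fgrad F \<longlongrightarrow> fgrad G 0) (at_right 0)"
      by (rule Lim_transform_eventually[OF gradient_right_limit_0[OF G]])
  qed simp
  then have "fgrad F t = fgrad G t" if "t \<in> {0..T}" for t
    using g0[of t] that by (cases "t = 0") (auto simp: g_def)
  then show ?thesis by (auto simp: along_def restrict_def fun_eq_iff)
qed

end

section \<open>Injective isometry\<close>

theorem proposition2p8:
  fixes T \<nu> :: real
    and m :: "nat \<Rightarrow> nat" and \<pi> :: "nat \<Rightarrow> nat \<Rightarrow> real"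
    and a :: "real \<Rightarrow> real^'d^'d" and \<omega> :: "real \<Rightarrow> real^'d"
    and I :: "(real \<Rightarrow> real^'d) \<Rightarrow> (real \<Rightarrow> real)"
  assumes "0 < T"
    and "partition_seq T m \<pi>"
    and "continuous_on {0..T} a"
    and "\<And>t. t \<in> {0..T} \<Longrightarrow> transpose (a t) = a t"
    and "\<And>t v. t \<in> {0..T} \<Longrightarrow> v \<noteq> 0 \<Longrightarrow> v \<bullet> (a t *v v) > 0"
    and "\<omega> \<in> Q_vec T m \<pi>"
    and "0 < \<nu>" and "\<nu> < 1" and "holder_on T \<nu> \<omega>"
    and "\<nu> > (sqrt 3 - 1) / 2"
    and "\<And>t. t \<in> {0..T} \<Longrightarrow> (qv_mat m \<pi> \<omega> has_vector_derivative a t) (at t within {0..T})"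
    and "(\<lambda>n. MAX j\<in>{..<m n}. SUP t\<in>{\<pi> n j<..\<pi> n (Suc j)}. norm (\<omega> t - \<omega> (\<pi> n j)))
           \<longlonglongrightarrow> 0"
    \<comment> \<open>\<open>I\<close> is any map following the prescription \<open>\<nabla>F(\<cdot>,\<omega>) \<mapsto> \<integral>\<nabla>F d\<omega>\<close>, whatever representative \<open>F\<close> it uses\<close>
    and "\<And>\<phi>. \<phi> \<in> V_paths T m \<pi> a \<omega> \<Longrightarrow>
           \<exists>F\<in>harmonic_functionals T m \<pi> a \<omega>.
             \<phi> = along T \<omega> (vgrad T F) \<and> I \<phi> = pathwise_integral T m \<pi> \<omega> F"
  shows "V_paths T m \<pi> a \<omega> \<subseteq> L2_space T a \<and>
         H_paths T m \<pi> a \<omega> \<subseteq> Q_scalar T m \<pi> \<and>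
         (\<forall>F\<in>harmonic_functionals T m \<pi> a \<omega>. \<forall>t\<in>{0..T}. convergent (integral_sum T m \<pi> \<omega> F t)) \<and>
         I \<in> V_paths T m \<pi> a \<omega> \<rightarrow> H_paths T m \<pi> a \<omega> \<and>
         (\<forall>F\<in>harmonic_functionals T m \<pi> a \<omega>.
           (\<lambda>t. I (along T \<omega> (vgrad T F)) t - pathwise_integral T m \<pi> \<omega> F t) \<in> Q_scalar T m \<pi> \<and>
           qv_norm T m \<pi> (\<lambda>t. I (along T \<omega> (vgrad T F)) t - pathwise_integral T m \<pi> \<omega> F t) = 0) \<and>
         inj_on I (V_paths T m \<pi> a \<omega>) \<and>
         (\<forall>\<phi>\<in>V_paths T m \<pi> a \<omega>. qv_norm T m \<pi> (I \<phi>) = L2_norm T a \<phi>)"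
proof -
  note T = assms(1) and part = assms(2) and a_cont = assms(3) and a_sym = assms(4) and a_pos = assms(5)
    and Q = assms(6) and qv_deriv = assms(11)
  have conv1: "convergent (qv_sum m \<pi> (\<lambda>s. \<omega> s $ i) t)"
    and conv2: "convergent (qv_sum m \<pi> (\<lambda>s. \<omega> s $ i + \<omega> s $ j) t)" if "t \<in> {0..T}" for i j t
    using Q that by (auto simp: Q_vec_def Q_scalar_def)
  have lim1: "qv_sum m \<pi> (\<lambda>s. \<omega> s $ i) t \<longlonglongrightarrow> qv m \<pi> (\<lambda>s. \<omega> s $ i) t"
    and lim2: "qv_sum m \<pi> (\<lambda>s. \<omega> s $ i + \<omega> s $ j) t \<longlonglongrightarrow> qv m \<pi> (\<lambda>s. \<omega> s $ i + \<omega> s $ j) t"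
    if "t \<in> {0..T}" for i j t
    using conv1[OF that] conv2[OF that] by (simp_all add: qv_def convergent_LIMSEQ_iff)
  have entry_deriv: "((\<lambda>t. qv_mat m \<pi> \<omega> t $ i $ i) has_real_derivative a t $ i $ i) (at t within {0..T})"
    if "t \<in> {0..T}" for i t
    using bounded_linear.has_vector_derivative[OF bounded_linear_vec_nth
      bounded_linear.has_vector_derivative[OF bounded_linear_vec_nth qv_deriv[OF that]]]
    by (simp add: has_real_derivative_iff_has_vector_derivative)
  \<comment> \<open>One diagonal entry is enough to see that the mesh tends to zero; any index will do.\<close>
  define i0 :: 'd where "i0 = undefined"
  have diag: "qv_mat m \<pi> \<omega> t $ i0 $ i0 = qv m \<pi> (\<lambda>s. \<omega> s $ i0) t" if t: "t \<in> {0..T}" for t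
  proof -
    have "qv_sum m \<pi> (\<lambda>s. \<omega> s $ i0 + \<omega> s $ i0) t = (\<lambda>n. 4 * qv_sum m \<pi> (\<lambda>s. \<omega> s $ i0) t n)"
      by (rule ext) (simp add: qv_sum_def sum_distrib_left power2_eq_square algebra_simps)
    then have "qv m \<pi> (\<lambda>s. \<omega> s $ i0 + \<omega> s $ i0) t = 4 * qv m \<pi> (\<lambda>s. \<omega> s $ i0) t"
      using LIMSEQ_unique[OF lim2[OF t, of i0 i0]] tendsto_mult_left[OF lim1[OF t], of 4 i0] by simp
    then show ?thesis by (simp add: qv_mat_def)
  qed
  have deriv0: "(qv m \<pi> (\<lambda>s. \<omega> s $ i0) has_real_derivative a t $ i0 $ i0) (at t within {0..T})" if t: "t \<in> {0..T}" for t
    by (rule has_field_derivative_transform_within[OF entry_deriv[OF t] zero_less_one t]) (simp add: diag)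
  have pos0: "0 < a t $ i0 $ i0" if "t \<in> {0..T}" for t
    using a_pos[OF that, of "axis i0 1"] by (simp add: inner_axis' matrix_vector_mult_basis column_def)
  have mesh: "\<forall>\<^sub>F n in sequentially. \<forall>i<m n. \<pi> n (Suc i) - \<pi> n i < e" if "e > 0" for e
    by (rule mesh_tendsto_0[OF T part conv1 deriv0 pos0 that])
  interpret partitions T m \<pi> by unfold_locales (use T part mesh in auto)
  have path_cont: "continuous_on {0..T} \<omega>"
  proof -
    obtain K where K: "\<And>s t. s \<in> {0..T} \<Longrightarrow> t \<in> {0..T} \<Longrightarrow> norm (\<omega> t - \<omega> s) \<le> K * \<bar>t - s\<bar> powr \<nu>"
      using assms(9) unfolding holder_on_def by blast
    show ?thesis
      unfolding continuous_on_def
    proof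
      fix t assume t: "t \<in> {0..T}"
      have "((\<lambda>s. K * \<bar>s - t\<bar> powr \<nu>) \<longlongrightarrow> K * \<bar>t - t\<bar> powr \<nu>) (at t within {0..T})"
        using assms(7) by (intro tendsto_intros tendsto_powr') auto
      then have "((\<lambda>s. K * \<bar>s - t\<bar> powr \<nu>) \<longlongrightarrow> 0) (at t within {0..T})" by simp
      moreover have "\<forall>\<^sub>F s in at t within {0..T}. norm (\<omega> s - \<omega> t) \<le> K * \<bar>s - t\<bar> powr \<nu>"
        using K[OF t] by (auto simp: eventually_at_topological)
      ultimately have "((\<lambda>s. \<omega> s - \<omega> t) \<longlongrightarrow> 0) (at t within {0..T})" by (rule Lim_null_comparison[rotated])
      then show "(\<omega> \<longlongrightarrow> \<omega> t) (at t within {0..T})" by (simp add: Lim_null[symmetric])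
    qed
  qed
  have outer_lim: "(\<lambda>n. psum n (\<lambda>i. outer (\<omega> (\<pi> n (Suc i)) - \<omega> (\<pi> n i))) t) \<longlonglongrightarrow> qv_mat m \<pi> \<omega> t"
    if t: "t \<in> {0..T}" for t
  proof (intro vec_tendstoI)
    fix j k
    have "psum n (\<lambda>i. outer (\<omega> (\<pi> n (Suc i)) - \<omega> (\<pi> n i))) t $ j $ k
        = (qv_sum m \<pi> (\<lambda>s. \<omega> s $ j + \<omega> s $ k) t n - qv_sum m \<pi> (\<lambda>s. \<omega> s $ j) t n
          - qv_sum m \<pi> (\<lambda>s. \<omega> s $ k) t n) / 2" for n
      unfolding qv_sum_def psum_def outer_def sum_component sum_subtractf[symmetric] sum_divide_distrib
      by (intro sum.cong) (simp_all add: power2_eq_square field_simps)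
    moreover have "(\<lambda>n. (qv_sum m \<pi> (\<lambda>s. \<omega> s $ j + \<omega> s $ k) t n - qv_sum m \<pi> (\<lambda>s. \<omega> s $ j) t n
          - qv_sum m \<pi> (\<lambda>s. \<omega> s $ k) t n) / 2) \<longlonglongrightarrow> qv_mat m \<pi> \<omega> t $ j $ k"
      unfolding qv_mat_def by (auto intro!: tendsto_intros lim1[OF t] lim2[OF t])
    ultimately show "(\<lambda>n. psum n (\<lambda>i. outer (\<omega> (\<pi> n (Suc i)) - \<omega> (\<pi> n i))) t $ j $ k)
        \<longlonglongrightarrow> qv_mat m \<pi> \<omega> t $ j $ k" by (simp only:)
  qed
  have \<nu>_large: "1 / 2 < \<nu> + \<nu>\<^sup>2"
  proof -
    \<comment> \<open>The threshold is the positive root of \<open>\<nu>\<^sup>2 + \<nu> = 1 / 2\<close>; complete the square.\<close>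
    have "(sqrt 3 / 2)\<^sup>2 < (\<nu> + 1 / 2)\<^sup>2"
      using assms(10) by (intro power_strict_mono) (auto simp: field_simps)
    then show ?thesis by (simp add: power2_eq_square field_simps)
  qed
  interpret holder_covariation T m \<pi> \<omega> a "qv_mat m \<pi> \<omega>" \<nu>
    by unfold_locales
      (use path_cont a_cont a_sym qv_deriv outer_lim a_pos assms(7,8,9) \<nu>_large in auto)
  let ?H = "harmonic_functionals T m \<pi> a \<omega>" and ?V = "V_paths T m \<pi> a \<omega>"
  have R: "F \<in> R_space T m \<pi> \<omega>" if "F \<in> ?H" for F by (rule harmonic_D(1)[OF that])
  define F0 where "F0 F = (\<lambda>p. F p - F (0, stop T 0 \<omega>))" for F :: "'d functional"
  have F0: "F0 F \<in> ?H" "pathwise_integral T m \<pi> \<omega> F = along T \<omega> (F0 F)" "vgrad T (F0 F) = vgrad T F" if "F \<in> ?H" for F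
    unfolding F0_def using harmonic_diff_const[OF that] pathwise_integral_eq[OF that] vgrad_diff_const by auto
  \<comment> \<open>The functional that \<open>I\<close> actually uses to represent the integrand \<open>\<phi>\<close>.\<close>
  obtain rep where rep: "\<And>\<phi>. \<phi> \<in> ?V \<Longrightarrow> rep \<phi> \<in> ?H \<and> \<phi> = along T \<omega> (vgrad T (rep \<phi>))
      \<and> I \<phi> = pathwise_integral T m \<pi> \<omega> (rep \<phi>)"
    using assms(13) by metis
  have I_eq: "I \<phi> = along T \<omega> (F0 (rep \<phi>))" if "\<phi> \<in> ?V" for \<phi>
    using rep[OF that] F0(2) by simp
  show ?thesis
  proof (intro conjI)
    show "?V \<subseteq> L2_space T a"
      using along_quadratic_variation(2)[OF R] by (auto simp: V_paths_def)
    show "H_paths T m \<pi> a \<omega> \<subseteq> Q_scalar T m \<pi>"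
      using along_quadratic_variation(1)[OF R] by (auto simp: H_paths_def)
    show "\<forall>F\<in>?H. \<forall>t\<in>{0..T}. convergent (integral_sum T m \<pi> \<omega> F t)"
      using integral_sum_tendsto by (blast intro: convergentI)
    show "I \<in> ?V \<rightarrow> H_paths T m \<pi> a \<omega>"
      using I_eq rep F0(1) unfolding H_paths_def by blast
    show "\<forall>F\<in>?H. (\<lambda>t. I (along T \<omega> (vgrad T F)) t - pathwise_integral T m \<pi> \<omega> F t) \<in> Q_scalar T m \<pi> \<and>
        qv_norm T m \<pi> (\<lambda>t. I (along T \<omega> (vgrad T F)) t - pathwise_integral T m \<pi> \<omega> F t) = 0"
    proof
      fix F assume F: "F \<in> ?H"
      define \<phi> where "\<phi> = along T \<omega> (vgrad T F)"
      have \<phi>: "\<phi> \<in> ?V" using F unfolding \<phi>_def V_paths_def by blast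
      have "along T \<omega> (vgrad T (F0 (rep \<phi>))) = along T \<omega> (vgrad T (F0 F))"
        using rep[OF \<phi>] F0(3) F by (simp add: \<phi>_def)
      from same_gradient_qv_0[OF R[OF F0(1)] R[OF F0(1)[OF F]] this] rep[OF \<phi>]
      show "(\<lambda>t. I (along T \<omega> (vgrad T F)) t - pathwise_integral T m \<pi> \<omega> F t) \<in> Q_scalar T m \<pi> \<and>
        qv_norm T m \<pi> (\<lambda>t. I (along T \<omega> (vgrad T F)) t - pathwise_integral T m \<pi> \<omega> F t) = 0"
        using I_eq[OF \<phi>] F0(2)[OF F] by (simp add: \<phi>_def)
    qed
    show "inj_on I ?V"
    proof (rule inj_onI)
      fix \<phi> \<psi> assume \<phi>: "\<phi> \<in> ?V" and \<psi>: "\<psi> \<in> ?V" and eq: "I \<phi> = I \<psi>"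
      have "along T \<omega> (vgrad T (rep \<phi>)) = along T \<omega> (vgrad T (rep \<psi>))"
      proof (rule same_increments_same_gradient)
        show "rep \<phi> \<in> R_space T m \<pi> \<omega>" "rep \<psi> \<in> R_space T m \<pi> \<omega>" using rep \<phi> \<psi> R by blast+
        fix t assume t: "t \<in> {0..T}"
        have "along T \<omega> (F0 (rep \<phi>)) t = along T \<omega> (F0 (rep \<psi>)) t"
          using eq I_eq[OF \<phi>] I_eq[OF \<psi>] by simp
        then show "fval (rep \<phi>) t - fval (rep \<phi>) 0 = fval (rep \<psi>) t - fval (rep \<psi>) 0"
          using t by (simp add: along_def F0_def)
      qed
      then show "\<phi> = \<psi>" using rep[OF \<phi>] rep[OF \<psi>] by simp
    qed
    show "\<forall>\<phi>\<in>?V. qv_norm T m \<pi> (I \<phi>) = L2_norm T a \<phi>"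
    proof
      fix \<phi> assume \<phi>: "\<phi> \<in> ?V"
      have "qv_norm T m \<pi> (along T \<omega> (F0 (rep \<phi>))) = L2_norm T a (along T \<omega> (vgrad T (F0 (rep \<phi>))))"
        using rep[OF \<phi>] by (intro along_quadratic_variation(3) R F0(1)) blast
      then show "qv_norm T m \<pi> (I \<phi>) = L2_norm T a \<phi>"
        using I_eq[OF \<phi>] rep[OF \<phi>] F0(3) by simp
    qed
  qed
qed

end
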